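(* Let $f$ be a nonconstant meromorphic function on the unit disk $\mathbb{D}$. If $f$ is univalent in $\mathbb{D}$, then $\|Vf\|_3\le 16$, and the number $16$ is sharp (it cannot be replaced by a smaller number). Conversely, if $\|Vf\|_3\le 3/2$, then $f$ is univalent in $\mathbb{D}$.
   Context: $\mathbb{D}=\{z\in\mathbb{C}:|z|<1\}$. A meromorphic function on $\mathbb{D}$ is a holomorphic map into the Riemann sphere $\widehat{\mathbb{C}}=\mathbb{C}\cup\{\infty\}$; univalent means injective. The Schwarzian derivative of a nonconstant meromorphic function $f$ is $Sf=\left(\frac{f''}{f'}\right)'-\frac12\left(\frac{f''}{f'}\right)^2$, a meromorphic function on $\mathbb{D}$ (holomorphic exactly where $f$ is locally injective, simple poles of $f$ included, after removing removable singularities). Define $$Vf(z)=(Sf)'(z)-\frac{4\bar z}{1-|z|^2}\,Sf(z),$$ with value $\infty$ at poles of $Sf$. For a $\widehat{\mathbb{C}}$-valued function $\varphi$ on $\mathbb{D}$ and real $c$, $\|\varphi\|_c=\sup_{z\in\mathbb{D}}(1-|z|^2)^c|\varphi(z)|\in[0,+\infty]$, with $|\infty|=+\infty$. *)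

theory Defs
  imports "HOL-Complex_Analysis.Complex_Analysis"
begin

abbreviation unit_disk :: "complex set" where
  "unit_disk \<equiv> ball 0 1"

text \<open>Points of the Riemann sphere.\<close>

datatype rsphere = Finite complex | Infinity

primrec sphere_abs :: "rsphere \<Rightarrow> ennreal" where
  "sphere_abs (Finite w) = ennreal (cmod w)"
| "sphere_abs Infinity = \<infinity>"

text \<open>
  A function that is nicely meromorphic on the disk is continuous off its poles and takes the
  library's dummy value 0 at its poles. Replacing that dummy value by \<infinity> gives the associated
  holomorphic map into the Riemann sphere. All nonconstant holomorphic maps into the sphere
  arise this way; only the constant map \<infinity> does not.
\<close>

definition sphere_map :: "(complex \<Rightarrow> complex) \<Rightarrow> complex \<Rightarrow> rsphere" where
  "sphere_map f z = (if is_pole f z then Infinity else Finite (f z))"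

definition nonconstant_meromorphic :: "(complex \<Rightarrow> complex) \<Rightarrow> bool" where
  "nonconstant_meromorphic f \<longleftrightarrow>
     f nicely_meromorphic_on unit_disk \<and> \<not> f constant_on unit_disk"

text \<open>Injectivity is that of the sphere-valued map, so \<infinity> is taken at most once.\<close>

definition univalent :: "(complex \<Rightarrow> complex) \<Rightarrow> bool" where
  "univalent f \<longleftrightarrow> inj_on (sphere_map f) unit_disk"

text \<open>
  The pointwise formula is meaningless at poles of \<open>f\<close> and zeros of \<open>deriv f\<close>; these points are
  isolated, and \<open>remove_sings\<close> discards the values there, filling in the limit where the
  singularity is removable.
\<close>

definition schwarzian :: "(complex \<Rightarrow> complex) \<Rightarrow> complex \<Rightarrow> complex" where
  "schwarzian f = remove_sings (\<lambda>z.
     deriv (\<lambda>w. deriv (deriv f) w / deriv f w) z - 1/2 * (deriv (deriv f) z / deriv f z)\<^sup>2)"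

definition V_op :: "(complex \<Rightarrow> complex) \<Rightarrow> complex \<Rightarrow> rsphere" where
  "V_op f z = (if is_pole (schwarzian f) z then Infinity
     else Finite (deriv (schwarzian f) z - 4 * cnj z / (1 - (cmod z)\<^sup>2) * schwarzian f z))"

definition weighted_norm :: "real \<Rightarrow> (complex \<Rightarrow> rsphere) \<Rightarrow> ennreal" where
  "weighted_norm c \<phi> = (SUP z\<in>unit_disk. ennreal ((1 - (cmod z)\<^sup>2) powr c) * sphere_abs (\<phi> z))"

end

theory Submission
  imports Defs
begin

text \<open>
  Precomposition with disk automorphisms and postcomposition with Moebius maps reduce the upper
  bound to the point 0 and to \<open>G z = 1 / z + b\<^sub>0 + b\<^sub>1 z + b\<^sub>2 z\<^sup>2 + \<dots>\<close>, where the quantity in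
  question is \<open>24 \<bar>b\<^sub>2\<bar>\<close>; so one needs \<open>\<bar>b\<^sub>2\<bar> \<le> 2 / 3\<close>. For a value \<open>w\<close> omitted by \<open>G\<close>, Grunsky's
  inequality for \<open>sqrt (G (z\<^sup>2) - w)\<close> gives \<open>\<bar>b\<^sub>2 + (b\<^sub>0 - w)\<^sup>3 / 12\<bar> \<le> 2 / 3\<close>, and the omitted set is
  connected with \<open>b\<^sub>0\<close> in its convex hull, so \<open>w\<close> can be chosen such that the second summand does not
  decrease the modulus. Grunsky's inequality itself expresses that a charge of total mass 0 on the
  image of a circle has nonnegative logarithmic energy. Equality holds for \<open>(1 + z\<^sup>3) powr (2 / 3) / z\<close>
  at 0.

  Conversely, averaging \<open>z V f\<close> over \<open>\<bar>z\<bar> = 1 / 2\<close> recovers \<open>Sf 0\<close>, and by invariance the hypothesis gives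
  \<open>(1 - \<bar>z\<bar>\<^sup>2)\<^sup>2 \<bar>Sf z\<bar> \<le> 4 / 3 < 2\<close>, so univalence follows by Nehari's comparison argument.
\<close>

section \<open>Logarithmic energy\<close>

text \<open>The logarithmic kernel is singular on the diagonal. Both energies, that of the image
  curve and that of the circle itself, are therefore regularized by the same
  \<open>\<epsilon>\<close>, and only their difference is passed to the limit: its limiting kernel
  is the logarithm of a quotient without zeros, so dominated convergence applies. The charge is the
  third harmonic because the square root transform moves the coefficient \<open>b\<^sub>2\<close> to
  the index (3, 3) of the logarithm of that quotient.

  The value \<open>b\<^sub>0\<close> itself may be attained by \<open>G\<close>, so one cannot
  simply take \<open>w = b\<^sub>0\<close>; this is why the geometry of the omitted set enters.

  For the converse, the constant 4 / 3 lies strictly below Nehari's 2. The comparison function is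
  therefore crossed with a strict inequality between the slopes, and no discussion of an equality
  case arises.\<close>

abbreviation unit_square :: "(real \<times> real) set" where
  "unit_square \<equiv> cbox (0, 0) (1, 1)"

lemma unit_square_eq: "unit_square = {0..1} \<times> {0..1}"
  by (simp add: cbox_Pair_eq)

lemma continuous_on_unit_square_fst:
  assumes "continuous_on {0..1} f"
  shows "continuous_on unit_square (\<lambda>x. f (fst x))"
  by (rule continuous_on_compose2[OF assms]) (auto simp: unit_square_eq intro!: continuous_intros)

lemma continuous_on_unit_square_snd:
  assumes "continuous_on {0..1} f"
  shows "continuous_on unit_square (\<lambda>x. f (snd x))"
  by (rule continuous_on_compose2[OF assms]) (auto simp: unit_square_eq intro!: continuous_intros)

lemma integral_unit_square_product:
  fixes f g :: "real \<Rightarrow> real"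
  assumes f: "continuous_on {0..1} f" and g: "continuous_on {0..1} g"
  shows "integral unit_square (\<lambda>x. f (fst x) * g (snd x)) = integral {0..1} f * integral {0..1} g"
proof -
  have "continuous_on unit_square (\<lambda>x. f (fst x) * g (snd x))"
    by (intro continuous_intros continuous_on_unit_square_fst continuous_on_unit_square_snd f g)
  from integral_prod_continuous[OF this] show ?thesis
    by (simp add: cbox_interval)
qed

text \<open>Schur's product theorem for a kernel of finite rank. Expanding one factor of the power
  gives a sum of integrals of the same shape with charges \<open>m s * \<phi> i s\<close>, hence the
  induction over arbitrary \<open>m\<close>. At exponent 0 the value is the square of the integral
  of \<open>m\<close>.\<close>

lemma positive_definite_power:
  fixes \<phi> :: "'i \<Rightarrow> real \<Rightarrow> real"
  assumes "finite I" and \<phi>: "\<And>i. i \<in> I \<Longrightarrow> continuous_on {0..1} (\<phi> i)"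
    and m: "continuous_on {0..1} m"
  shows "0 \<le> integral unit_square
    (\<lambda>x. (\<Sum>i\<in>I. \<phi> i (fst x) * \<phi> i (snd x)) ^ n * (m (fst x) * m (snd x)))"
  using m
proof (induction n arbitrary: m)
  case 0
  then show ?case by (simp add: integral_unit_square_product)
next
  case (Suc n)
  let ?K = "\<lambda>x. \<Sum>i\<in>I. \<phi> i (fst x) * \<phi> i (snd x)"
  let ?m = "\<lambda>i s. m s * \<phi> i s"
  have contm: "continuous_on {0..1} (?m i)" if "i \<in> I" for i
    using Suc.prems \<phi> that by (intro continuous_intros)
  have K: "continuous_on unit_square ?K"
    by (intro continuous_intros continuous_on_unit_square_fst continuous_on_unit_square_snd \<phi>)
  have "integral unit_square (\<lambda>x. ?K x ^ Suc n * (m (fst x) * m (snd x)))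
      = integral unit_square (\<lambda>x. \<Sum>i\<in>I. ?K x ^ n * (?m i (fst x) * ?m i (snd x)))"
    by (intro arg_cong[of _ _ "integral unit_square"] ext)
       (simp add: sum_distrib_left sum_distrib_right mult_ac)
  also have "\<dots> = (\<Sum>i\<in>I. integral unit_square (\<lambda>x. ?K x ^ n * (?m i (fst x) * ?m i (snd x))))"
    by (intro integral_sum assms(1) integrable_continuous continuous_on_mult[OF _ continuous_on_mult]
        continuous_on_power K continuous_on_unit_square_fst[OF contm] continuous_on_unit_square_snd[OF contm])
  also have "\<dots> \<ge> 0"
    using Suc.IH[OF contm] by (intro sum_nonneg) auto
  finally show ?case .
qed

text \<open>The power series of \<open>- ln (1 - K)\<close> has nonnegative coefficients, which
  reduces the claim to powers of the kernel; \<open>\<kappa> < 1\<close> gives the uniform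
  convergence that allows integration term by term.\<close>

lemma positive_definite_log:
  fixes \<phi> :: "'i \<Rightarrow> real \<Rightarrow> real"
  assumes "finite I" and \<phi>: "\<And>i. i \<in> I \<Longrightarrow> continuous_on {0..1} (\<phi> i)"
    and m: "continuous_on {0..1} m" and "\<kappa> < 1"
    and bound: "\<And>x. x \<in> unit_square \<Longrightarrow> \<bar>\<Sum>i\<in>I. \<phi> i (fst x) * \<phi> i (snd x)\<bar> \<le> \<kappa>"
  shows "integral unit_square
    (\<lambda>x. ln (1 - (\<Sum>i\<in>I. \<phi> i (fst x) * \<phi> i (snd x))) * (m (fst x) * m (snd x))) \<le> 0"
proof -
  let ?K = "\<lambda>x. \<Sum>i\<in>I. \<phi> i (fst x) * \<phi> i (snd x)"
  let ?g = "\<lambda>n x. (?K x ^ Suc n * (m (fst x) * m (snd x))) / Suc n"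
  have K: "continuous_on unit_square ?K"
    by (intro continuous_intros continuous_on_unit_square_fst continuous_on_unit_square_snd \<phi>)
  have mm: "continuous_on unit_square (\<lambda>x. m (fst x) * m (snd x))"
    by (intro continuous_intros continuous_on_unit_square_fst continuous_on_unit_square_snd m)
  have "bounded ((\<lambda>x. m (fst x) * m (snd x)) ` unit_square)"
    by (intro compact_imp_bounded compact_continuous_image mm compact_cbox)
  then obtain M where M: "\<And>x. x \<in> unit_square \<Longrightarrow> \<bar>m (fst x) * m (snd x)\<bar> \<le> M"
    unfolding bounded_iff ball_simps real_norm_def by blast
  have k0: "0 \<le> \<kappa>"
    using bound[of "(0,0)"] by (force simp: unit_square_eq)
  have unif: "uniform_limit unit_square (\<lambda>n x. \<Sum>i<n. ?g i x) (\<lambda>x. \<Sum>i. ?g i x) sequentially"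
  proof (rule Weierstrass_m_test)
    show "summable (\<lambda>n. M * \<kappa> ^ Suc n)"
      using k0 \<open>\<kappa> < 1\<close> by (intro summable_mult) (simp add: summable_geometric)
    fix n x assume x: "x \<in> unit_square"
    have "norm (?g n x) \<le> \<bar>?K x ^ Suc n\<bar> * \<bar>m (fst x) * m (snd x)\<bar> / 1"
      unfolding real_norm_def abs_divide abs_mult by (intro frac_le) (auto simp: abs_mult)
    also have "\<dots> \<le> \<kappa> ^ Suc n * M"
      unfolding power_abs div_by_1
      using bound[OF x] M[OF x] k0 by (intro mult_mono power_mono) auto
    finally show "norm (?g n x) \<le> M * \<kappa> ^ Suc n" by (simp add: mult_ac)
  qed
  have sum_eq: "(\<Sum>i. ?g i x) = - (ln (1 - ?K x) * (m (fst x) * m (snd x)))" if x: "x \<in> unit_square" for x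
  proof -
    have K1: "\<bar>?K x\<bar> < 1" using bound[OF x] \<open>\<kappa> < 1\<close> by simp
    then have "(\<lambda>n. - (?K x ^ n / real n)) sums ln (1 - ?K x)"
      using ln_series'[of "- ?K x"] by simp
    then have "(\<lambda>n. ?K x ^ n / real n) sums - ln (1 - ?K x)"
      using sums_minus by fastforce
    \<comment> \<open>The term for \<open>n = 0\<close> is a division by 0, hence 0, so the shift of
      the index does not change the sum.\<close>
    then have "(\<lambda>n. ?K x ^ Suc n / real (Suc n)) sums - ln (1 - ?K x)"
      by (subst sums_Suc_iff) auto
    from sums_mult2[OF this, of "m (fst x) * m (snd x)"] show ?thesis
      by (simp add: sums_iff mult_ac)
  qed
  have gcont: "continuous_on unit_square (\<lambda>x. \<Sum>i<n. ?g i x)" for n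
    by (intro continuous_intros K mm) auto
  obtain I' J where IJ: "\<And>n. ((\<lambda>x. \<Sum>i<n. ?g i x) has_integral I' n) unit_square"
      "((\<lambda>x. \<Sum>i. ?g i x) has_integral J) unit_square" "I' \<longlonglongrightarrow> J"
    by (rule uniform_limit_integral_cbox[OF unif gcont trivial_limit_sequentially]) (rule that)
  have "0 \<le> I' n" for n
  proof -
    have "I' n = integral unit_square (\<lambda>x. \<Sum>i<n. ?g i x)"
      by (rule integral_unique[symmetric], rule IJ)
    also have "\<dots> = (\<Sum>i<n. integral unit_square (?g i))"
      by (intro integral_sum integrable_continuous continuous_intros K mm) auto
    also have "\<dots> \<ge> 0"
      using positive_definite_power[OF assms(1) \<phi> m]
      by (intro sum_nonneg) (auto intro!: divide_nonneg_nonneg simp del: power_Suc)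
    finally show ?thesis .
  qed
  then have "J \<ge> 0" using IJ(3) by (meson LIMSEQ_le_const)
  moreover have "((\<lambda>x. - (ln (1 - ?K x) * (m (fst x) * m (snd x)))) has_integral J) unit_square"
    using IJ(2) sum_eq by (subst has_integral_cong[where g="\<lambda>x. \<Sum>i. ?g i x"]) auto
  then have "((\<lambda>x. ln (1 - ?K x) * (m (fst x) * m (snd x))) has_integral -J) unit_square"
    using has_integral_neg_iff by fastforce
  ultimately show ?thesis by (simp add: integral_unique)
qed

text \<open>
  The kernel is conditionally negative definite: dividing its argument by the product
  \<open>a s * a t\<close>, where \<open>a = (\<epsilon> + \<bar>w\<bar>\<^sup>2) / sqrt \<epsilon>\<close>, leaves \<open>1 - K\<close> with a positive definite
  \<open>K\<close>, and a charge of total mass 0 does not see the two factors.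
\<close>
lemma regularized_log_energy:
  fixes w :: "real \<Rightarrow> complex" and m :: "real \<Rightarrow> real"
  assumes w: "continuous_on {0..1} w" and m: "continuous_on {0..1} m"
    and m0: "integral {0..1} m = 0" and "\<epsilon> > 0"
  shows "integral unit_square
    (\<lambda>x. ln ((cmod (w (fst x) - w (snd x)))\<^sup>2 + \<epsilon>) * (m (fst x) * m (snd x))) \<le> 0"
proof -
  define a where "a = (\<lambda>s. (\<epsilon> + (cmod (w s))\<^sup>2) / sqrt \<epsilon>)"
  have apos: "a s > 0" for s
    unfolding a_def using \<open>\<epsilon> > 0\<close> by (intro divide_pos_pos) (auto intro: add_pos_nonneg)
  have a: "continuous_on {0..1} a"
    unfolding a_def using \<open>\<epsilon> > 0\<close> by (intro continuous_intros w) auto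
  \<comment> \<open>The remainder \<open>a s * a t - (cmod (w s - w t))\<^sup>2 - \<epsilon>\<close>
    equals \<open>(cmod (w s))\<^sup>2 * (cmod (w t))\<^sup>2 / \<epsilon> + 2 * Re (w s * cnj (w
    t))\<close>, a sum of three products of a function of s with the same function of t; these are
    the three components.\<close>
  define \<phi> where "\<phi> = (\<lambda>(i::nat) s. (if i = 0 then (cmod (w s))\<^sup>2 / sqrt \<epsilon> else
     if i = 1 then sqrt 2 * Re (w s) else sqrt 2 * Im (w s)) / a s)"
  have \<phi>: "continuous_on {0..1} (\<phi> i)" for i
    unfolding \<phi>_def using apos[THEN less_imp_neq] w a \<open>\<epsilon> > 0\<close> 
    by (cases "i = 0"; cases "i = 1") (auto intro!: continuous_intros)
  let ?K = "\<lambda>x. \<Sum>i\<in>{0,1,2::nat}. \<phi> i (fst x) * \<phi> i (snd x)"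
  have Keq: "?K (s,t) = ((cmod (w s))\<^sup>2 * (cmod (w t))\<^sup>2 / \<epsilon> + 2 * Re (w s * cnj (w t))) / (a s * a t)" for s t
    using \<open>\<epsilon> > 0\<close> apos[of s] apos[of t]
    by (simp add: \<phi>_def divide_simps) (simp add: algebra_simps)
  have aa: "a s * a t = \<epsilon> + (cmod (w s))\<^sup>2 + (cmod (w t))\<^sup>2 + (cmod (w s))\<^sup>2 * (cmod (w t))\<^sup>2 / \<epsilon>" for s t
    using \<open>\<epsilon> > 0\<close> by (simp add: a_def field_simps)
  have d1: "(cmod (u - v))\<^sup>2 = (cmod u)\<^sup>2 + (cmod v)\<^sup>2 - 2 * Re (u * cnj v)" for u v
    unfolding cmod_power2 by (simp add: power2_eq_square algebra_simps)
  have d2: "(cmod (u + v))\<^sup>2 = (cmod u)\<^sup>2 + (cmod v)\<^sup>2 + 2 * Re (u * cnj v)" for u v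
    unfolding cmod_power2 by (simp add: power2_eq_square algebra_simps)
  have one_minus: "1 - ?K (s,t) = ((cmod (w s - w t))\<^sup>2 + \<epsilon>) / (a s * a t)" for s t
  proof -
    have "1 - ?K (s,t) = (a s * a t - ((cmod (w s))\<^sup>2 * (cmod (w t))\<^sup>2 / \<epsilon> + 2 * Re (w s * cnj (w t)))) / (a s * a t)"
      unfolding Keq using apos[of s] apos[of t] by (simp only: diff_divide_distrib) simp
    then show ?thesis unfolding aa[of s t] d1 by simp
  qed
  have one_plus: "1 + ?K (s,t) = ((cmod (w s + w t))\<^sup>2 + \<epsilon> + 2 * ((cmod (w s))\<^sup>2 * (cmod (w t))\<^sup>2 / \<epsilon>)) / (a s * a t)" for s t
  proof -
    have "1 + ?K (s,t) = (a s * a t + ((cmod (w s))\<^sup>2 * (cmod (w t))\<^sup>2 / \<epsilon> + 2 * Re (w s * cnj (w t)))) / (a s * a t)"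
      unfolding Keq using apos[of s] apos[of t] by (simp only: add_divide_distrib) simp
    then show ?thesis unfolding aa[of s t] d2 by simp
  qed
  have "bounded (a ` {0..1})"
    by (intro compact_imp_bounded compact_continuous_image a) auto
  then obtain A where A: "\<And>s. s \<in> {0..1} \<Longrightarrow> a s \<le> A"
    unfolding bounded_iff by (fastforce simp: abs_le_iff)
  have Apos: "A > 0" using A[of 0] apos[of 0] by simp
  have low: "\<epsilon> / (A * A) \<le> u / (a s * a t)" if "s \<in> {0..1}" "t \<in> {0..1}" "u \<ge> \<epsilon>" for s t u
    using that A apos \<open>\<epsilon> > 0\<close> by (intro frac_le mult_mono mult_pos_pos) (auto simp: less_imp_le Apos)
  \<comment> \<open>The logarithmic series needs distance from both 1 and -1. The numerators of
    \<open>1 - K\<close> and of \<open>1 + K\<close> are at least \<open>\<epsilon>\<close>, and the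
    common denominator is at most \<open>A * A\<close>.\<close>
  have bound: "\<bar>?K x\<bar> \<le> 1 - \<epsilon> / (A * A)" if x: "x \<in> unit_square" for x
  proof -
    obtain s t where st: "x = (s,t)" "s \<in> {0..1}" "t \<in> {0..1}"
      using x by (auto simp: unit_square_eq)
    have "\<epsilon> / (A * A) \<le> 1 - ?K (s,t)" unfolding one_minus
      by (rule low) (use st in auto)
    moreover have "\<epsilon> / (A * A) \<le> 1 + ?K (s,t)" unfolding one_plus
      by (rule low) (use st \<open>\<epsilon> > 0\<close> in auto)
    ultimately show ?thesis unfolding st(1) by linarith
  qed
  have "integral unit_square (\<lambda>x. ln (1 - ?K x) * (m (fst x) * m (snd x))) \<le> 0"
    by (rule positive_definite_log[where \<kappa>="1 - \<epsilon> / (A * A)"])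
       (use \<phi> m bound \<open>\<epsilon> > 0\<close> Apos in auto)
  moreover have "integral unit_square (\<lambda>x. ln ((cmod (w (fst x) - w (snd x)))\<^sup>2 + \<epsilon>) * (m (fst x) * m (snd x)))
    = integral unit_square (\<lambda>x. ln (1 - ?K x) * (m (fst x) * m (snd x)))"
  proof -
    have lna: "continuous_on {0..1} (\<lambda>s. ln (a s) * m s)"
      using apos by (intro continuous_intros a m) (metis less_irrefl)
    have "ln ((cmod (w (fst x) - w (snd x)))\<^sup>2 + \<epsilon>) * (m (fst x) * m (snd x))
       = ln (1 - ?K x) * (m (fst x) * m (snd x)) + (ln (a (fst x)) * m (fst x)) * m (snd x)
         + m (fst x) * (ln (a (snd x)) * m (snd x))" for x
    proof -
      obtain s t where st: "x = (s,t)" by fastforce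
      have "(cmod (w s - w t))\<^sup>2 + \<epsilon> = (1 - ?K (s,t)) * (a s * a t)"
        unfolding one_minus using apos[of s] apos[of t] by simp
      moreover have "1 - ?K (s,t) > 0"
        unfolding one_minus using apos[of s] apos[of t] \<open>\<epsilon> > 0\<close>
        by (intro divide_pos_pos) (auto intro: add_nonneg_pos)
      ultimately have "ln ((cmod (w s - w t))\<^sup>2 + \<epsilon>) = ln (1 - ?K (s,t)) + ln (a s) + ln (a t)"
        using apos[of s] apos[of t] by (simp add: ln_mult_pos)
      then show ?thesis unfolding st fst_conv snd_conv by (simp add: algebra_simps)
    qed
    moreover have K: "continuous_on unit_square (\<lambda>x. ln (1 - ?K x) * (m (fst x) * m (snd x)))"
    proof (intro continuous_intros continuous_on_unit_square_fst continuous_on_unit_square_snd \<phi> m ballI)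
      fix x assume x: "x \<in> unit_square"
      have "\<epsilon> / (A * A) > 0" using Apos \<open>\<epsilon> > 0\<close> by simp
      then show "1 - ?K x \<noteq> 0" using bound[OF x] by linarith
    qed
    moreover have A: "continuous_on unit_square (\<lambda>x. (ln (a (fst x)) * m (fst x)) * m (snd x))"
      by (intro continuous_on_mult[OF continuous_on_unit_square_fst[OF lna]] continuous_on_unit_square_snd m)
    moreover have B: "continuous_on unit_square (\<lambda>x. m (fst x) * (ln (a (snd x)) * m (snd x)))"
      by (intro continuous_on_mult[OF _ continuous_on_unit_square_snd[OF lna]] continuous_on_unit_square_fst m)
    ultimately have "integral unit_square (\<lambda>x. ln ((cmod (w (fst x) - w (snd x)))\<^sup>2 + \<epsilon>) * (m (fst x) * m (snd x)))
      = integral unit_square (\<lambda>x. ln (1 - ?K x) * (m (fst x) * m (snd x)))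
       + integral unit_square (\<lambda>x. (ln (a (fst x)) * m (fst x)) * m (snd x))
       + integral unit_square (\<lambda>x. m (fst x) * (ln (a (snd x)) * m (snd x)))"
      by (simp only: integral_add integrable_add integrable_continuous)
    then show ?thesis
      using integral_unit_square_product[OF lna m] integral_unit_square_product[OF m lna] m0
      by simp
  qed
  ultimately show ?thesis by simp
qed

section \<open>Fourier coefficients on circles and the energy of the third harmonic\<close>

text \<open>Cauchy's formula as an average: along \<open>circlepath\<close> the differential dz / z
  is 2 pi i dt, which absorbs the factor 2 pi i and one power of the denominator.\<close>

lemma circlepath_integral_coeff:
  assumes f: "f holomorphic_on ball 0 R" "f has_fps_expansion F" and r: "0 < r" "r < R"
  shows "((\<lambda>t. f (circlepath 0 r t) / circlepath 0 r t ^ n) has_integral fps_nth F n) {0..1}"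
proof -
  let ?g = "circlepath 0 r"
  have "((\<lambda>u. f u / (u - 0) ^ (Suc n)) has_contour_integral
      ((2 * pi * \<i>) / (fact n) * (deriv ^^ n) f 0)) ?g"
    using r by (intro Cauchy_has_contour_integral_higher_derivative_circlepath
      holomorphic_on_imp_continuous_on holomorphic_on_subset[OF f(1)]) auto
  then have "((\<lambda>t. f (?g t) / ?g t ^ Suc n * vector_derivative ?g (at t within {0..1}))
      has_integral ((2 * pi * \<i>) * fps_nth F n)) {0..1}"
    by (simp add: has_contour_integral_def fps_nth_fps_expansion[OF f(2)])
  moreover have "vector_derivative ?g (at t within {0..1}) = 2 * pi * \<i> * ?g t" if "t \<in> {0..1}" for t
    using that by (simp add: vector_derivative_circlepath01) (simp add: circlepath)
  moreover have "?g t \<noteq> 0" for t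
    using r by (simp add: circlepath)
  ultimately have "((\<lambda>t. 2 * pi * \<i> * (f (?g t) / ?g t ^ n)) has_integral ((2 * pi * \<i>) * fps_nth F n)) {0..1}"
    by (elim has_integral_eq[rotated]) (simp add: field_simps)
  from has_integral_mult_right[OF this, of "1 / (2 * pi * \<i>)"] show ?thesis
    by simp
qed

lemma circlepath_integral_mult:
  assumes f: "f holomorphic_on ball 0 R" and r: "0 < r" "r < R"
  shows "((\<lambda>t. f (circlepath 0 r t) * circlepath 0 r t ^ Suc n) has_integral 0) {0..1}"
proof -
  have "f analytic_on {0}"
    using f r by (meson analytic_on_holomorphic centre_in_ball insert_subset open_ball subset_singletonD empty_subsetI less_trans)
  then obtain F where F: "f has_fps_expansion F"
    using analytic_at_imp_has_fps_expansion_0 by blast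
  have "((\<lambda>t. f (circlepath 0 r t) * circlepath 0 r t ^ Suc n / circlepath 0 r t ^ 0)
      has_integral fps_nth (F * fps_X ^ Suc n) 0) {0..1}"
    by (rule circlepath_integral_coeff[OF _ _ r])
       (intro holomorphic_intros f fps_expansion_intros F)+
  then show ?thesis by simp
qed

text \<open>Integration against this charge selects a third Fourier coefficient; the phase of
  \<open>\<mu>\<close> determines which real part of it is seen.\<close>

definition trig_charge :: "real \<Rightarrow> complex \<Rightarrow> real \<Rightarrow> real" where
  "trig_charge r \<mu> t = Re (\<mu> * circlepath 0 r t ^ 3)"

lemma continuous_on_trig_charge [continuous_intros]: "continuous_on S (trig_charge r \<mu>)"
  unfolding trig_charge_def circlepath by (intro continuous_intros)

lemma cnj_circlepath_cube:
  assumes "r > 0"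
  shows "cnj (circlepath 0 r t ^ 3) = r ^ 6 / circlepath 0 r t ^ 3"
proof -
  have "circlepath 0 r t * cnj (circlepath 0 r t) = r ^ 2"
    using assms complex_norm_square[of "circlepath 0 r t"]
    by (simp add: circlepath norm_mult)
  then have "(circlepath 0 r t * cnj (circlepath 0 r t)) ^ 3 = r ^ 6"
    by (simp flip: power_mult of_real_power)
  moreover have "circlepath 0 r t \<noteq> 0"
    using assms by (simp add: circlepath)
  ultimately show ?thesis by (simp add: power_mult_distrib field_simps)
qed

lemma Re_of_real_mult: "Re (complex_of_real a * z) = a * Re z"
  by simp

text \<open>On the circle the conjugate of \<open>z ^ 3\<close> is \<open>r ^ 6 / z ^ 3\<close>.
  This turns a product of two real parts into real parts of Laurent series, which the averages over
  circles can evaluate.\<close>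

lemma Re_mult_trig_charge:
  assumes "r > 0"
  shows "Re z * trig_charge r \<mu> t =
    Re (\<mu> * (z * circlepath 0 r t ^ 3)) / 2 + Re (cnj \<mu> * r ^ 6 * (z / circlepath 0 r t ^ 3)) / 2"
proof -
  have "Re z * Re b = Re (z * b) / 2 + Re (z * cnj b) / 2" for b
    by (simp add: field_simps)
  from this[of "\<mu> * circlepath 0 r t ^ 3"] show ?thesis
    unfolding trig_charge_def complex_cnj_mult cnj_circlepath_cube[OF assms]
    by (simp add: mult_ac)
qed

lemma integral_Re_trig_charge:
  assumes f: "f holomorphic_on ball 0 R" "f has_fps_expansion F" and r: "0 < r" "r < R"
  shows "((\<lambda>t. Re (f (circlepath 0 r t)) * trig_charge r \<mu> t) has_integral
     r ^ 6 / 2 * Re (cnj \<mu> * fps_nth F 3)) {0..1}"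
proof -
  have "((\<lambda>t. \<mu> * (f (circlepath 0 r t) * circlepath 0 r t ^ Suc 2)) has_integral \<mu> * 0) {0..1}"
    by (intro has_integral_mult_right circlepath_integral_mult[OF f(1) r])
  moreover have "((\<lambda>t. cnj \<mu> * r ^ 6 * (f (circlepath 0 r t) / circlepath 0 r t ^ 3)) has_integral
     cnj \<mu> * r ^ 6 * fps_nth F 3) {0..1}"
    by (intro has_integral_mult_right circlepath_integral_coeff[OF f r])
  ultimately have "((\<lambda>t. Re (\<mu> * (f (circlepath 0 r t) * circlepath 0 r t ^ 3)) / 2 +
      Re (cnj \<mu> * r ^ 6 * (f (circlepath 0 r t) / circlepath 0 r t ^ 3)) / 2) has_integral
      (Re (\<mu> * 0) / 2 + Re (cnj \<mu> * r ^ 6 * fps_nth F 3) / 2)) {0..1}"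
    by (intro has_integral_add has_integral_divide has_integral_Re) (auto simp: eval_nat_numeral)
  then show ?thesis
    unfolding Re_mult_trig_charge[OF r(1)]
    using Re_of_real_mult[of "r ^ 6" "cnj \<mu> * fps_nth F 3"] by (simp add: mult_ac)
qed

text \<open>For the outer of the two energy integrals, whose integrand has a pole of order 3 at 0:
  the two exponentials in the charge now select the coefficients 0 and 6.\<close>

lemma integral_Re_pole_trig_charge:
  assumes f: "f holomorphic_on ball 0 R" "f has_fps_expansion F" and r: "0 < r" "r < R"
  shows "((\<lambda>t. Re (c * (f (circlepath 0 r t) / circlepath 0 r t ^ 3)) * trig_charge r \<mu> t) has_integral
     (Re (c * \<mu> * fps_nth F 0) + r ^ 6 * Re (c * cnj \<mu> * fps_nth F 6)) / 2) {0..1}"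
proof -
  have nz: "circlepath 0 r t \<noteq> 0" for t using r by (simp add: circlepath)
  have "((\<lambda>t. c * \<mu> * (f (circlepath 0 r t) / circlepath 0 r t ^ 0)) has_integral c * \<mu> * fps_nth F 0) {0..1}"
    by (intro has_integral_mult_right circlepath_integral_coeff[OF f r])
  moreover have "((\<lambda>t. c * cnj \<mu> * r ^ 6 * (f (circlepath 0 r t) / circlepath 0 r t ^ 6)) has_integral
     c * cnj \<mu> * r ^ 6 * fps_nth F 6) {0..1}"
    by (intro has_integral_mult_right circlepath_integral_coeff[OF f r])
  ultimately have key: "((\<lambda>t. Re (c * \<mu> * (f (circlepath 0 r t) / circlepath 0 r t ^ 0)) / 2 +
      Re (c * cnj \<mu> * r ^ 6 * (f (circlepath 0 r t) / circlepath 0 r t ^ 6)) / 2) has_integral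
      (Re (c * \<mu> * fps_nth F 0) / 2 + Re (c * cnj \<mu> * r ^ 6 * fps_nth F 6) / 2)) {0..1}"
    by (intro has_integral_add has_integral_divide has_integral_Re)
  have eq3: "Re (c * cnj \<mu> * r ^ 6 * fps_nth F 6) = r ^ 6 * Re (c * cnj \<mu> * fps_nth F 6)"
    using Re_of_real_mult[of "r ^ 6" "c * cnj \<mu> * fps_nth F 6"] by (simp only: of_real_power mult_ac)
  have eq1: "\<mu> * (c * (f (circlepath 0 r t) / circlepath 0 r t ^ 3) * circlepath 0 r t ^ 3)
       = c * \<mu> * (f (circlepath 0 r t) / circlepath 0 r t ^ 0)" for t
    using nz[of t] by simp
  have eq2: "cnj \<mu> * r ^ 6 * (c * (f (circlepath 0 r t) / circlepath 0 r t ^ 3) / circlepath 0 r t ^ 3) =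
      c * cnj \<mu> * r ^ 6 * (f (circlepath 0 r t) / circlepath 0 r t ^ 6)" for t
    using nz[of t] by (simp add: field_simps flip: power_add)
  show ?thesis
    unfolding Re_mult_trig_charge[OF r(1)] eq1 eq2 using key unfolding eq3
    by (simp only: add_divide_distrib)
qed

lemma integral_trig_charge:
  assumes "r > 0"
  shows "integral {0..1} (trig_charge r \<mu>) = 0"
proof -
  have "((\<lambda>t. Re (1::complex) * trig_charge r \<mu> t) has_integral r ^ 6 / 2 * Re (cnj \<mu> * fps_nth 1 3)) {0..1}"
    by (rule integral_Re_trig_charge[where f="\<lambda>_. 1" and R="r+1"]) (use assms in auto)
  then show ?thesis by (simp add: integral_unique)
qed

text \<open>Compare coefficients in \<open>deriv Q = deriv l * Q\<close>. The branch of the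
  logarithm affects only the constant term of \<open>L\<close>.\<close>

lemma log_third_coeff:
  fixes l Q :: "complex \<Rightarrow> complex"
  assumes l: "l has_fps_expansion L" and Q: "Q has_fps_expansion E" and E0: "fps_nth E 0 = 1"
    and eq: "eventually (\<lambda>z. exp (l z) = Q z) (nhds 0)"
  shows "fps_nth L 3 = fps_nth E 3 - fps_nth E 1 * fps_nth E 2 + fps_nth E 1 ^ 3 / 3"
proof -
  obtain A where A: "open A" "0 \<in> A" "l holomorphic_on A"
    using has_fps_expansion_imp_holomorphic[OF l] by metis
  obtain B where B: "open B" "0 \<in> B" "\<And>z. z \<in> B \<Longrightarrow> exp (l z) = Q z"
    using eq unfolding eventually_nhds by blast
  have "deriv Q z = deriv l z * Q z" if z: "z \<in> A \<inter> B" for z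
  proof -
    have "(l has_field_derivative deriv l z) (at z)"
      using A that holomorphic_derivI by blast
    then have "((\<lambda>z. exp (l z)) has_field_derivative exp (l z) * deriv l z) (at z)"
      by (auto intro!: derivative_eq_intros)
    then have "(Q has_field_derivative exp (l z) * deriv l z) (at z)"
      by (rule has_field_derivative_transform_within_open[where S="A \<inter> B"]) (use A B z in auto)
    then show ?thesis using B z by (auto simp: DERIV_imp_deriv)
  qed
  then have "eventually (\<lambda>z. deriv Q z = deriv l z * Q z) (nhds 0)"
    using A B unfolding eventually_nhds by (intro exI[of _ "A \<inter> B"]) auto
  moreover have "(\<lambda>z. deriv l z * Q z) has_fps_expansion fps_deriv L * E"
    by (intro fps_expansion_intros l Q)
  ultimately have "deriv Q has_fps_expansion fps_deriv L * E"
    by (subst has_fps_expansion_cong) auto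
  then have eqs: "fps_deriv E = fps_deriv L * E"
    using fps_expansion_unique_complex has_fps_expansion_deriv[OF Q] by blast
  have "fps_nth (fps_deriv E) 0 = fps_nth (fps_deriv L * E) 0"
    "fps_nth (fps_deriv E) 1 = fps_nth (fps_deriv L * E) 1"
    "fps_nth (fps_deriv E) 2 = fps_nth (fps_deriv L * E) 2"
    using eqs by simp_all
  then have "fps_nth E 1 = fps_nth L 1" "2 * fps_nth E 2 = fps_nth L 1 * fps_nth E 1 + 2 * fps_nth L 2"
    "3 * fps_nth E 3 = fps_nth L 1 * fps_nth E 2 + 2 * fps_nth L 2 * fps_nth E 1 + 3 * fps_nth L 3"
    by (simp_all add: fps_mult_nth E0 eval_nat_numeral)
  then show ?thesis by (simp add: field_simps power3_eq_cube)
qed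

text \<open>The kernel \<open>ln \<bar>1 - q e^{2 pi i (s - t)}\<bar>^2\<close> on the circle has third Fourier coefficient \<open>-q^3/3\<close>.\<close>
lemma circle_log_energy:
  assumes r: "r > 0" and \<mu>: "cmod \<mu> = 1" and e: "\<epsilon> > 0"
  shows "- (r ^ 6 / 6) \<le> integral unit_square
    (\<lambda>x. ln ((cmod (1 / circlepath 0 r (fst x) - 1 / circlepath 0 r (snd x)))\<^sup>2 + \<epsilon>) *
         (trig_charge r \<mu> (fst x) * trig_charge r \<mu> (snd x)))"
proof -
  let ?g = "circlepath 0 r" and ?m = "trig_charge r \<mu>"
  \<comment> \<open>The regularized kernel is \<open>2 / r\<^sup>2 * (b - Re v)\<close> with
    \<open>v\<close> the quotient of the two points. As \<open>q\<close> is the root in (0, 1) of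
    \<open>1 + q\<^sup>2 = 2 * q * b\<close>, this is again a constant times the square of
    \<open>cmod (1 - q * v)\<close>: regularizing amounts to shrinking by \<open>q\<close>.\<close>
  define b where "b = 1 + \<epsilon> * r\<^sup>2 / 2"
  define q where "q = b - sqrt (b\<^sup>2 - 1)"
  have b: "b > 1" using r e by (simp add: b_def)
  have "b\<^sup>2 > 1" using b by (simp add: power_strict_increasing one_less_power)
  have "sqrt (b\<^sup>2 - 1) < b" using b by (intro real_less_lsqrt) auto
  then have q0: "q > 0" by (simp add: q_def)
  have "(b - 1)\<^sup>2 < b\<^sup>2 - 1" using b by (simp add: power2_eq_square algebra_simps)
  then have "b - 1 < sqrt (b\<^sup>2 - 1)" using b by (intro real_less_rsqrt) auto
  then have q1: "q < 1" by (simp add: q_def)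
  have qb: "1 + q\<^sup>2 = 2 * q * b"
    using \<open>b\<^sup>2 > 1\<close> by (simp add: q_def power2_eq_square algebra_simps)
  have nz: "?g t \<noteq> 0" and cmodg: "cmod (?g t) = r" for t
    using r by (auto simp: circlepath norm_mult)
  have kernel: "(cmod (1 / ?g s - 1 / ?g t))\<^sup>2 + \<epsilon> = 1 / (q * r\<^sup>2) * (cmod (1 - q * (?g t / ?g s)))\<^sup>2" for s t
  proof -
    have *: "(cmod (1 - c * v))\<^sup>2 = 1 + c\<^sup>2 - 2 * c * Re v" if "cmod v = 1" for v :: complex and c :: real
    proof -
      have "Im v * Im v = 1 - Re v * Re v"
        using that cmod_power2[of v] by (simp add: power2_eq_square)
      then have "c * c * (Im v * Im v) = c * c * (1 - Re v * Re v)" by simp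
      then show ?thesis
        unfolding cmod_power2[of "1 - c * v"] by (simp add: power2_eq_square algebra_simps)
    qed
    have v: "cmod (?g t / ?g s) = 1" using r by (simp add: norm_divide cmodg)
    have "1 / ?g s - 1 / ?g t = (?g t / ?g s - 1) / ?g t" using nz by (simp add: field_simps)
    then have "(cmod (1 / ?g s - 1 / ?g t))\<^sup>2 = (cmod (1 - ?g t / ?g s))\<^sup>2 / r\<^sup>2"
      by (simp add: norm_divide cmodg power_divide norm_minus_commute)
    also have "\<dots> = (2 - 2 * Re (?g t / ?g s)) / r\<^sup>2"
      using *[OF v, of 1] by simp
    also have "\<dots> + \<epsilon> = 1 / (q * r\<^sup>2) * (1 + q\<^sup>2 - 2 * q * Re (?g t / ?g s))"
      unfolding qb using q0 r by (simp add: b_def field_simps power2_eq_square)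
    finally show ?thesis using *[OF v, of q] by simp
  qed
  have pos: "1 - q * (?g t / ?g s) \<noteq> 0" for s t
  proof
    assume "1 - q * (?g t / ?g s) = 0"
    then have "cmod (q * (?g t / ?g s)) = 1" by (metis eq_iff_diff_eq_0 norm_one)
    then show False using q0 q1 r by (simp add: norm_mult norm_divide cmodg)
  qed
  define C where "C = ln (1 / (q * r\<^sup>2))"
  have ln_kernel: "ln ((cmod (1 / ?g s - 1 / ?g t))\<^sup>2 + \<epsilon>) = C + 2 * Re (Ln (1 - q * (?g t / ?g s)))" for s t
    unfolding kernel C_def using q0 r pos[of t s] by (subst ln_mult_pos) (auto simp: ln_realpow)
  have inner: "integral {0..1} (\<lambda>t. ln ((cmod (1 / ?g s - 1 / ?g t))\<^sup>2 + \<epsilon>) * ?m t)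
     = - (q ^ 3 / 3 * ?m s)" for s
  proof -
    \<comment> \<open>This branch is holomorphic on the disk of radius \<open>r / q\<close>, and
      \<open>q < 1\<close> puts the circle of integration inside that disk.\<close>
    define l where "l = (\<lambda>z. Ln (1 - q * (z / ?g s)))"
    have Re_pos: "Re (1 - q * (z / ?g s)) > 0" if "z \<in> ball 0 (r / q)" for z
    proof -
      have "\<bar>Re (q * (z / ?g s))\<bar> \<le> cmod (q * (z / ?g s))" by (rule abs_Re_le_cmod)
      also have "\<dots> < 1" using that q0 r by (simp add: norm_mult norm_divide cmodg field_simps)
      finally show ?thesis by simp
    qed
    then have nonpos: "1 - q * (z / ?g s) \<notin> \<real>\<^sub>\<le>\<^sub>0" if "z \<in> ball 0 (r / q)" for z
      using that by (metis complex_nonpos_Reals_iff not_less)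
    have hol: "l holomorphic_on ball 0 (r / q)"
      unfolding l_def by (intro holomorphic_intros nonpos) (use nz in auto)
    have "0 \<in> ball 0 (r / q)" using r q0 by simp
    then have "l analytic_on {0}"
      using hol analytic_at open_ball by blast
    then obtain L where L: "l has_fps_expansion L"
      using analytic_at_imp_has_fps_expansion_0 by blast
    have "(\<lambda>z. 1 - q / ?g s * z) has_fps_expansion 1 - fps_const (q / ?g s) * fps_X"
      by (intro fps_expansion_intros)
    from log_third_coeff[OF L this]
    have L3: "fps_nth L 3 = - ((q / ?g s) ^ 3 / 3)"
    proof -
      have "eventually (\<lambda>z. z \<in> ball 0 (r/q)) (nhds 0)"
        using r q0 by (intro eventually_nhds_in_open) auto
      then have "eventually (\<lambda>z. exp (l z) = 1 - q / ?g s * z) (nhds 0)"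
      proof eventually_elim
        case (elim z)
        then have "1 - q * (z / ?g s) \<noteq> 0" using nonpos by force
        then show ?case by (simp add: l_def)
      qed
      then show ?thesis using log_third_coeff[OF L \<open>_ has_fps_expansion 1 - _\<close>] by simp
    qed
    have rq: "r < r / q" using r q0 q1 by (simp add: field_simps)
    have "((\<lambda>t. Re (l (?g t)) * ?m t) has_integral r ^ 6 / 2 * Re (cnj \<mu> * fps_nth L 3)) {0..1}"
      by (rule integral_Re_trig_charge[OF hol L r rq])
    moreover have "r ^ 6 * Re (cnj \<mu> * fps_nth L 3) = - (q ^ 3 / 3 * ?m s)"
    proof -
      have "r ^ 6 * (cnj \<mu> * fps_nth L 3) = - (q ^ 3 / 3) * cnj (\<mu> * ?g s ^ 3)"
        unfolding complex_cnj_mult cnj_circlepath_cube[OF r] L3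
        using nz by (simp add: power_divide field_simps)
      then have "Re (r ^ 6 * (cnj \<mu> * fps_nth L 3)) = Re (- (q ^ 3 / 3) * cnj (\<mu> * ?g s ^ 3))"
        by simp
      then show ?thesis unfolding trig_charge_def
        using Re_of_real_mult[of "r ^ 6" "cnj \<mu> * fps_nth L 3"]
          Re_of_real_mult[of "- (q ^ 3 / 3)" "cnj (\<mu> * ?g s ^ 3)"]
        by (simp del: Re_divide_of_real complex_cnj_mult)
    qed
    ultimately have I: "((\<lambda>t. Re (l (?g t)) * ?m t) has_integral - (q ^ 3 / 3 * ?m s) / 2) {0..1}"
      by (simp add: mult_ac)
    have M: "(?m has_integral 0) {0..1}"
      using integral_trig_charge[OF r] integrable_continuous_interval[OF continuous_on_trig_charge]
      by (metis integrable_integral)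
    have "((\<lambda>t. C * ?m t + 2 * (Re (l (?g t)) * ?m t)) has_integral C * 0 + 2 * (- (q ^ 3 / 3 * ?m s) / 2)) {0..1}"
      by (intro has_integral_add has_integral_mult_right I M)
    then show ?thesis
      unfolding ln_kernel l_def by (intro integral_unique) (simp add: algebra_simps)
  qed
  have cont: "continuous_on unit_square (\<lambda>x. ln ((cmod (1 / ?g (fst x) - 1 / ?g (snd x)))\<^sup>2 + \<epsilon>) * (?m (fst x) * ?m (snd x)))"
  proof (intro continuous_intros ballI continuous_on_unit_square_fst continuous_on_unit_square_snd)
    show "(cmod (1 / ?g (fst x) - 1 / ?g (snd x)))\<^sup>2 + \<epsilon> \<noteq> 0" for x
      using e by (smt (verit) zero_le_power2)
    show "continuous_on {0..1} ?g" unfolding circlepath by (intro continuous_intros)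
    then show "continuous_on {0..1} ?g" .
  qed (use nz in auto)
  have "integral unit_square (\<lambda>x. ln ((cmod (1 / ?g (fst x) - 1 / ?g (snd x)))\<^sup>2 + \<epsilon>) * (?m (fst x) * ?m (snd x)))
    = integral {0..1} (\<lambda>s. ?m s * integral {0..1} (\<lambda>t. ln ((cmod (1 / ?g s - 1 / ?g t))\<^sup>2 + \<epsilon>) * ?m t))"
    unfolding integral_prod_continuous[OF cont]
    by (simp add: cbox_interval mult_ac flip: integral_mult_right)
  also have "\<dots> = integral {0..1} (\<lambda>s. - (q ^ 3 / 3) * (?m s * ?m s))"
    unfolding inner by (simp add: mult_ac)
  also have "\<dots> = - (q ^ 3 / 3) * integral {0..1} (\<lambda>s. ?m s * ?m s)"
    by (rule integral_mult_right)
  also have "integral {0..1} (\<lambda>s. ?m s * ?m s) = r ^ 6 / 2"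
  proof -
    have "(\<lambda>z. \<mu> * z ^ 3) has_fps_expansion fps_const \<mu> * fps_X ^ 3"
      by (intro fps_expansion_intros)
    then have "((\<lambda>t. Re (\<mu> * ?g t ^ 3) * ?m t) has_integral
       r ^ 6 / 2 * Re (cnj \<mu> * fps_nth (fps_const \<mu> * fps_X ^ 3) 3)) {0..1}"
      by (intro integral_Re_trig_charge[where R="r+1"] holomorphic_intros) (use r in auto)
    moreover have "Re (cnj \<mu> * \<mu>) = 1"
      using \<mu> by (metis Re_complex_of_real complex_norm_square mult.commute one_power2)
    ultimately show ?thesis by (intro integral_unique) (simp add: trig_charge_def fps_X_power_iff)
  qed
  \<comment> \<open>The exact energy is \<open>- (q ^ 3 * r ^ 6 / 6)\<close>; estimating
    \<open>q ^ 3\<close> by 1 makes the bound independent of \<open>\<epsilon>\<close>.\<close>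
  also have "- (q ^ 3 / 3) * (r ^ 6 / 2) \<ge> - (r ^ 6 / 6)"
    using q0 q1 r power_le_one[of q 3] by (simp add: mult_left_le_one_le)
  finally show ?thesis .
qed

section \<open>A Grunsky inequality\<close>

text \<open>
  With \<open>X z = k z / z\<close> this is \<open>(X z - X w) / (1 / z - 1 / w)\<close>, extended to the diagonal and to
  \<open>z = 0\<close>, \<open>w = 0\<close>.
\<close>
definition quotient_kernel :: "(complex \<Rightarrow> complex) \<Rightarrow> complex \<Rightarrow> complex \<Rightarrow> complex" where
  "quotient_kernel k z w = k z - z * (if w = z then deriv k z else (k w - k z) / (w - z))"

lemma quotient_kernel_mult: "(z - w) * quotient_kernel k z w = z * k w - w * k z"
  by (cases "w = z") (auto simp: quotient_kernel_def field_simps)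

lemma quotient_kernel_eq:
  assumes "z \<noteq> 0" "w \<noteq> 0"
  shows "k z / z - k w / w = (1 / z - 1 / w) * quotient_kernel k z w"
proof -
  have "(k z / z - k w / w) * (z * w) = w * k z - z * k w"
    using assms by (simp add: field_simps)
  also have "\<dots> = (w - z) * quotient_kernel k z w"
    using quotient_kernel_mult[of z w k] by (simp add: algebra_simps)
  also have "\<dots> = (1 / z - 1 / w) * quotient_kernel k z w * (z * w)"
    using assms by (simp add: field_simps)
  finally show ?thesis using assms by simp
qed

text \<open>Across the diagonal the difference quotient is the average of \<open>deriv k\<close>
  over the segment from z to w, which stays in the convex set \<open>S\<close>; this average depends
  continuously on both end points.\<close>

lemma continuous_on_quotient_kernel:
  assumes k: "k holomorphic_on S" and S: "open S" "convex S"
  shows "continuous_on (S \<times> S) (\<lambda>x. quotient_kernel k (fst x) (snd x))"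
proof -
  have dk: "continuous_on S (deriv k)"
    by (intro holomorphic_on_imp_continuous_on holomorphic_deriv k S)
  have seg: "z + of_real u * (w - z) \<in> S" if "z \<in> S" "w \<in> S" "u \<in> {0..1}" for z w u
    using convexD_alt[OF S(2) that(1,2), of u] that(3) by (simp add: scaleR_conv_of_real algebra_simps)
  let ?D = "\<lambda>x. integral {0..1} (\<lambda>u. deriv k (fst x + of_real u * (snd x - fst x)))"
  have "continuous_on (S \<times> S) ?D"
  proof -
    have "continuous_on ((S \<times> S) \<times> cbox 0 1)
      (\<lambda>(x, u::real). deriv k (fst x + of_real u * (snd x - fst x)))"
      unfolding split_beta
      by (rule continuous_on_compose2[OF dk]) (auto intro!: continuous_intros seg simp: cbox_interval)
    from integral_continuous_on_param[OF this] show ?thesis by (simp add: cbox_interval)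
  qed
  moreover have "?D x = (if snd x = fst x then deriv k (fst x) else (k (snd x) - k (fst x)) / (snd x - fst x))"
    if x: "x \<in> S \<times> S" for x
  proof -
    obtain z w where zw: "x = (z, w)" "z \<in> S" "w \<in> S" using x by auto
    have "((\<lambda>u. (w - z) * deriv k (z + of_real u * (w - z))) has_integral
        k (z + of_real 1 * (w - z)) - k (z + of_real 0 * (w - z))) {0..1}"
    proof (rule fundamental_theorem_of_calculus)
      fix u :: real assume u: "u \<in> {0..1}"
      have "(k has_field_derivative deriv k (z + of_real u * (w - z))) (at (z + of_real u * (w - z)))"
        using holomorphic_derivI[OF k S(1)] seg[OF zw(2,3) u] by blast
      moreover have "((\<lambda>u. z + of_real u * (w - z)) has_vector_derivative (w - z)) (at u within {0..1})"
        by (auto intro!: derivative_eq_intros)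
      ultimately show "((\<lambda>u. k (z + of_real u * (w - z))) has_vector_derivative
          (w - z) * deriv k (z + of_real u * (w - z))) (at u within {0..1})"
        using field_vector_diff_chain_within[where f="\<lambda>u. z + of_real u * (w - z)" and g=k and S="{0..1}"]
          has_field_derivative_at_within by (force simp: o_def)
    qed auto
    then have "(w - z) * ?D x = k w - k z"
      by (simp add: integral_unique zw flip: integral_mult_right)
    then show ?thesis
      by (cases "w = z") (auto simp: zw field_simps)
  qed
  ultimately have "continuous_on (S \<times> S) (\<lambda>x. if snd x = fst x then deriv k (fst x) else (k (snd x) - k (fst x)) / (snd x - fst x))"
    by (subst continuous_on_cong[OF refl, symmetric]) auto
  moreover have "continuous_on (S \<times> S) (\<lambda>x. k (fst x))"
    by (rule continuous_on_compose2[OF holomorphic_on_imp_continuous_on[OF k]]) (auto intro!: continuous_intros)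
  ultimately show ?thesis
    unfolding quotient_kernel_def by (intro continuous_intros)
qed

lemma holomorphic_on_quotient_kernel:
  assumes "k holomorphic_on S" "open S"
  shows "quotient_kernel k z holomorphic_on S"
  unfolding quotient_kernel_def[abs_def]
  by (intro holomorphic_intros pole_lemma_open assms)

text \<open>If z or w is 0 the kernel is \<open>k 0 = 1\<close>. Otherwise, injectivity of
  \<open>k z / z\<close> settles z \<noteq> w, and the nonvanishing derivative of an injective
  holomorphic function settles z = w.\<close>

lemma quotient_kernel_nonzero:
  assumes k: "k holomorphic_on S" and S: "open S" "0 \<in> S" and k0: "k 0 = 1"
    and inj: "inj_on (\<lambda>z. k z / z) (S - {0})" and zw: "z \<in> S" "w \<in> S"
  shows "quotient_kernel k z w \<noteq> 0"
proof (cases "z = 0 \<or> w = 0")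
  case True
  then show ?thesis
    using quotient_kernel_mult[of z w k] k0 by (cases "z = 0") (auto simp: quotient_kernel_def)
next
  case nz: False
  show ?thesis
  proof (cases "z = w")
    case False
    then have "k z / z \<noteq> k w / w" using inj zw nz by (auto dest: inj_onD)
    then show ?thesis using quotient_kernel_eq[of z w k] nz by auto
  next
    case True
    have "(\<lambda>z. k z / z) holomorphic_on S - {0}"
      by (intro holomorphic_intros holomorphic_on_subset[OF k]) auto
    then have "deriv (\<lambda>z. k z / z) z \<noteq> 0"
      by (rule holomorphic_injective_imp_regular) (use S nz zw inj in auto)
    moreover have "((\<lambda>z. k z / z) has_field_derivative (deriv k z * z - k z * 1) / (z * z)) (at z)"
      using nz zw by (intro DERIV_divide DERIV_ident holomorphic_derivI[OF k S(1)]) auto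
    ultimately show ?thesis
      unfolding quotient_kernel_def using True by (auto dest!: DERIV_imp_deriv simp: mult_ac)
  qed
qed

text \<open>For fixed z the kernel has no zeros in w, so it has a holomorphic logarithm on the disk,
  and the charge reads off the third coefficient of that logarithm.\<close>

lemma integral_log_quotient_kernel:
  assumes k: "k holomorphic_on ball 0 1" and K: "k has_fps_expansion K"
    and K013: "fps_nth K 0 = 1" "fps_nth K 1 = 0" "fps_nth K 3 = 0"
    and inj: "inj_on (\<lambda>z. k z / z) (ball 0 1 - {0})"
    and r: "0 < r" "r < 1" and z: "z \<in> ball 0 1" "z \<noteq> 0"
  shows "((\<lambda>t. ln (cmod (quotient_kernel k z (circlepath 0 r t))) * trig_charge r \<mu> t) has_integral
     r ^ 6 / 2 * Re (cnj \<mu> * ((1 / 3 - k z ^ 3 / 3 + fps_nth K 2 * z\<^sup>2 * k z) / z ^ 3))) {0..1}"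
proof -
  let ?Q = "quotient_kernel k z"
  have k0: "k 0 = 1"
    using has_fps_expansion_imp_0_eq_fps_nth_0[OF K] K013 by simp
  have Qhol: "?Q holomorphic_on ball 0 1"
    using k by (intro holomorphic_on_quotient_kernel) auto
  have Qnz: "?Q w \<noteq> 0" if "w \<in> ball 0 1" for w
    using quotient_kernel_nonzero[OF k _ _ k0 inj z(1) that] by simp
  obtain l where l: "l holomorphic_on ball 0 1" "\<And>w. w \<in> ball 0 1 \<Longrightarrow> ?Q w = exp (l w)"
    using contractible_imp_holomorphic_log[OF Qhol convex_imp_contractible[OF convex_ball] Qnz] by blast
  have an: "f analytic_on {0}" if "f holomorphic_on ball 0 1" for f :: "complex \<Rightarrow> complex"
    using that analytic_at open_ball centre_in_ball zero_less_one by blast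
  obtain L where L: "l has_fps_expansion L"
    using analytic_at_imp_has_fps_expansion_0[OF an[OF l(1)]] by blast
  obtain E where E: "?Q has_fps_expansion E"
    using analytic_at_imp_has_fps_expansion_0[OF an[OF Qhol]] by blast
  define X y where "X = k z / z" and "y = 1 / z"
  \<comment> \<open>Dividing \<open>quotient_kernel_mult\<close> by z gives
    \<open>(1 - y * w) * ?Q w = k w - X * w\<close>, from which the coefficients of
    \<open>?Q\<close> follow recursively.\<close>
  have "(\<lambda>w. (1 - y * w) * ?Q w) has_fps_expansion (1 - fps_const y * fps_X) * E"
    by (intro fps_expansion_intros E)
  also have "(\<lambda>w. (1 - y * w) * ?Q w) = (\<lambda>w. k w - X * w)"
    using quotient_kernel_mult[of z _ k] z(2) by (auto simp: fun_eq_iff X_def y_def field_simps)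
  finally have "(\<lambda>w. k w - X * w) has_fps_expansion (1 - fps_const y * fps_X) * E" .
  moreover have "(\<lambda>w. k w - X * w) has_fps_expansion K - fps_const X * fps_X"
    by (intro fps_expansion_intros K)
  ultimately have "K - fps_const X * fps_X = (1 - fps_const y * fps_X) * E"
    using fps_expansion_unique_complex by blast
  then have eq: "K - fps_const X * fps_X = E - fps_const y * (fps_X * E)"
    by (simp add: algebra_simps)
  have "fps_nth (K - fps_const X * fps_X) n = fps_nth (E - fps_const y * (fps_X * E)) n" for n
    using eq by simp
  from this[of 0] this[of 1] this[of 2] this[of 3]
  have "fps_nth E 0 = 1" "fps_nth E 1 - y * fps_nth E 0 = - X"
    "fps_nth E 2 - y * fps_nth E 1 = fps_nth K 2" "fps_nth E 3 - y * fps_nth E 2 = 0"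
    using K013 by simp_all
  then have E0: "fps_nth E 0 = 1" and E1: "fps_nth E 1 = y - X" and E2: "fps_nth E 2 = fps_nth K 2 + y * fps_nth E 1"
    and E3: "fps_nth E 3 = y * fps_nth E 2"
    by (simp_all add: algebra_simps)
  have "eventually (\<lambda>w. w \<in> ball 0 1) (nhds (0::complex))"
    by (intro eventually_nhds_in_open) auto
  then have "eventually (\<lambda>w. exp (l w) = ?Q w) (nhds 0)"
    by eventually_elim (use l(2) in auto)
  from log_third_coeff[OF L E E0 this]
  have "fps_nth L 3 = fps_nth K 2 * X + (y ^ 3 - X ^ 3) / 3"
    unfolding E3 E2 E1 by (simp add: field_simps power3_eq_cube)
  also have "\<dots> = (1 / 3 - k z ^ 3 / 3 + fps_nth K 2 * z\<^sup>2 * k z) / z ^ 3"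
    using z(2) by (simp add: X_def y_def field_simps power2_eq_square power3_eq_cube)
  finally have L3: "fps_nth L 3 = \<dots>" .
  have "ln (cmod (?Q (circlepath 0 r t))) = Re (l (circlepath 0 r t))" for t
    using r by (subst l(2)) (auto simp: circlepath norm_mult)
  then show ?thesis
    using integral_Re_trig_charge[OF l(1) L r] unfolding L3 by simp
qed

text \<open>
  \<open>T z / z ^ 3\<close> is the coefficient of \<open>w ^ 3\<close> in the logarithm of the quotient kernel, so
  \<open>fps_nth T 6\<close> is the coefficient of \<open>z ^ 3 w ^ 3\<close>.
\<close>
lemma grunsky_coeff_bound:
  assumes k: "k holomorphic_on ball 0 1" and K: "k has_fps_expansion K"
    and K013: "fps_nth K 0 = 1" "fps_nth K 1 = 0" "fps_nth K 3 = 0"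
    and inj: "inj_on (\<lambda>z. k z / z) (ball 0 1 - {0})"
    and T: "(\<lambda>z. 1 / 3 - k z ^ 3 / 3 + fps_nth K 2 * z\<^sup>2 * k z) has_fps_expansion T"
  shows "cmod (fps_nth T 6) \<le> 1 / 3"
proof -
  let ?T = "\<lambda>z. 1 / 3 - k z ^ 3 / 3 + fps_nth K 2 * z\<^sup>2 * k z"
  have k0: "k 0 = 1"
    using has_fps_expansion_imp_0_eq_fps_nth_0[OF K] K013 by simp
  have T0: "fps_nth T 0 = 0"
    using has_fps_expansion_imp_0_eq_fps_nth_0[OF T] k0 by simp
  have main: "r ^ 6 * Re ((cnj \<mu>)\<^sup>2 * fps_nth T 6) \<le> 1 / 3"
    if r: "0 < r" "r < 1" and \<mu>: "cmod \<mu> = 1" for r \<mu>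
  proof -
    let ?g = "circlepath 0 r" and ?m = "trig_charge r \<mu>"
    let ?mm = "\<lambda>x. ?m (fst x) * ?m (snd x)"
    let ?Q = "\<lambda>x. quotient_kernel k (?g (fst x)) (?g (snd x))"
    let ?D = "\<lambda>x. (cmod (1 / ?g (fst x) - 1 / ?g (snd x)))\<^sup>2"
    let ?w = "\<lambda>t. k (?g t) / ?g t"
    have gin: "?g t \<in> ball 0 1" and gnz: "?g t \<noteq> 0" for t
      using r by (auto simp: circlepath norm_mult)
    have gcont: "continuous_on A ?g" for A unfolding circlepath by (intro continuous_intros)
    have wcont: "continuous_on A ?w" for A
      using gin gnz by (intro continuous_intros gcont
        continuous_on_compose2[OF holomorphic_on_imp_continuous_on[OF k]]) auto
    have Dcont: "continuous_on unit_square ?D"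
      using gnz by (intro continuous_intros continuous_on_unit_square_fst continuous_on_unit_square_snd gcont) auto
    have mmcont: "continuous_on unit_square ?mm"
      by (intro continuous_intros continuous_on_unit_square_fst continuous_on_unit_square_snd)
    have Qcont: "continuous_on unit_square ?Q"
    proof -
      have "continuous_on (ball 0 1 \<times> ball 0 1) (\<lambda>x. quotient_kernel k (fst x) (snd x))"
        by (intro continuous_on_quotient_kernel k) auto
      then have "continuous_on unit_square (\<lambda>x. quotient_kernel k (fst (?g (fst x), ?g (snd x))) (snd (?g (fst x), ?g (snd x))))"
        by (rule continuous_on_compose2)
           (use gin in \<open>auto intro!: continuous_intros continuous_on_unit_square_fst continuous_on_unit_square_snd gcont\<close>)
      then show ?thesis by simp
    qed
    have Qnz: "?Q x \<noteq> 0" for x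
      using quotient_kernel_nonzero[OF k _ _ k0 inj gin gin] by simp
    have DQ: "(cmod (?w (fst x) - ?w (snd x)))\<^sup>2 = ?D x * (cmod (?Q x))\<^sup>2" for x
      by (subst quotient_kernel_eq[OF gnz gnz]) (simp add: norm_mult power_mult_distrib)
    have lnQcont: "continuous_on unit_square (\<lambda>x. ln ((cmod (?Q x))\<^sup>2) * ?mm x)"
      by (intro continuous_intros Qcont mmcont) (use Qnz in auto)
    obtain c where c: "c > 0" "\<And>x. x \<in> unit_square \<Longrightarrow> c \<le> (cmod (?Q x))\<^sup>2"
    proof -
      have "continuous_on unit_square (\<lambda>x. (cmod (?Q x))\<^sup>2)" by (intro continuous_intros Qcont)
      then obtain x0 where "\<forall>x\<in>unit_square. (cmod (?Q x0))\<^sup>2 \<le> (cmod (?Q x))\<^sup>2"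
        using continuous_attains_inf[OF compact_cbox] by (metis (no_types, lifting) box_ne_empty(1) cbox_Pair_eq_0 cbox_interval emptyE atLeastAtMost_iff empty_iff le_numeral_extra(3) mem_Times_iff unit_square_eq zero_le_one insertI1 fst_conv snd_conv)
      then show thesis using that[of "(cmod (?Q x0))\<^sup>2"] Qnz by simp
    qed
    obtain C where C: "\<And>x. x \<in> unit_square \<Longrightarrow> (cmod (?Q x))\<^sup>2 \<le> C"
    proof -
      have "bounded ((\<lambda>x. (cmod (?Q x))\<^sup>2) ` unit_square)"
        by (intro compact_imp_bounded compact_continuous_image continuous_intros Qcont compact_cbox)
      then show thesis using that unfolding bounded_iff ball_simps real_norm_def by (metis abs_le_D1)
    qed
    obtain M where M: "\<And>x. x \<in> unit_square \<Longrightarrow> \<bar>?mm x\<bar> \<le> M"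
    proof -
      have "bounded (?mm ` unit_square)"
        by (intro compact_imp_bounded compact_continuous_image mmcont compact_cbox)
      then show thesis using that unfolding bounded_iff ball_simps real_norm_def by metis
    qed
    define e where "e = (\<lambda>n::nat. 1 / (n + 1 :: real))"
    have e: "e n > 0" for n by (simp add: e_def)
    have elim: "e \<longlonglongrightarrow> 0" unfolding e_def by real_asymp
    \<comment> \<open>The difference of the two regularized logarithms. The quotient of their
      arguments is a mean of \<open>(cmod (?Q x))\<^sup>2\<close> and 1 with weights
      \<open>?D x\<close> and \<open>e n\<close>, so it lies between \<open>min c 1\<close> and
      \<open>max C 1\<close> for every n, even near the diagonal; this provides the dominating
      constant.\<close>
    define f where "f = (\<lambda>n x. ln (?D x * (cmod (?Q x))\<^sup>2 + e n) * ?mm x - ln (?D x + e n) * ?mm x)"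
    have pos1: "?D x + e n > 0" and pos2: "?D x * (cmod (?Q x))\<^sup>2 + e n > 0" for n x
      using e[of n] by (auto intro!: add_nonneg_pos)
    have c1: "continuous_on unit_square (\<lambda>x. ln (?D x * (cmod (?Q x))\<^sup>2 + e n) * ?mm x)" for n
      by (intro continuous_intros Qcont Dcont mmcont) (use pos2[THEN less_imp_neq] in \<open>auto dest: sym\<close>)
    have c2: "continuous_on unit_square (\<lambda>x. ln (?D x + e n) * ?mm x)" for n
      by (intro continuous_intros Dcont mmcont) (use pos1[THEN less_imp_neq] in \<open>auto dest: sym\<close>)
    have f_int: "integral unit_square (f n) \<le> r ^ 6 / 6" for n
    proof -
      have "integral unit_square (f n) = integral unit_square (\<lambda>x. ln (?D x * (cmod (?Q x))\<^sup>2 + e n) * ?mm x)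
          - integral unit_square (\<lambda>x. ln (?D x + e n) * ?mm x)"
        unfolding f_def by (intro integral_diff integrable_continuous c1 c2)
      moreover have "integral unit_square (\<lambda>x. ln (?D x * (cmod (?Q x))\<^sup>2 + e n) * ?mm x) \<le> 0"
        using regularized_log_energy[OF wcont continuous_on_trig_charge integral_trig_charge[OF r(1)] e]
        unfolding DQ .
      moreover have "- (r ^ 6 / 6) \<le> integral unit_square (\<lambda>x. ln (?D x + e n) * ?mm x)"
        by (rule circle_log_energy[OF r(1) \<mu> e])
      ultimately show ?thesis by linarith
    qed
    \<comment> \<open>Where \<open>?D x = 0\<close> the two logarithms are equal for every n, so the
      pointwise limit there is 0 instead of the value of the continuous kernel.\<close>
    define g where "g = (\<lambda>x. if ?D x = 0 then 0 else ln ((cmod (?Q x))\<^sup>2) * ?mm x)"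
    define c' where "c' = min c 1"
    define C' where "C' = max C 1"
    have conv: "(\<lambda>n. integral unit_square (f n)) \<longlonglongrightarrow> integral unit_square g"
    proof (rule dominated_convergence(2))
      show "f n integrable_on unit_square" for n
        unfolding f_def by (intro integrable_continuous continuous_on_diff c1 c2)
      show "(\<lambda>_. (\<bar>ln c'\<bar> + \<bar>ln C'\<bar>) * M) integrable_on unit_square" 
        by (intro integrable_continuous continuous_intros)
    next
      fix n x assume x: "x \<in> unit_square"
      let ?R = "(?D x * (cmod (?Q x))\<^sup>2 + e n) / (?D x + e n)"
      have q: "c' \<le> (cmod (?Q x))\<^sup>2" "(cmod (?Q x))\<^sup>2 \<le> C'"
        using c(2)[OF x] C[OF x] by (auto simp: c'_def C'_def)
      have "c' * (?D x + e n) \<le> ?D x * (cmod (?Q x))\<^sup>2 + e n"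
      proof -
        have "c' * e n \<le> 1 * e n"
          using e[of n] by (intro mult_right_mono) (auto simp: c'_def)
        moreover have "?D x * c' \<le> ?D x * (cmod (?Q x))\<^sup>2"
          by (intro mult_left_mono q) auto
        ultimately show ?thesis by (simp only: distrib_left mult.commute[of c'])
      qed
      then have "c' \<le> ?R" using pos1[of x n] by (simp add: field_simps)
      moreover have "?D x * (cmod (?Q x))\<^sup>2 + e n \<le> C' * (?D x + e n)"
      proof -
        have "1 * e n \<le> C' * e n"
          using e[of n] by (intro mult_right_mono) (auto simp: C'_def)
        moreover have "?D x * (cmod (?Q x))\<^sup>2 \<le> ?D x * C'"
          by (intro mult_left_mono q) auto
        ultimately show ?thesis by (simp only: distrib_left mult.commute[of C'])
      qed
      then have "?R \<le> C'" using pos1[of x n] by (simp add: field_simps)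
      moreover have "c' > 0" "C' > 0" using c(1) by (auto simp: c'_def C'_def)
      ultimately have "ln c' \<le> ln ?R" "ln ?R \<le> ln C'" by (auto intro!: ln_mono)
      then have "\<bar>ln ?R\<bar> \<le> \<bar>ln c'\<bar> + \<bar>ln C'\<bar>" by linarith
      moreover have "f n x = ln ?R * ?mm x"
        unfolding f_def ln_divide_pos[OF pos2 pos1] by (simp add: algebra_simps)
      ultimately show "norm (f n x) \<le> (\<bar>ln c'\<bar> + \<bar>ln C'\<bar>) * M"
        using M[OF x] by (simp only: real_norm_def abs_mult) (intro mult_mono; auto)
    next
      fix x assume x: "x \<in> unit_square"
      show "(\<lambda>n. f n x) \<longlonglongrightarrow> g x"
      proof (cases "?D x = 0")
        case True
        then show ?thesis unfolding f_def g_def by simp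
      next
        case False
        then have D: "?D x > 0" by (metis zero_le_power2 order_le_less)
        have "(\<lambda>n. f n x) \<longlonglongrightarrow> ln (?D x * (cmod (?Q x))\<^sup>2 + 0) * ?mm x - ln (?D x + 0) * ?mm x"
          unfolding f_def using D Qnz[of x] by (intro tendsto_intros elim) auto
        also have "ln (?D x * (cmod (?Q x))\<^sup>2 + 0) * ?mm x - ln (?D x + 0) * ?mm x = g x"
          using D Qnz[of x] by (simp add: g_def ln_mult_pos algebra_simps)
        finally show ?thesis .
      qed
    qed
    have "integral unit_square g = integral unit_square (\<lambda>x. ln ((cmod (?Q x))\<^sup>2) * ?mm x)"
    proof (rule integral_spike)
      \<comment> \<open>The circle closes up, so equality of the two points occurs not only on the
        diagonal but also at the corners where the parameters differ by 1.\<close>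
      let ?N = "\<Union>j\<in>{-1,0,1::int}. {x::real\<times>real. (1,-1) \<bullet> x = of_int j}"
      show "negligible ?N"
        by (intro negligible_Union finite_imageI) (auto intro!: negligible_hyperplane simp: zero_prod_def)
      fix x assume x: "x \<in> unit_square - ?N"
      have "?D x \<noteq> 0"
      proof
        assume "?D x = 0"
        then have "?g (fst x) = ?g (snd x)" using gnz by (simp add: field_simps)
        then have "exp (2 * of_real pi * \<i> * fst x) = exp (2 * of_real pi * \<i> * snd x)"
          using r by (simp add: circlepath)
        then obtain n where "2 * of_real pi * \<i> * fst x = 2 * of_real pi * \<i> * snd x + (of_int (2 * n) * pi) * \<i>"
          unfolding exp_eq by blast
        then have "2 * pi * fst x = 2 * pi * snd x + 2 * n * pi"
          by (auto simp: complex_eq_iff)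
        then have "2 * pi * fst x = 2 * pi * (snd x + n)" by (simp add: algebra_simps)
        then have n: "fst x = snd x + n" using pi_gt_zero by (simp only: mult_cancel_left) auto
        moreover have "n \<in> {-1,0,1}"
        proof -
          have "\<bar>real_of_int n\<bar> \<le> 1" using n x by (auto simp: unit_square_eq)
          then show ?thesis by auto
        qed
        ultimately show False using x by (cases x) auto
      qed
      then show "ln ((cmod (?Q x))\<^sup>2) * ?mm x = g x" by (simp add: g_def)
    qed
    moreover have "integral unit_square g \<le> r ^ 6 / 6"
      by (rule LIMSEQ_le_const2[OF conv]) (use f_int in auto)
    \<comment> \<open>Each of the two integrations contributes \<open>r ^ 6 / 2\<close>, and the
      square inside the logarithm a factor 2. The constant coefficient of \<open>T\<close> vanishes
      because \<open>k 0 = 1\<close>.\<close>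
    moreover have "integral unit_square (\<lambda>x. ln ((cmod (?Q x))\<^sup>2) * ?mm x) = r ^ 12 / 2 * Re ((cnj \<mu>)\<^sup>2 * fps_nth T 6)"
    proof -
      have "integral unit_square (\<lambda>x. ln ((cmod (?Q x))\<^sup>2) * ?mm x) =
        integral {0..1} (\<lambda>s. 2 * ?m s * integral {0..1} (\<lambda>t. ln (cmod (quotient_kernel k (?g s) (?g t))) * ?m t))"
        unfolding integral_prod_continuous[OF lnQcont] using Qnz
        by (simp add: cbox_interval ln_realpow mult_ac flip: integral_mult_right)
      also have "\<dots> = integral {0..1} (\<lambda>s. r ^ 6 * (Re (cnj \<mu> * (?T (?g s) / ?g s ^ 3)) * ?m s))"
        unfolding integral_unique[OF integral_log_quotient_kernel[OF k K K013 inj r gin gnz]]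
        by (rule arg_cong[of _ _ "integral {0..1}"]) (simp add: fun_eq_iff)
      also have "\<dots> = r ^ 6 * integral {0..1} (\<lambda>s. Re (cnj \<mu> * (?T (?g s) / ?g s ^ 3)) * ?m s)"
        by (rule integral_mult_right)
      also have "integral {0..1} (\<lambda>s. Re (cnj \<mu> * (?T (?g s) / ?g s ^ 3)) * ?m s)
         = (Re (cnj \<mu> * \<mu> * fps_nth T 0) + r ^ 6 * Re (cnj \<mu> * cnj \<mu> * fps_nth T 6)) / 2"
        by (intro integral_unique integral_Re_pole_trig_charge[where f="?T" and R=1] T r holomorphic_intros k) auto
      finally show ?thesis
        unfolding T0 by (simp only: power2_eq_square) (simp add: mult_ac)
    qed
    ultimately have "r ^ 12 / 2 * Re ((cnj \<mu>)\<^sup>2 * fps_nth T 6) \<le> r ^ 6 / 6" by simp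
    then have "r ^ 6 * (r ^ 6 * Re ((cnj \<mu>)\<^sup>2 * fps_nth T 6)) \<le> r ^ 6 * (1 / 3)"
      by (simp only: mult.assoc[symmetric] power_add[symmetric]) simp
    then show ?thesis using r by (simp only: mult_le_cancel_left_pos zero_less_power)
  qed
  let ?a = "fps_nth T 6"
  \<comment> \<open>The charge enters the energy twice, so \<open>\<mu>\<close> is a square root of
    the phase of the coefficient.\<close>
  obtain \<mu> where \<mu>: "cmod \<mu> = 1" "(cnj \<mu>)\<^sup>2 * ?a = cmod ?a"
  proof -
    have "cmod (csqrt (cis (Arg ?a))) = 1" by (simp)
    moreover have "(cnj (csqrt (cis (Arg ?a))))\<^sup>2 * ?a = cmod ?a"
    proof -
      have "(cnj (csqrt (cis (Arg ?a))))\<^sup>2 = cnj (cis (Arg ?a))"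
        by (simp only: power2_csqrt flip: complex_cnj_power)
      moreover have "?a = cmod ?a * cis (Arg ?a)" using rcis_cmod_Arg[of ?a] by (simp add: rcis_def)
      ultimately show ?thesis
        by (metis (no_types, lifting) cis_cnj cis_mult cis_zero add.left_inverse mult.left_commute mult.right_neutral)
    qed
    ultimately show thesis using that by blast
  qed
  have "r ^ 6 * cmod ?a \<le> 1 / 3" if "0 < r" "r < 1" for r
    using main[OF that \<mu>(1)] unfolding \<mu>(2) by simp
  then have ev: "eventually (\<lambda>r. r ^ 6 * cmod ?a \<le> 1 / 3) (at_left (1::real))"
    unfolding eventually_at_left_field by (intro exI[of _ 0]) auto
  have "((\<lambda>r. r ^ 6 * cmod ?a) \<longlongrightarrow> 1 ^ 6 * cmod ?a) (at_left (1::real))"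
    by (intro tendsto_intros)
  from tendsto_upperbound[OF this ev] show ?thesis by simp
qed

section \<open>The coefficient of $z^2$\<close>

text \<open>
  The inequality for \<open>z \<mapsto> sqrt (p (z\<^sup>2)) / z\<close>, the square root transform of \<open>p z / z\<close>; it
  exists because \<open>p\<close> has no zeros.
\<close>
lemma nonvanishing_coeff_bound:
  assumes p: "p holomorphic_on ball 0 1" and P: "p has_fps_expansion P" and P0: "fps_nth P 0 = 1"
    and nz: "\<And>z. z \<in> ball 0 1 \<Longrightarrow> p z \<noteq> 0"
    and inj: "inj_on (\<lambda>z. p z / z) (ball 0 1 - {0})"
  shows "cmod (fps_nth P 3 + fps_nth P 1 ^ 3 / 12) \<le> 2 / 3"
proof -
  have p0: "p 0 = 1"
    using has_fps_expansion_imp_0_eq_fps_nth_0[OF P] P0 by simp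
  obtain s where s: "s holomorphic_on ball 0 1" "\<And>z. z \<in> ball 0 1 \<Longrightarrow> p z = s z ^ 2"
    using contractible_imp_holomorphic_sqrt[OF p convex_imp_contractible[OF convex_ball] nz] by blast
  have s0: "s 0 ^ 2 = 1" using s(2)[of 0] p0 by simp
  define h where "h = (\<lambda>z. s z / s 0)"
  have h: "h holomorphic_on ball 0 1" and hp: "\<And>z. z \<in> ball 0 1 \<Longrightarrow> h z ^ 2 = p z"
    unfolding h_def using s s0 by (auto intro!: holomorphic_intros simp: power_divide)
  obtain H where H: "h has_fps_expansion H"
    using h analytic_at_imp_has_fps_expansion_0 by (meson analytic_at centre_in_ball open_ball zero_less_one)
  have H0: "fps_nth H 0 = 1"
    using has_fps_expansion_imp_0_eq_fps_nth_0[OF H] s0 by (simp add: h_def split: if_splits)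
  have sq: "z\<^sup>2 \<in> ball 0 1" if "z \<in> ball 0 1" for z :: complex
    using that by (simp add: norm_power power_less_one_iff)
  define k where "k = (\<lambda>z. h (z\<^sup>2))"
  have "(h \<circ> (\<lambda>z. z ^ 2)) has_fps_expansion fps_compose H (fps_X ^ 2)"
    by (intro fps_expansion_intros H) auto
  then have K: "k has_fps_expansion fps_compose H (fps_X ^ 2)"
    by (simp add: k_def o_def)
  have kp: "k z ^ 2 = p (z\<^sup>2)" if "z \<in> ball 0 1" for z
    unfolding k_def using hp[OF sq[OF that]] .
  have "inj_on (\<lambda>z. k z / z) (ball 0 1 - {0})"
  proof (rule inj_onI)
    fix z w assume zw: "z \<in> ball 0 1 - {0}" "w \<in> ball 0 1 - {0}" and eq: "k z / z = k w / w"
    from eq have "(k z / z)\<^sup>2 = (k w / w)\<^sup>2" by simp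
    then have "p (z\<^sup>2) / z\<^sup>2 = p (w\<^sup>2) / w\<^sup>2"
      using zw by (simp add: power_divide kp)
    then have "z\<^sup>2 = w\<^sup>2" by (rule inj_onD[OF inj]) (use sq zw in auto)
    then consider "z = w" | "z = - w" by (metis power2_eq_iff)
    then show "z = w"
    proof cases
      \<comment> \<open>Since \<open>k\<close> is even, \<open>k z / z\<close> is odd; equal values
        at w and -w force \<open>k w = 0\<close>, hence a zero of \<open>p\<close>.\<close>
      case 2
      then have "k w = 0" using eq zw by (simp add: k_def)
      then show ?thesis using kp[of w] nz[of "w\<^sup>2"] sq[of w] zw by simp
    qed
  qed
  moreover have "k holomorphic_on ball 0 1"
    unfolding k_def by (rule holomorphic_on_compose_gen[OF _ h, unfolded o_def])
      (use sq in \<open>auto intro!: holomorphic_intros\<close>)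
  \<comment> \<open>The function in the Grunsky bound for \<open>k\<close> is
    \<open>t (z\<^sup>2)\<close>, so its sixth coefficient is the third coefficient of
    \<open>t\<close>.\<close>
  moreover define t where "t = (\<lambda>z. 1 / 3 - h z ^ 3 / 3 + fps_nth H 1 * z * h z)"
  define T where "T = fps_const (1 / 3) - H ^ 3 * fps_const (1/3) + fps_const (fps_nth H 1) * fps_X * H"
  have "(\<lambda>z. 1 / 3 - h z ^ 3 * (1/3) + fps_nth H 1 * z * h z) has_fps_expansion T"
    unfolding T_def by (intro fps_expansion_intros H)
  then have "t has_fps_expansion T" by (simp add: t_def)
  then have "(t \<circ> (\<lambda>z. z ^ 2)) has_fps_expansion fps_compose T (fps_X ^ 2)"
    by (intro fps_expansion_intros) auto
  then have "(\<lambda>z. 1 / 3 - k z ^ 3 / 3 + fps_nth (fps_compose H (fps_X ^ 2)) 2 * z\<^sup>2 * k z)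
      has_fps_expansion fps_compose T (fps_X ^ 2)"
    by (simp add: t_def k_def o_def fps_nth_compose_X_power)
  ultimately have "cmod (fps_nth (fps_compose T (fps_X ^ 2)) 6) \<le> 1 / 3"
    by (intro grunsky_coeff_bound[OF _ K]) (auto simp: fps_nth_compose_X_power H0)
  moreover have "fps_nth T 3 = - (fps_nth P 3 + fps_nth P 1 ^ 3 / 12) / 2"
  proof -
    have "eventually (\<lambda>z. z \<in> ball 0 1) (nhds (0::complex))"
      by (intro eventually_nhds_in_open) auto
    then have "eventually (\<lambda>z. p z = h z * h z) (nhds 0)"
      by eventually_elim (use hp in \<open>auto simp: power2_eq_square\<close>)
    moreover have "(\<lambda>z. h z * h z) has_fps_expansion H * H"
      by (intro fps_expansion_intros H)
    ultimately have "p has_fps_expansion H * H"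
      by (subst has_fps_expansion_cong) auto
    then have "P = H * H" using P fps_expansion_unique_complex by blast
    then have P1: "fps_nth P 1 = 2 * fps_nth H 1"
      and P3: "fps_nth P 3 = 2 * fps_nth H 3 + 2 * fps_nth H 1 * fps_nth H 2"
      by (simp_all add: fps_mult_nth H0 eval_nat_numeral)
    have H3: "fps_nth (H ^ 3) 3 = 3 * fps_nth H 3 + 6 * fps_nth H 1 * fps_nth H 2 + fps_nth H 1 ^ 3"
      by (simp add: power3_eq_cube fps_mult_nth H0 eval_nat_numeral algebra_simps)
    have "fps_nth (fps_const (fps_nth H 1) * fps_X * H) 3 = fps_nth H 1 * fps_nth H 2"
      by (simp add: mult.assoc)
    then have "fps_nth T 3 = fps_nth H 1 * fps_nth H 2 - fps_nth (H ^ 3) 3 * (1 / 3)"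
      by (simp only: T_def fps_add_nth fps_sub_nth fps_mult_right_const_nth) simp
    then show ?thesis unfolding P1 P3 by (simp only: H3) (simp add: field_simps power3_eq_cube)
  qed
  then have "cmod (fps_nth T 3) = cmod (fps_nth P 3 + fps_nth P 1 ^ 3 / 12) / 2"
    by (simp only: norm_divide norm_minus_cancel) simp
  ultimately show ?thesis by (simp add: fps_nth_compose_X_power)
qed

text \<open>Under \<open>1 / (w - w0)\<close> the omitted values other than \<open>w0\<close> become
  the complement of the simply connected image \<open>\<Omega>\<close>, whose components are
  unbounded. A component beyond the line \<open>Re (c * w) = 0\<close> would be bounded, so all
  omitted values lie on the side of \<open>w0\<close>. The opposite closed half plane together with
  infinity then corresponds to a compact part of \<open>\<Omega>\<close>, and its preimage stays
  away from the unit circle.\<close>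

lemma omitted_values_half_plane:
  assumes p: "p holomorphic_on ball 0 1" and p0: "p 0 = 1"
    and inj: "inj_on (\<lambda>z. p z / z) (ball 0 1 - {0})"
    and E: "E = {w. \<forall>z\<in>ball 0 1. p z \<noteq> w * z}"
    and w0: "w0 \<in> E" "Re (c * w0) > 0" and cE: "\<And>w. w \<in> E \<Longrightarrow> Re (c * w) \<noteq> 0"
    and r: "r < 1"
  shows "\<exists>s. r < s \<and> s < 1 \<and> (\<forall>z. s < cmod z \<and> cmod z < 1 \<longrightarrow> Re (c * (p z / z)) > 0)"
proof -
  define \<delta> where "\<delta> = Re (c * w0)"
  have \<delta>: "\<delta> > 0" using w0 by (simp add: \<delta>_def)
  define g where "g = (\<lambda>z. z / (p z - w0 * z))"
  have den: "p z - w0 * z \<noteq> 0" if "z \<in> ball 0 1" for z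
    using w0(1) that by (auto simp: E)
  have g: "g holomorphic_on ball 0 1"
    unfolding g_def using den by (intro holomorphic_intros p) auto
  have g_eq: "w0 + 1 / g z = p z / z" if "z \<in> ball 0 1" "z \<noteq> 0" for z
    using that den[OF that(1)] by (simp add: g_def field_simps)
  have g0: "g z = 0 \<longleftrightarrow> z = 0" if "z \<in> ball 0 1" for z
    using den[OF that] by (simp add: g_def)
  have ginj: "inj_on g (ball 0 1)"
  proof (rule inj_onI)
    fix z w assume zw: "z \<in> ball 0 1" "w \<in> ball 0 1" "g z = g w"
    show "z = w"
    proof (cases "z = 0 \<or> w = 0")
      case True
      then show ?thesis using zw g0 by metis
    next
      case False
      then have "p z / z = p w / w" using g_eq[of z] g_eq[of w] zw by metis
      then show ?thesis by (rule inj_onD[OF inj]) (use False zw in auto)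
    qed
  qed
  define \<Omega> where "\<Omega> = g ` ball 0 1"
  have "open \<Omega>" unfolding \<Omega>_def by (rule open_mapping_thm3[OF g open_ball ginj])
  obtain gi where gi: "gi holomorphic_on \<Omega>" "\<And>z. z \<in> ball 0 1 \<Longrightarrow> gi (g z) = z"
    using holomorphic_has_inverse[OF g open_ball ginj] unfolding \<Omega>_def by metis
  have "homeomorphism (ball 0 1) \<Omega> g gi"
    unfolding homeomorphism_def using gi g
    by (auto simp: \<Omega>_def image_iff intro: holomorphic_on_imp_continuous_on)
  then have "ball (0::complex) 1 homeomorphic \<Omega>"
    unfolding homeomorphic_def by blast
  then have "simply_connected \<Omega>"
    using homeomorphic_simply_connected convex_imp_simply_connected[OF convex_ball] by blast
  then have unb: "\<not> bounded C" if "C \<in> components (- \<Omega>)" for C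
    using simply_connected_eq_unbounded_complement_components[OF \<open>open \<Omega>\<close>] that by blast
  have out: "v \<noteq> 0" "w0 + 1 / v \<in> E" if v: "v \<notin> \<Omega>" for v
  proof -
    show "v \<noteq> 0"
    proof
      assume "v = 0"
      then have "v = g 0" by (simp add: g_def)
      then show False using v by (auto simp: \<Omega>_def)
    qed
    show "w0 + 1 / v \<in> E" unfolding E
    proof (safe)
      fix z assume z: "z \<in> ball 0 1" "p z = (w0 + 1 / v) * z"
      then have "z \<noteq> 0" using p0 by auto
      moreover have "p z - w0 * z = z / v" using z by (simp add: algebra_simps)
      ultimately have "g z = v" using \<open>v \<noteq> 0\<close> by (simp add: g_def)
      then show False using v z by (auto simp: \<Omega>_def)
    qed
  qed
  have E_pos: "Re (c * w) > 0" if w: "w \<in> E" for w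
  proof (rule ccontr)
    assume "\<not> Re (c * w) > 0"
    then have neg: "Re (c * w) < 0" using cE[OF w] by simp
    then have "w \<noteq> w0" using w0 by auto
    define v where "v = 1 / (w - w0)"
    have "v \<notin> \<Omega>"
    proof
      assume "v \<in> \<Omega>"
      then obtain z where z: "z \<in> ball 0 1" "v = g z" by (auto simp: \<Omega>_def)
      then have "z \<noteq> 0" using \<open>w \<noteq> w0\<close> by (auto simp: v_def g_def)
      have "1 / g z = w - w0" using z(2) by (simp add: v_def flip: z(2))
      then have "p z / z = w" using g_eq[OF z(1) \<open>z \<noteq> 0\<close>] by simp
      then have "p z = w * z" using \<open>z \<noteq> 0\<close> by (simp add: field_simps)
      then show False using w z by (auto simp: E)
    qed
    let ?C = "connected_component_set (- \<Omega>) v"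
    have "?C \<in> components (- \<Omega>)"
      using \<open>v \<notin> \<Omega>\<close> by (auto simp: components_def)
    have C_sub: "?C \<subseteq> - \<Omega>" by (rule connected_component_subset)
    let ?h = "\<lambda>u. Re (c * (w0 + 1 / u))"
    have "connected (?h ` ?C)"
      by (intro connected_continuous_image continuous_intros connected_connected_component)
         (use C_sub out(1) in auto)
    moreover have "0 \<notin> ?h ` ?C"
      using C_sub out(2) cE by fastforce
    moreover have "?h v < 0" using neg by (simp add: v_def)
    moreover have "v \<in> ?C" using \<open>v \<notin> \<Omega>\<close> by simp
    ultimately have neg': "?h u < 0" if u: "u \<in> ?C" for u
    proof -
      assume conn: "connected (?h ` ?C)" and no0: "0 \<notin> ?h ` ?C" and v: "?h v < 0" "v \<in> ?C"
      have "{?h v..?h u} \<subseteq> ?h ` ?C"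
        by (intro connected_contains_Icc conn imageI v u)
      then show "?h u < 0" using no0 v(1) by (meson atLeastAtMost_iff less_imp_le not_less subsetD)
    qed
    \<comment> \<open>On the negative side \<open>Re (c / u) < - \<delta>\<close>, which keeps
      \<open>u\<close> bounded.\<close>
    have "cmod u \<le> cmod c / \<delta>" if u: "u \<in> ?C" for u
    proof -
      have "u \<noteq> 0" using u C_sub out(1) by blast
      have "\<delta> < - Re (c / u)" using neg'[OF u] by (simp add: \<delta>_def ring_distribs)
      also have "\<dots> \<le> cmod (c / u)" using abs_Re_le_cmod[of "c / u"] by linarith
      finally show ?thesis using \<open>u \<noteq> 0\<close> \<delta> by (simp add: norm_divide field_simps)
    qed
    then have "bounded ?C" by (auto simp: bounded_iff)
    then show False using unb \<open>?C \<in> components (- \<Omega>)\<close> by blast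
  qed
  \<comment> \<open>The closed half plane \<open>Re (c * w) \<le> 0\<close> and infinity in the
    coordinate \<open>v = 1 / (w - w0)\<close>, with the denominator cleared: a closed disk whose
    boundary passes through 0.\<close>
  define V where "V = {v. \<delta> * (cmod v)\<^sup>2 + Re (c * cnj v) \<le> 0}"
  have V_eq: "v = 0 \<or> Re (c * (w0 + 1 / v)) \<le> 0 \<longleftrightarrow> v \<in> V" for v
  proof (cases "v = 0")
    case False
    have "1 / v = cnj v / (cmod v)\<^sup>2"
      using False complex_div_cnj[of 1 v] by simp
    then have "c * (1 / v) = c * cnj v / of_real ((cmod v)\<^sup>2)" by simp
    then have "Re (c * (1 / v)) = Re (c * cnj v) / (cmod v)\<^sup>2"
      by (simp only: Re_divide_of_real)
    then have "Re (c * (w0 + 1 / v)) = \<delta> + Re (c * cnj v) / (cmod v)\<^sup>2"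
      by (simp only: \<delta>_def distrib_left plus_complex.sel)
    then have "Re (c * (w0 + 1 / v)) = (\<delta> * (cmod v)\<^sup>2 + Re (c * cnj v)) / (cmod v)\<^sup>2"
      using False by (simp only: add_divide_distrib) simp
    then show ?thesis using False by (simp add: V_def divide_le_0_iff)
  qed (simp add: V_def)
  have "V \<subseteq> \<Omega>"
  proof (rule subsetI, rule ccontr)
    fix v assume v: "v \<in> V" "v \<notin> \<Omega>"
    show False using V_eq[of v] v(1) out(1)[OF v(2)] E_pos[OF out(2)[OF v(2)]] by linarith
  qed
  have "closed V" unfolding V_def by (intro closed_Collect_le continuous_intros)
  moreover have "bounded V"
  proof -
    have "cmod v \<le> cmod c / \<delta>" if "v \<in> V" for v
    proof (cases "v = 0")
      case False
      have "\<delta> * (cmod v)\<^sup>2 \<le> - Re (c * cnj v)" using that by (simp add: V_def)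
      also have "\<dots> \<le> cmod (c * cnj v)" using abs_Re_le_cmod[of "c * cnj v"] by linarith
      finally have "cmod v * (\<delta> * cmod v) \<le> cmod v * cmod c"
        by (simp add: norm_mult power2_eq_square mult_ac)
      then show ?thesis using False \<delta> by (simp add: field_simps)
    qed (use \<delta> in simp)
    then show ?thesis by (auto simp: bounded_iff)
  qed
  ultimately have "compact V" by (simp add: compact_eq_bounded_closed)
  then have "compact (gi ` V)"
    using holomorphic_on_imp_continuous_on[OF gi(1)] \<open>V \<subseteq> \<Omega>\<close>
    by (intro compact_continuous_image) (auto intro: continuous_on_subset)
  moreover have "0 \<in> gi ` V"
    using gi(2)[of 0] by (force simp: g_def V_def)
  then have "gi ` V \<noteq> {}" by blast
  ultimately obtain z1 where z1: "z1 \<in> gi ` V" "\<And>z. z \<in> gi ` V \<Longrightarrow> cmod z \<le> cmod z1"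
    using continuous_attains_sup[OF _ _ continuous_on_norm_id, of "gi ` V"] by blast
  have "cmod z1 < 1"
    using z1(1) \<open>V \<subseteq> \<Omega>\<close> gi(2) by (fastforce simp: \<Omega>_def)
  have "Re (c * (p z / z)) > 0" if z: "cmod z1 < cmod z" "cmod z < 1" for z
  proof -
    have z': "z \<in> ball 0 1" "z \<noteq> 0" using z by auto
    have "g z \<notin> V"
    proof
      assume "g z \<in> V"
      then have "gi (g z) \<in> gi ` V" by (rule imageI)
      then show False using z1(2)[of z] z gi(2)[OF z'(1)] by simp
    qed
    then show ?thesis using V_eq[of "g z"] unfolding g_eq[OF z'] by linarith
  qed
  moreover obtain s where "max r (cmod z1) < s" "s < 1"
    using dense[of "max r (cmod z1)" 1] r \<open>cmod z1 < 1\<close> by auto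
  ultimately show ?thesis by (intro exI[of _ s]) auto
qed

text \<open>
  If the bound failed, every omitted value \<open>w\<close> would satisfy \<open>Re (cnj b * w\<^sup>3) > 0\<close> with \<open>b = fps_nth P 3\<close>, which
  describes three sectors. The omitted set is connected, so it lies in a single sector and hence in
  an open half plane through 0, contradicting that \<open>p z / z\<close> has constant term 0.
\<close>
lemma coeff_bound_centred:
  assumes p: "p holomorphic_on ball 0 1" and P: "p has_fps_expansion P"
    and P01: "fps_nth P 0 = 1" "fps_nth P 1 = 0"
    and inj: "inj_on (\<lambda>z. p z / z) (ball 0 1 - {0})"
  shows "cmod (fps_nth P 3) \<le> 2 / 3"
proof (rule ccontr)
  let ?b = "fps_nth P 3"
  assume big: "\<not> cmod ?b \<le> 2 / 3"
  have p0: "p 0 = 1"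
    using has_fps_expansion_imp_0_eq_fps_nth_0[OF P] P01 by simp
  define E where "E = {w. \<forall>z\<in>ball 0 1. p z \<noteq> w * z}"
  \<comment> \<open>The series of \<open>p z / z - w\<close> has constant term \<open>- w\<close>,
    so the previous bound controls \<open>?b - w ^ 3 / 12\<close>. Without the claimed sign,
    \<open>?b\<close> and \<open>- (w ^ 3)\<close> make an angle of at most pi / 2, and the sum is
    no shorter than \<open>?b\<close>.\<close>
  have pos: "Re (cnj ?b * w ^ 3) > 0" if w: "w \<in> E" for w
  proof (rule ccontr)
    assume neg: "\<not> Re (cnj ?b * w ^ 3) > 0"
    let ?P = "P - fps_const w * fps_X"
    have "cmod (fps_nth ?P 3 + fps_nth ?P 1 ^ 3 / 12) \<le> 2 / 3"
    proof (rule nonvanishing_coeff_bound)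
      show "(\<lambda>z. p z - w * z) has_fps_expansion ?P" by (intro fps_expansion_intros P)
      show "(\<lambda>z. p z - w * z) holomorphic_on ball 0 1" by (intro holomorphic_intros p)
      have "inj_on (\<lambda>z. p z / z - w) (ball 0 1 - {0})"
        using inj by (auto simp: inj_on_def)
      then show "inj_on (\<lambda>z. (p z - w * z) / z) (ball 0 1 - {0})"
        by (rule inj_on_cong[THEN iffD1, rotated]) (simp add: diff_divide_distrib)
    qed (use w P01 in \<open>auto simp: E_def\<close>)
    then have "cmod (?b - w ^ 3 / 12) \<le> 2 / 3" using P01 by (simp add: power3_eq_cube)
    moreover have "(cmod ?b)\<^sup>2 \<le> (cmod (?b - w ^ 3 / 12))\<^sup>2"
    proof -
      have "(cmod (u - v / 12))\<^sup>2 = (cmod u)\<^sup>2 - Re (cnj u * v) / 6 + (cmod (v / 12))\<^sup>2" for u v :: complex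
        unfolding cmod_power2 by (simp add: power2_eq_square field_simps)
      from this[of ?b "w ^ 3"] show ?thesis
        using neg zero_le_power2[of "cmod (w ^ 3 / 12)"] by linarith
    qed
    then have "cmod ?b \<le> cmod (?b - w ^ 3 / 12)" by (rule power2_le_imp_le) simp
    ultimately show False using big by simp
  qed
  \<comment> \<open>If every value were attained, the inverse of \<open>p z / z\<close> would be a
    bounded entire function, against Liouville's theorem.\<close>
  have "\<exists>w. w \<in> E"
  proof (rule ccontr)
    assume "\<nexists>w. w \<in> E"
    let ?G = "\<lambda>z. p z / z" and ?U = "ball 0 1 - {0::complex}"
    have "w \<in> ?G ` ?U" for w
    proof -
      obtain z where z: "z \<in> ball 0 1" "p z = w * z"
        using \<open>\<nexists>w. w \<in> E\<close> unfolding E_def by blast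
      then have "z \<noteq> 0" using p0 by auto
      then show ?thesis using z by (intro image_eqI[of _ _ z]) auto
    qed
    then have surj: "?G ` ?U = UNIV" by auto
    have hol: "?G holomorphic_on ?U"
      by (intro holomorphic_intros holomorphic_on_subset[OF p]) auto
    then obtain gi where gi: "gi holomorphic_on UNIV" "\<And>z. z \<in> ?U \<Longrightarrow> gi (?G z) = z"
      using holomorphic_has_inverse[OF hol open_delete[OF open_ball] inj] unfolding surj by metis
    have "range gi \<subseteq> ball 0 1"
    proof (rule image_subsetI)
      fix w :: complex
      obtain z where "z \<in> ?U" "w = ?G z" using surj by blast
      then show "gi w \<in> ball 0 1" using gi(2)[of z] by simp
    qed
    then have "bounded (range gi)" using bounded_subset bounded_ball by blast
    then obtain c where c: "\<And>w. gi w = c"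
      using Liouville_theorem[OF gi(1)] unfolding constant_on_def by auto
    have "gi (?G (1/2)) = 1/2" "gi (?G (1/3)) = 1/3"
      by (intro gi(2); simp add: norm_divide)+
    then have "(1 / 2 :: complex) = 1 / 3" unfolding c by (rule trans[OF sym])
    then show False by simp
  qed
  then obtain w0 where w0: "w0 \<in> E" ..
  have w0nz: "w0 \<noteq> 0" using pos[OF w0] by auto
  \<comment> \<open>A cube root of \<open>cnj ?b\<close>, chosen among the three so that
    \<open>c * w0\<close> is a principal cube root, with argument below pi / 6 in modulus. Numbers
    with \<open>Re (c * w) = 0\<close> have a purely imaginary \<open>(c * w) ^ 3\<close>, so none
    of them is omitted.\<close>
  define c where "c = exp (Ln (cnj ?b * w0 ^ 3) / 3) / w0"
  have nz: "cnj ?b * w0 ^ 3 \<noteq> 0" using pos[OF w0] by (metis less_irrefl zero_complex.sel(1))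
  have c3: "(c * w) ^ 3 = cnj ?b * w ^ 3" for w
  proof -
    have "exp (Ln (cnj ?b * w0 ^ 3) / 3) ^ 3 = cnj ?b * w0 ^ 3"
      using nz exp_of_nat_mult[of 3 "Ln (cnj ?b * w0 ^ 3) / 3"] by simp
    then show ?thesis using w0nz by (simp add: c_def power_mult_distrib power_divide)
  qed
  have cE: "Re (c * w) \<noteq> 0" if "w \<in> E" for w
  proof
    assume "Re (c * w) = 0"
    then have "Re ((c * w) ^ 3) = 0" by (simp add: power3_eq_cube)
    then show False using pos[OF that] unfolding c3 by simp
  qed
  have cw0: "Re (c * w0) > 0"
  proof -
    have "c * w0 = exp (Ln (cnj ?b * w0 ^ 3) / 3)" using w0nz by (simp add: c_def)
    moreover have "\<bar>Im (Ln (cnj ?b * w0 ^ 3))\<bar> < pi / 2"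
      using pos[OF w0] nz Re_Ln_pos_lt by blast
    then have "cos (Im (Ln (cnj ?b * w0 ^ 3)) / 3) > 0"
      by (intro cos_gt_zero_pi) linarith+
    ultimately show ?thesis by (simp only: Re_exp) simp
  qed
  obtain r where r: "0 < r" "r < 1" "\<And>z. r < cmod z \<Longrightarrow> cmod z < 1 \<Longrightarrow> Re (c * (p z / z)) > 0"
    using omitted_values_half_plane[OF p p0 inj E_def w0 cw0 cE, of 0] by auto
  obtain s where s: "r < s" "s < 1" using dense[OF r(2)] by blast
  let ?g = "circlepath 0 s"
  have cg: "cmod (?g t) = s" for t using s r by (simp add: circlepath norm_mult)
  have gnz: "?g t \<noteq> 0" for t using s r by (simp add: circlepath)
  have "((\<lambda>t. c * (p (?g t) / ?g t ^ 1)) has_integral c * fps_nth P 1) {0..1}"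
    by (intro has_integral_mult_right circlepath_integral_coeff[OF p P]) (use s r in auto)
  from has_integral_Re[OF this] have I: "((\<lambda>t. Re (c * (p (?g t) / ?g t))) has_integral 0) (cbox 0 1)"
    by (simp only: P01 power_one_right mult_zero_right zero_complex.sel cbox_interval)
  have "continuous_on (cbox 0 1) ?g" unfolding circlepath by (intro continuous_intros)
  then have "continuous_on (cbox 0 1) (\<lambda>t. Re (c * (p (?g t) / ?g t)))"
    using gnz cg s by (intro continuous_intros continuous_on_compose2[OF holomorphic_on_imp_continuous_on[OF p]]) auto
  from has_integral_0_cbox_imp_0[OF this _ I, of 0] have "Re (c * (p (?g 0) / ?g 0)) = 0"
    using r(3) cg s by (simp add: less_imp_le)
  then show False using r(3)[of "?g 0"] cg s by simp
qed

lemma coeff_bound: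
  assumes p: "p holomorphic_on ball 0 1" and P: "p has_fps_expansion P"
    and P0: "fps_nth P 0 = 1"
    and inj: "inj_on (\<lambda>z. p z / z) (ball 0 1 - {0})"
  shows "cmod (fps_nth P 3) \<le> 2 / 3"
proof -
  let ?P = "P - fps_const (fps_nth P 1) * fps_X"
  have "inj_on (\<lambda>z. p z / z - fps_nth P 1) (ball 0 1 - {0})"
    using inj by (auto simp: inj_on_def)
  then have "inj_on (\<lambda>z. (p z - fps_nth P 1 * z) / z) (ball 0 1 - {0})"
    by (rule inj_on_cong[THEN iffD1, rotated]) (simp add: diff_divide_distrib)
  then have "cmod (fps_nth ?P 3) \<le> 2 / 3"
    by (intro coeff_bound_centred[of "\<lambda>z. p z - fps_nth P 1 * z"] fps_expansion_intros P holomorphic_intros p)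
       (simp_all add: P0)
  then show ?thesis by simp
qed

section \<open>The Schwarzian derivative\<close>

text \<open>The image of 0 is \<open>a\<close>; the rotation \<open>e\<close> will later serve to
  put a second point on the positive real axis.\<close>

definition disk_aut :: "complex \<Rightarrow> complex \<Rightarrow> complex \<Rightarrow> complex" where
  "disk_aut e a z = (e * z + a) / (1 + cnj a * e * z)"

locale disk_automorphism =
  fixes e a :: complex
  assumes e: "cmod e = 1" and a: "cmod a < 1"
begin

abbreviation "\<sigma> \<equiv> disk_aut e a"

lemma e_cnj: "e * cnj e = 1" "e \<noteq> 0"
  using e complex_norm_square[of e] by auto

lemma denom_nonzero:
  assumes "z \<in> ball 0 1"
  shows "1 + cnj a * e * z \<noteq> 0"
proof
  assume "1 + cnj a * e * z = 0"
  then have "cmod (cnj a * e * z) = 1"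
    by (metis add_eq_0_iff norm_minus_cancel norm_one)
  moreover have "cmod (cnj a * e * z) < 1 * 1"
    unfolding norm_mult using assms a e by (intro mult_strict_mono') auto
  ultimately show False by simp
qed

lemma one_minus_norm_nonzero: "1 - a * cnj a \<noteq> 0"
proof -
  have "(cmod a)\<^sup>2 < 1" using a by (simp add: power_less_one_iff)
  then show ?thesis
    unfolding complex_norm_square[symmetric] by (metis eq_iff_diff_eq_0 less_irrefl of_real_eq_1_iff)
qed

lemma one_minus_norm_sq:
  assumes "z \<in> ball 0 1"
  shows "1 - (cmod (\<sigma> z))\<^sup>2 = (1 - (cmod a)\<^sup>2) * (1 - (cmod z)\<^sup>2) / (cmod (1 + cnj a * e * z))\<^sup>2"
proof -
  have "(cmod (1 + cnj a * u))\<^sup>2 - (cmod (u + a))\<^sup>2 = (1 - (cmod a)\<^sup>2) * (1 - (cmod u)\<^sup>2)" for u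
    unfolding cmod_power2 by (simp add: power2_eq_square algebra_simps)
  from this[of "e * z"] show ?thesis
    using denom_nonzero[OF assms] e
    by (simp add: disk_aut_def norm_divide norm_mult power_divide power_mult_distrib field_simps mult.assoc)
qed

lemma maps_ball:
  assumes "z \<in> ball 0 1"
  shows "\<sigma> z \<in> ball 0 1"
proof -
  have "(1 - (cmod a)\<^sup>2) * (1 - (cmod z)\<^sup>2) / (cmod (1 + cnj a * e * z))\<^sup>2 > 0"
    using assms a denom_nonzero[OF assms]
    by (intro divide_pos_pos mult_pos_pos) (auto simp: power_less_one_iff)
  then have "(cmod (\<sigma> z))\<^sup>2 < 1" using one_minus_norm_sq[OF assms] by linarith
  then show ?thesis by (simp add: power_less_one_iff)
qed

lemma has_deriv:
  assumes "z \<in> ball 0 1"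
  shows "(\<sigma> has_field_derivative e * (1 - a * cnj a) / (1 + cnj a * e * z)\<^sup>2) (at z)"
  unfolding disk_aut_def[abs_def] using denom_nonzero[OF assms]
  by (auto intro!: derivative_eq_intros simp: power2_eq_square field_simps)

lemma holomorphic: "\<sigma> holomorphic_on ball 0 1"
  using has_deriv by (subst holomorphic_on_open) blast+

lemma deriv_eq: "z \<in> ball 0 1 \<Longrightarrow> deriv \<sigma> z = e * (1 - a * cnj a) / (1 + cnj a * e * z)\<^sup>2"
  using has_deriv DERIV_imp_deriv by blast

lemma deriv_nonzero: "z \<in> ball 0 1 \<Longrightarrow> deriv \<sigma> z \<noteq> 0"
  using e_cnj one_minus_norm_nonzero denom_nonzero by (simp add: deriv_eq)

text \<open>Equality in the Schwarz-Pick lemma. It converts powers of the weight at z into powers of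
  the weight at \<open>\<sigma> z\<close>.\<close>

lemma norm_deriv:
  assumes "z \<in> ball 0 1"
  shows "cmod (deriv \<sigma> z) * (1 - (cmod z)\<^sup>2) = 1 - (cmod (\<sigma> z))\<^sup>2"
proof -
  have "cmod (1 - a * cnj a) = 1 - (cmod a)\<^sup>2"
  proof -
    have "(cmod a)\<^sup>2 < 1" using a by (simp add: power_less_one_iff)
    moreover have "1 - a * cnj a = of_real (1 - (cmod a)\<^sup>2)"
      by (simp add: complex_norm_square del: of_real_power)
    ultimately show ?thesis by (simp only: norm_of_real abs_of_pos diff_gt_0_iff_gt)
  qed
  then show ?thesis
    unfolding one_minus_norm_sq[OF assms] deriv_eq[OF assms] norm_divide norm_mult norm_power e by simp
qed

lemma surj:
  assumes "w \<in> ball 0 1"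
  obtains z where "z \<in> ball 0 1" "\<sigma> z = w"
proof -
  interpret inv: disk_automorphism 1 "- a" by unfold_locales (use a in auto)
  let ?u = "disk_aut 1 (- a) w"
  have u: "?u \<in> ball 0 1" by (rule inv.maps_ball[OF assms])
  have d: "1 - cnj a * w \<noteq> 0" using inv.denom_nonzero[OF assms] by simp
  have z: "?u / e \<in> ball 0 1" using u e by (simp add: norm_divide)
  have "1 + cnj a * ?u = (1 - a * cnj a) / (1 - cnj a * w)"
    using d by (simp add: disk_aut_def field_simps)
  moreover have "?u + a = w * (1 - a * cnj a) / (1 - cnj a * w)"
    using d by (simp add: disk_aut_def field_simps)
  ultimately have "\<sigma> (?u / e) = w"
    using e_cnj one_minus_norm_nonzero d by (simp add: disk_aut_def[of e])
  then show thesis using that z by blast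
qed

lemma inj: "inj_on \<sigma> (ball 0 1)"
proof (rule inj_onI)
  fix z w assume zw: "z \<in> ball 0 1" "w \<in> ball 0 1" and "\<sigma> z = \<sigma> w"
  then have "(e * z + a) * (1 + cnj a * e * w) = (e * w + a) * (1 + cnj a * e * z)"
    using denom_nonzero[OF zw(1)] denom_nonzero[OF zw(2)] by (simp add: disk_aut_def frac_eq_eq)
  then have "e * (1 - a * cnj a) * (z - w) = 0" by (simp add: algebra_simps)
  then show "z = w" using e_cnj one_minus_norm_nonzero by simp
qed

text \<open>The Christoffel form of conformal invariance of the hyperbolic metric.\<close>
lemma second_deriv:
  assumes z: "z \<in> ball 0 1"
  shows "deriv (deriv \<sigma>) z = 2 * cnj z / (1 - (cmod z)\<^sup>2) * deriv \<sigma> z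
     - 2 * cnj (\<sigma> z) / (1 - (cmod (\<sigma> z))\<^sup>2) * (deriv \<sigma> z)\<^sup>2"
proof -
  define N where "N = 1 + cnj a * e * z"
  have N: "N \<noteq> 0" using denom_nonzero[OF z] by (simp add: N_def)
  have beta: "1 - z * cnj z \<noteq> 0"
  proof -
    have "(cmod z)\<^sup>2 < 1" using z by (simp add: power_less_one_iff)
    then show ?thesis
      unfolding complex_norm_square[symmetric] by (metis eq_iff_diff_eq_0 less_irrefl of_real_eq_1_iff)
  qed
  have "((\<lambda>z. e * (1 - a * cnj a) / (1 + cnj a * e * z)\<^sup>2) has_field_derivative
     - 2 * cnj a * e\<^sup>2 * (1 - a * cnj a) / N ^ 3) (at z)"
    using N by (auto intro!: derivative_eq_intros simp: N_def power2_eq_square power3_eq_cube divide_simps)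
  then have "(deriv \<sigma> has_field_derivative - 2 * cnj a * e\<^sup>2 * (1 - a * cnj a) / N ^ 3) (at z)"
    by (rule has_field_derivative_transform_within_open[where S="ball 0 1"]) (use z deriv_eq in auto)
  then have d2: "deriv (deriv \<sigma>) z = - 2 * cnj a * e\<^sup>2 * (1 - a * cnj a) / N ^ 3"
    by (rule DERIV_imp_deriv)
  have cz: "of_real (1 - (cmod u)\<^sup>2) = 1 - u * cnj u" for u
    by (simp add: complex_norm_square del: of_real_power)
  have s: "of_real (1 - (cmod (\<sigma> z))\<^sup>2) = (1 - a * cnj a) * (1 - z * cnj z) / (N * cnj N)"
    unfolding one_minus_norm_sq[OF z] of_real_divide of_real_mult cz N_def[symmetric]
    by (simp add: complex_norm_square[symmetric])
  have "2 * cnj (\<sigma> z) / (1 - (cmod (\<sigma> z))\<^sup>2) * (deriv \<sigma> z)\<^sup>2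
     = 2 * ((cnj e * cnj z + cnj a) / cnj N) / ((1 - a * cnj a) * (1 - z * cnj z) / (N * cnj N)) *
        (e * (1 - a * cnj a) / N\<^sup>2)\<^sup>2"
    unfolding s[unfolded of_real_diff of_real_1, symmetric] deriv_eq[OF z] by (simp add: disk_aut_def N_def)
  also have "\<dots> = 2 * e * (1 - a * cnj a) / ((1 - z * cnj z) * N ^ 3) * (e * (cnj e * cnj z + cnj a))"
  proof -
    have gen: "2 * (u / M) / (\<alpha> * \<beta> / (N * M)) * (e * \<alpha> / N\<^sup>2)\<^sup>2 = 2 * e * \<alpha> / (\<beta> * N ^ 3) * (e * u)"
      if "M \<noteq> 0" "\<alpha> \<noteq> 0" "\<beta> \<noteq> 0" for u M \<alpha> \<beta>
      using that N by (simp add: field_simps power2_eq_square power3_eq_cube)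
    have "cnj N \<noteq> 0" using N by simp
    then show ?thesis by (rule gen[OF _ one_minus_norm_nonzero beta])
  qed
  also have "e * (cnj e * cnj z + cnj a) = cnj z + cnj a * e"
    using e_cnj by (simp add: distrib_left mult.assoc[symmetric])
  finally have t2: "2 * cnj (\<sigma> z) / (1 - (cmod (\<sigma> z))\<^sup>2) * (deriv \<sigma> z)\<^sup>2 = 
      2 * e * (1 - a * cnj a) / ((1 - z * cnj z) * N ^ 3) * (cnj z + cnj a * e)" .
  have t1: "2 * cnj z / (1 - (cmod z)\<^sup>2) * deriv \<sigma> z = 
      2 * e * (1 - a * cnj a) / ((1 - z * cnj z) * N ^ 3) * (cnj z * N)"
    unfolding deriv_eq[OF z] cz[of z, unfolded of_real_diff of_real_1, symmetric] N_def[symmetric]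
    using N by (simp add: power2_eq_square power3_eq_cube)
  show ?thesis
    unfolding d2 t1 t2 using N beta
    by (simp add: divide_simps power2_eq_square) (simp add: N_def algebra_simps)
qed

text \<open>V is the covariant derivative of a quadratic differential for the hyperbolic metric,
  whence the constant 4, twice that in \<open>second_deriv\<close>. The terms from differentiating
  \<open>(deriv \<sigma> w)\<^sup>2\<close> are exactly those that \<open>second_deriv\<close>
  trades for the correction at \<open>\<sigma> z\<close>. Together with \<open>norm_deriv\<close>
  this makes the weighted modulus invariant.\<close>

lemma V_transform:
  assumes z: "z \<in> ball 0 1" and \<phi>: "\<phi> field_differentiable at (\<sigma> z)"
  shows "deriv (\<lambda>w. \<phi> (\<sigma> w) * (deriv \<sigma> w)\<^sup>2) z - 4 * cnj z / (1 - (cmod z)\<^sup>2) * (\<phi> (\<sigma> z) * (deriv \<sigma> z)\<^sup>2)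
    = (deriv \<sigma> z) ^ 3 * (deriv \<phi> (\<sigma> z) - 4 * cnj (\<sigma> z) / (1 - (cmod (\<sigma> z))\<^sup>2) * \<phi> (\<sigma> z))"
proof -
  have s: "(\<sigma> has_field_derivative deriv \<sigma> z) (at z)"
    using holomorphic_derivI[OF holomorphic open_ball z] .
  have s2: "(deriv \<sigma> has_field_derivative deriv (deriv \<sigma>) z) (at z)"
    using holomorphic_derivI[OF holomorphic_deriv[OF holomorphic open_ball] open_ball z] .
  have "((\<lambda>w. \<phi> (\<sigma> w)) has_field_derivative deriv \<phi> (\<sigma> z) * deriv \<sigma> z) (at z)"
    using DERIV_chain2[OF _ s] \<phi> field_differentiable_derivI by blast
  then have "((\<lambda>w. \<phi> (\<sigma> w) * (deriv \<sigma> w)\<^sup>2) has_field_derivative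
     deriv \<phi> (\<sigma> z) * deriv \<sigma> z * (deriv \<sigma> z)\<^sup>2 + (2 * deriv \<sigma> z * deriv (deriv \<sigma>) z) * \<phi> (\<sigma> z)) (at z)"
    by (auto intro!: derivative_eq_intros s2 simp: power2_eq_square)
  then show ?thesis
    by (simp add: DERIV_imp_deriv second_deriv[OF z] power2_eq_square power3_eq_cube algebra_simps)
qed

end

section \<open>Chain rule and Moebius invariance of the Schwarzian\<close>

definition pre_schwarzian :: "(complex \<Rightarrow> complex) \<Rightarrow> complex \<Rightarrow> complex" where
  "pre_schwarzian f z = deriv (deriv f) z / deriv f z"

definition raw_schwarzian :: "(complex \<Rightarrow> complex) \<Rightarrow> complex \<Rightarrow> complex" where
  "raw_schwarzian f z = deriv (pre_schwarzian f) z - 1 / 2 * (pre_schwarzian f z)\<^sup>2"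

lemma schwarzian_eq: "schwarzian f = remove_sings (raw_schwarzian f)"
  by (simp add: schwarzian_def raw_schwarzian_def[abs_def] pre_schwarzian_def[abs_def])

lemma eventually_deriv_eq:
  assumes "eventually (\<lambda>w. f w = g w) (nhds z)"
  shows "eventually (\<lambda>w. deriv f w = deriv g w) (nhds z)"
  using eventually_eventually[of "\<lambda>w. f w = g w" z] assms
  by (auto elim!: eventually_mono intro: deriv_cong_ev)

lemma eventually_pre_schwarzian_eq:
  assumes "eventually (\<lambda>w. f w = g w) (nhds z)"
  shows "eventually (\<lambda>w. pre_schwarzian f w = pre_schwarzian g w) (nhds z)"
  using eventually_deriv_eq[OF assms] eventually_deriv_eq[OF eventually_deriv_eq[OF assms]]
  by eventually_elim (simp add: pre_schwarzian_def)

lemma raw_schwarzian_cong: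
  assumes "eventually (\<lambda>w. f w = g w) (nhds z)"
  shows "raw_schwarzian f z = raw_schwarzian g z"
  unfolding raw_schwarzian_def
  using deriv_cong_ev[OF eventually_pre_schwarzian_eq[OF assms] refl]
    eventually_nhds_x_imp_x[OF eventually_pre_schwarzian_eq[OF assms]] by simp

lemma eventually_raw_schwarzian_cong:
  assumes "eventually (\<lambda>w. f w = g w) (at z)"
  shows "eventually (\<lambda>w. raw_schwarzian f w = raw_schwarzian g w) (at z)"
proof -
  have "eventually (\<lambda>w. eventually (\<lambda>u. f u = g u) (nhds w)) (at z)"
  proof -
    obtain S where S: "open S" "z \<in> S" "\<And>w. w \<in> S \<Longrightarrow> w \<noteq> z \<Longrightarrow> f w = g w"
      using assms unfolding eventually_at_topological by blast
    have "eventually (\<lambda>w. w \<in> S - {z}) (at z)"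
      using S by (intro eventually_at_in_open) auto
    then show ?thesis
    proof eventually_elim
      case (elim w)
      then have "eventually (\<lambda>u. u \<in> S - {z}) (nhds w)"
        using S by (intro eventually_nhds_in_open open_delete) auto
      then show ?case by eventually_elim (use S in auto)
    qed
  qed
  then show ?thesis by eventually_elim (rule raw_schwarzian_cong)
qed

lemma analytic_deriv_nonzero_nhd:
  assumes "f analytic_on {z}" "deriv f z \<noteq> 0"
  shows "eventually (\<lambda>w. f analytic_on {w} \<and> deriv f w \<noteq> 0) (nhds z)"
proof -
  obtain S where S: "open S" "z \<in> S" "f holomorphic_on S"
    using assms(1) analytic_at by blast
  have "eventually (\<lambda>w. w \<in> S) (nhds z)"
    using S by (intro eventually_nhds_in_open)
  then have "eventually (\<lambda>w. f analytic_on {w}) (nhds z)"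
    by eventually_elim (use S analytic_at in blast)
  moreover have "deriv f analytic_on {z}" using assms(1) by (rule analytic_deriv)
  then have "isCont (deriv f) z" by (rule analytic_at_imp_isCont)
  then have "eventually (\<lambda>w. deriv f w \<noteq> 0) (nhds z)"
    unfolding eventually_nhds_conv_at using assms(2) by (auto intro: tendsto_imp_eventually_ne dest: isContD)
  ultimately show ?thesis by eventually_elim auto
qed

lemma analytic_pre_schwarzian:
  assumes "f analytic_on {z}" "deriv f z \<noteq> 0"
  shows "pre_schwarzian f analytic_on {z}"
  unfolding pre_schwarzian_def[abs_def]
  using assms by (intro analytic_intros analytic_deriv) auto

lemma analytic_raw_schwarzian:
  assumes "f analytic_on {z}" "deriv f z \<noteq> 0"
  shows "raw_schwarzian f analytic_on {z}"
  unfolding raw_schwarzian_def[abs_def]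
  using analytic_pre_schwarzian[OF assms] by (intro analytic_intros analytic_deriv) auto

lemma analytic_at_DERIV: "f analytic_on {z} \<Longrightarrow> (f has_field_derivative deriv f z) (at z)"
  using analytic_at holomorphic_derivI by blast

lemma pre_schwarzian_compose:
  assumes g: "g analytic_on {z}" "deriv g z \<noteq> 0"
    and f: "f analytic_on {g z}" "deriv f (g z) \<noteq> 0"
  shows "pre_schwarzian (\<lambda>w. f (g w)) z = pre_schwarzian f (g z) * deriv g z + pre_schwarzian g z"
proof -
  have chain: "deriv (\<lambda>w. f (g w)) w = deriv f (g w) * deriv g w" if "g analytic_on {w}" "f analytic_on {g w}" for w
    using DERIV_chain2[OF analytic_at_DERIV analytic_at_DERIV] that DERIV_imp_deriv by blast
  have "isCont g z" using g by (simp add: analytic_at_imp_isCont)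
  then have lim: "filterlim g (nhds (g z)) (nhds z)"
    by (metis continuous_within filterlim_at_within_not_equal isCont_def tendsto_at_iff_tendsto_nhds)
  have "eventually (\<lambda>w. f analytic_on {g w}) (nhds z)"
    by (rule eventually_mono[OF eventually_compose_filterlim[OF analytic_deriv_nonzero_nhd[OF f] lim]]) simp
  with analytic_deriv_nonzero_nhd[OF g]
  have "eventually (\<lambda>w. deriv (\<lambda>w. f (g w)) w = deriv f (g w) * deriv g w) (nhds z)"
    by eventually_elim (simp add: chain)
  then have "deriv (deriv (\<lambda>w. f (g w))) z = deriv (\<lambda>w. deriv f (g w) * deriv g w) z"
    by (intro deriv_cong_ev refl)
  also have "((\<lambda>w. deriv f (g w) * deriv g w) has_field_derivative
      (deriv (deriv f) (g z) * deriv g z) * deriv g z + deriv (deriv g) z * deriv f (g z)) (at z)"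
    by (intro DERIV_mult DERIV_chain2[OF analytic_at_DERIV] analytic_at_DERIV analytic_deriv f g)
  then have "deriv (\<lambda>w. deriv f (g w) * deriv g w) z = (deriv (deriv f) (g z) * deriv g z) * deriv g z + deriv (deriv g) z * deriv f (g z)"
    by (rule DERIV_imp_deriv)
  finally show ?thesis
    using g f by (simp add: pre_schwarzian_def chain field_simps)
qed

text \<open>The mixed term of the square cancels
  \<open>deriv (deriv g) z * pre_schwarzian f (g z)\<close>, which is what the factor 1 / 2 in the
  Schwarzian achieves.\<close>

lemma raw_schwarzian_compose:
  assumes g: "g analytic_on {z}" "deriv g z \<noteq> 0"
    and f: "f analytic_on {g z}" "deriv f (g z) \<noteq> 0"
  shows "raw_schwarzian (\<lambda>w. f (g w)) z = raw_schwarzian f (g z) * (deriv g z)\<^sup>2 + raw_schwarzian g z"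
proof -
  have "isCont g z" using g by (simp add: analytic_at_imp_isCont)
  then have "filterlim g (nhds (g z)) (nhds z)"
    by (metis continuous_within filterlim_at_within_not_equal isCont_def tendsto_at_iff_tendsto_nhds)
  from eventually_compose_filterlim[OF analytic_deriv_nonzero_nhd[OF f] this]
    analytic_deriv_nonzero_nhd[OF g]
  have "eventually (\<lambda>w. pre_schwarzian (\<lambda>w. f (g w)) w = pre_schwarzian f (g w) * deriv g w + pre_schwarzian g w) (nhds z)"
    by eventually_elim (simp add: pre_schwarzian_compose)
  then have "deriv (pre_schwarzian (\<lambda>w. f (g w))) z = deriv (\<lambda>w. pre_schwarzian f (g w) * deriv g w + pre_schwarzian g w) z"
    by (intro deriv_cong_ev refl)
  also have "((\<lambda>w. pre_schwarzian f (g w) * deriv g w + pre_schwarzian g w) has_field_derivative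
      ((deriv (pre_schwarzian f) (g z) * deriv g z) * deriv g z + deriv (deriv g) z * pre_schwarzian f (g z))
        + deriv (pre_schwarzian g) z) (at z)"
    by (intro DERIV_add DERIV_mult DERIV_chain2[OF analytic_at_DERIV] analytic_at_DERIV analytic_deriv
      analytic_pre_schwarzian f g)
  then have "deriv (\<lambda>w. pre_schwarzian f (g w) * deriv g w + pre_schwarzian g w) z =
      ((deriv (pre_schwarzian f) (g z) * deriv g z) * deriv g z + deriv (deriv g) z * pre_schwarzian f (g z))
        + deriv (pre_schwarzian g) z" by (rule DERIV_imp_deriv)
  finally have D: "deriv (pre_schwarzian (\<lambda>w. f (g w))) z = \<dots>" .
  have "deriv (deriv g) z = pre_schwarzian g z * deriv g z"
    using g by (simp add: pre_schwarzian_def)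
  then show ?thesis
    unfolding raw_schwarzian_def D pre_schwarzian_compose[OF assms] by (simp add: power2_eq_square algebra_simps)
qed

text \<open>Stated through the derivative, whose form is common to disk automorphisms and to the map
  \<open>1 / (u - c)\<close>.\<close>

lemma raw_schwarzian_moebius:
  assumes "eventually (\<lambda>w. deriv g w = C / (A * w + B)\<^sup>2) (nhds z)" "C \<noteq> 0" "A * z + B \<noteq> 0"
  shows "raw_schwarzian g z = 0"
proof -
  have "((\<lambda>w. A * w + B) \<longlongrightarrow> A * z + B) (nhds z)" by (intro tendsto_intros filterlim_ident)
  then have nz: "eventually (\<lambda>w. A * w + B \<noteq> 0) (nhds z)"
    by (rule tendsto_imp_eventually_ne) (use assms(3) in auto)
  have lin: "((\<lambda>w. A * w + B) has_field_derivative A) (at w)" for w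
    by (auto intro!: derivative_eq_intros)
  have D: "deriv (\<lambda>w. C / (A * w + B)\<^sup>2) w = - 2 * A * C / (A * w + B) ^ 3" if w: "A * w + B \<noteq> 0" for w
  proof -
    have "((\<lambda>u. C / u\<^sup>2) has_field_derivative - 2 * C / u ^ 3) (at u)" if "u \<noteq> 0" for u
      using that by (auto intro!: derivative_eq_intros simp: power2_eq_square power3_eq_cube field_simps)
    from DERIV_chain2[OF this[OF w] lin] show ?thesis
      by (simp add: DERIV_imp_deriv mult_ac)
  qed
  from eventually_deriv_eq[OF assms(1)] assms(1) nz
  have "eventually (\<lambda>w. pre_schwarzian g w = - 2 * A / (A * w + B)) (nhds z)"
  proof eventually_elim
    case (elim w)
    then show ?case using assms(2)
      by (simp add: pre_schwarzian_def D) (simp add: power2_eq_square power3_eq_cube)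
  qed
  then have "deriv (pre_schwarzian g) z = deriv (\<lambda>w. - 2 * A / (A * w + B)) z"
    and P: "pre_schwarzian g z = - 2 * A / (A * z + B)"
    by (auto intro: deriv_cong_ev dest: eventually_nhds_x_imp_x)
  moreover have "deriv (\<lambda>w. - 2 * A / (A * w + B)) z = 2 * A\<^sup>2 / (A * z + B)\<^sup>2"
  proof -
    have "((\<lambda>u. - 2 * A / u) has_field_derivative 2 * A / u\<^sup>2) (at u)" if "u \<noteq> 0" for u
      using that by (auto intro!: derivative_eq_intros simp: power2_eq_square)
    from DERIV_chain2[OF this[OF assms(3)] lin] show ?thesis
      by (simp add: DERIV_imp_deriv power2_eq_square)
  qed
  ultimately show ?thesis by (simp add: raw_schwarzian_def power_divide power_mult_distrib)
qed

lemma (in disk_automorphism) raw_schwarzian_zero: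
  assumes "z \<in> ball 0 1"
  shows "raw_schwarzian \<sigma> z = 0"
proof (rule raw_schwarzian_moebius)
  have "eventually (\<lambda>w. w \<in> ball 0 1) (nhds z)"
    using assms by (intro eventually_nhds_in_open) auto
  then show "eventually (\<lambda>w. deriv \<sigma> w = e * (1 - a * cnj a) / ((cnj a * e) * w + 1)\<^sup>2) (nhds z)"
    by eventually_elim (simp add: deriv_eq add.commute)
qed (use denom_nonzero[OF assms] e_cnj one_minus_norm_nonzero in \<open>auto simp: add.commute\<close>)

lemma (in disk_automorphism) raw_schwarzian_precompose:
  assumes "z \<in> ball 0 1" "f analytic_on {\<sigma> z}" "deriv f (\<sigma> z) \<noteq> 0"
  shows "raw_schwarzian (\<lambda>w. f (\<sigma> w)) z = raw_schwarzian f (\<sigma> z) * (deriv \<sigma> z)\<^sup>2"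
proof -
  have "\<sigma> analytic_on {z}" using holomorphic assms(1) analytic_at open_ball by blast
  then show ?thesis
    using raw_schwarzian_compose[OF _ deriv_nonzero[OF assms(1)] assms(2,3)] raw_schwarzian_zero[OF assms(1)] by simp
qed

lemma raw_schwarzian_reciprocal:
  assumes "f analytic_on {z}" "deriv f z \<noteq> 0" "f z \<noteq> c"
  shows "raw_schwarzian (\<lambda>w. 1 / (f w - c)) z = raw_schwarzian f z"
proof -
  let ?m = "\<lambda>u. 1 / (u - c)"
  have D: "deriv ?m u = - 1 / (u - c)\<^sup>2" if "u \<noteq> c" for u
    using that by (intro DERIV_imp_deriv) (auto intro!: derivative_eq_intros simp: power2_eq_square)
  have "eventually (\<lambda>u. u \<noteq> c) (nhds (f z))"
    using assms(3) by (intro t1_space_nhds) 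
  then have "eventually (\<lambda>u. deriv ?m u = - 1 / (1 * u + (- c))\<^sup>2) (nhds (f z))"
    by eventually_elim (simp add: D)
  then have "raw_schwarzian ?m (f z) = 0"
    by (rule raw_schwarzian_moebius) (use assms(3) in auto)
  moreover have "?m analytic_on {f z}" using assms(3) by (intro analytic_intros) auto
  moreover have "deriv ?m (f z) \<noteq> 0" using D[OF assms(3)] assms(3) by simp
  ultimately show ?thesis using raw_schwarzian_compose[OF assms(1,2), of ?m] by simp
qed

text \<open>Agreement on a punctured neighbourhood is turned into agreement on a full one, so that
  the derivative of \<open>schwarzian f\<close> at \<open>a\<close> can be computed from
  \<open>\<phi>\<close>.\<close>

lemma eventually_schwarzian_eq:
  assumes "eventually (\<lambda>z. raw_schwarzian f z = \<phi> z) (at a)" "\<phi> analytic_on {a}"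
  shows "eventually (\<lambda>z. schwarzian f z = \<phi> z) (nhds a)"
proof -
  obtain S where S: "open S" "a \<in> S" "\<And>w. w \<in> S \<Longrightarrow> w \<noteq> a \<Longrightarrow> raw_schwarzian f w = \<phi> w"
    using assms(1) unfolding eventually_at_topological by blast
  obtain T where T: "open T" "a \<in> T" "\<phi> holomorphic_on T"
    using assms(2) analytic_at by blast
  have "eventually (\<lambda>z. z \<in> S \<inter> T) (nhds a)"
    using S T by (intro eventually_nhds_in_open) auto
  then show ?thesis
  proof eventually_elim
    case (elim z)
    have "eventually (\<lambda>w. raw_schwarzian f w = \<phi> w) (at z)"
    proof (cases "z = a")
      case False
      have "eventually (\<lambda>w. w \<in> S - {a}) (nhds z)"
        using S elim False by (intro eventually_nhds_in_open open_delete) auto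
      then have "eventually (\<lambda>w. raw_schwarzian f w = \<phi> w) (nhds z)"
        by eventually_elim (use S in auto)
      then show ?thesis by (simp add: eventually_nhds_conv_at)
    qed (use assms in simp)
    then have "remove_sings (raw_schwarzian f) z = remove_sings \<phi> z"
      by (rule remove_sings_cong) simp
    also have "\<dots> = \<phi> z"
      using elim T analytic_at by (intro remove_sings_at_analytic) blast
    finally show ?case by (simp add: schwarzian_eq)
  qed
qed

section \<open>Univalent functions\<close>

lemma nicely_meromorphic_eventually_analytic:
  assumes "f nicely_meromorphic_on A" "open A" "z \<in> A"
  shows "eventually (\<lambda>w. w \<in> A \<and> f analytic_on {w} \<and> \<not> is_pole f w) (at z)"
proof -
  have "f meromorphic_on A" using assms(1) by (simp add: nicely_meromorphic_on_def)
  then have "isolated_singularity_at f z"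
    using assms(3) meromorphic_on_isolated_singularity meromorphic_on_subset[of f A "{z}"] by blast
  then have "eventually (\<lambda>w. \<not> is_pole f w) (at z)" by (rule eventually_not_pole)
  moreover have "eventually (\<lambda>w. w \<in> A) (at z)"
    using assms(2,3) by (rule eventually_at_in_open')
  ultimately show ?thesis
    by eventually_elim (use nicely_meromorphic_on_imp_analytic_at[OF assms(1)] in auto)
qed

lemma analytic_inj_deriv_nonzero:
  assumes "f holomorphic_on S" "open S" "inj_on f S" "z \<in> S"
  shows "f analytic_on {z}" "deriv f z \<noteq> 0"
  using assms analytic_at holomorphic_injective_imp_regular by blast+

text \<open>A Moebius map that sends the value of f at \<open>a\<close> to infinity leaves the
  Schwarzian unchanged. Away from \<open>a\<close> the result is finite, since an injective map
  takes that value nowhere else.\<close>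

lemma univalent_pole_form:
  assumes f: "f nicely_meromorphic_on ball 0 1" and univ: "univalent f" and a: "a \<in> ball 0 1"
  obtains g where "g holomorphic_on ball 0 1 - {a}" "inj_on g (ball 0 1 - {a})" "is_pole g a"
    "eventually (\<lambda>z. raw_schwarzian f z = raw_schwarzian g z) (at a)"
proof (cases "is_pole f a")
  case True
  have np: "\<not> is_pole f z" if "z \<in> ball 0 1 - {a}" for z
    using inj_onD[OF univ[unfolded univalent_def], of z a] True that a by (auto simp: sphere_map_def)
  have "f analytic_on ball 0 1 - {a}"
    using nicely_meromorphic_on_imp_analytic_at[OF f] np by (subst analytic_on_analytic_at) auto
  moreover have "inj_on f (ball 0 1 - {a})"
    using univ np by (auto simp: univalent_def inj_on_def sphere_map_def)
  ultimately show thesis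
    by (intro that[of f] analytic_imp_holomorphic True) auto
next
  case False
  define w where "w = f a"
  \<comment> \<open>At a pole, f has the dummy value 0, for which the formula would give
    \<open>- 1 / w\<close>; the value 0 set here is the limit, so \<open>g\<close> is continuous at
    the poles of f.\<close>
  define g where "g = (\<lambda>z. if is_pole f z then 0 else 1 / (f z - w))"
  have fw: "f z \<noteq> w" if "z \<in> ball 0 1 - {a}" "\<not> is_pole f z" for z
    using inj_onD[OF univ[unfolded univalent_def], of z a] False that a
    by (auto simp: sphere_map_def w_def)
  have g_ev: "eventually (\<lambda>u. g u = 1 / (f u - w)) (at z)" if "z \<in> ball 0 1" for z
    using nicely_meromorphic_eventually_analytic[OF f open_ball that]
    by eventually_elim (simp add: g_def)
  have g_mero: "g meromorphic_on {z}" if z: "z \<in> ball 0 1" for z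
  proof -
    have "f meromorphic_on {z}"
      using f z by (auto simp: nicely_meromorphic_on_def intro: meromorphic_on_subset)
    then have "(\<lambda>u. 1 / (f u - w)) meromorphic_on {z}"
      by (intro meromorphic_intros)
    then show ?thesis
      using g_ev[OF z] by (subst meromorphic_on_cong) auto
  qed
  have "g analytic_on {z}" if z: "z \<in> ball 0 1 - {a}" for z
  proof (rule meromorphic_at_isCont_imp_analytic)
    show "g meromorphic_on {z}" using g_mero z by auto
    have "((\<lambda>u. 1 / (f u - w)) \<longlongrightarrow> g z) (at z)"
    proof (cases "is_pole f z")
      case True
      then have "is_pole (\<lambda>u. f u - w) z" by (simp add: is_pole_minus_const_iff)
      then show ?thesis
        using is_pole_tendsto True by (fastforce simp: g_def o_def inverse_eq_divide)
    next
      case False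
      then have "isCont f z"
        using nicely_meromorphic_on_imp_analytic_at[OF f] z analytic_at_imp_isCont by auto
      then have "(f \<longlongrightarrow> f z) (at z)" by (rule isContD)
      then show ?thesis
        using False fw[OF z] by (auto simp: g_def intro!: tendsto_intros)
    qed
    then show "isCont g z"
      unfolding isCont_def using g_ev[of z] z by (subst filterlim_cong[OF refl refl]) auto
  qed
  then have hol: "g holomorphic_on ball 0 1 - {a}"
    by (intro analytic_imp_holomorphic) (subst analytic_on_analytic_at, auto)
  have inj: "inj_on g (ball 0 1 - {a})"
  proof (rule inj_onI)
    fix y z assume yz: "y \<in> ball 0 1 - {a}" "z \<in> ball 0 1 - {a}" "g y = g z"
    have "sphere_map f y = sphere_map f z"
      using yz(3) fw[OF yz(1)] fw[OF yz(2)]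
      by (cases "is_pole f y"; cases "is_pole f z") (auto simp: g_def sphere_map_def)
    then show "y = z" using univ yz by (auto simp: univalent_def dest: inj_onD)
  qed
  have an: "f analytic_on {a}"
    using nicely_meromorphic_on_imp_analytic_at[OF f a False] .
  have near: "eventually (\<lambda>z. z \<in> ball 0 1 - {a} \<and> f analytic_on {z} \<and> \<not> is_pole f z) (at a)"
    using nicely_meromorphic_eventually_analytic[OF f open_ball a] eventually_at_in_open[OF open_ball a]
    by eventually_elim auto
  have "is_pole (\<lambda>u. 1 / (f u - w)) a"
  proof (rule is_pole_divide)
    show "filterlim (\<lambda>u. f u - w) (at 0) (at a)"
      unfolding filterlim_at
    proof
      show "eventually (\<lambda>u. f u - w \<in> UNIV \<and> f u - w \<noteq> 0) (at a)"
        using near by eventually_elim (use fw in auto)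
      have "(f \<longlongrightarrow> w) (at a)" unfolding w_def using an analytic_at_imp_isCont isContD by blast
      then have "((\<lambda>u. f u - w) \<longlongrightarrow> w - w) (at a)" by (intro tendsto_intros)
      then show "((\<lambda>u. f u - w) \<longlongrightarrow> 0) (at a)" by simp
    qed
  qed auto
  then have pole: "is_pole g a"
    using is_pole_cong[OF g_ev[OF a] refl] by simp
  obtain S where S: "open S" "a \<in> S" "f holomorphic_on S" using an analytic_at by blast
  have inj_f: "inj_on f (S \<inter> ball 0 1)"
  proof (rule inj_onI)
    fix y z assume yz: "y \<in> S \<inter> ball 0 1" "z \<in> S \<inter> ball 0 1" "f y = f z"
    have "\<not> is_pole f y" "\<not> is_pole f z"
      using S yz not_is_pole_holomorphic by blast+
    then have "sphere_map f y = sphere_map f z" using yz(3) by (simp add: sphere_map_def)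
    then show "y = z" using univ yz by (auto simp: univalent_def dest: inj_onD)
  qed
  have d: "f analytic_on {z}" "deriv f z \<noteq> 0" if "z \<in> S \<inter> ball 0 1" for z
    using analytic_inj_deriv_nonzero[of f "S \<inter> ball 0 1" z] S inj_f that
    by (auto intro: holomorphic_on_subset)
  have "eventually (\<lambda>z. z \<in> S) (at a)" using S by (intro eventually_at_in_open')
  with near have "eventually (\<lambda>z. raw_schwarzian f z = raw_schwarzian (\<lambda>u. 1 / (f u - w)) z) (at a)"
  proof eventually_elim
    case (elim z)
    then show ?case
      using raw_schwarzian_reciprocal[OF d[of z], of w] fw[of z] by simp
  qed
  with eventually_raw_schwarzian_cong[OF g_ev[OF a]]
  have "eventually (\<lambda>z. raw_schwarzian f z = raw_schwarzian g z) (at a)"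
    by eventually_elim simp
  then show thesis using that hol inj pole by blast
qed

text \<open>The reciprocal of \<open>G\<close>, extended by 0, is injective near 0 and so has a
  nonzero derivative there. Hence the pole is simple, and this derivative, the inverse of the
  residue, is the normalizing constant \<open>c\<close>.\<close>

lemma injective_pole_simple:
  assumes G: "G holomorphic_on ball 0 1 - {0}" and inj: "inj_on G (ball 0 1 - {0})" and pole: "is_pole G 0"
  obtains p c where "p holomorphic_on ball 0 1" "p 0 = 1" "c \<noteq> 0"
    "\<And>z. z \<in> ball 0 1 - {0} \<Longrightarrow> p z = c * z * G z"
proof -
  have "eventually (\<lambda>z. G z \<noteq> 0) (at 0)" by (rule non_zero_neighbour_pole[OF pole])
  then obtain r where r: "r > 0" "\<And>z. z \<noteq> 0 \<Longrightarrow> cmod z < r \<Longrightarrow> G z \<noteq> 0"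
    unfolding eventually_at by (auto simp: dist_norm)
  define s where "s = min r 1"
  have s: "s > 0" "s \<le> 1" "s \<le> r" using r by (auto simp: s_def)
  define u where "u = (\<lambda>z. if z = 0 then 0 else inverse (G z))"
  have u: "u holomorphic_on ball 0 s"
    unfolding u_def using pole r s
    by (intro is_pole_inverse_holomorphic holomorphic_on_subset[OF G]) auto
  have "inj_on u (ball 0 s)"
  proof (rule inj_onI)
    fix y z assume yz: "y \<in> ball 0 s" "z \<in> ball 0 s" "u y = u z"
    have nz: "G z \<noteq> 0" if "z \<in> ball 0 s" "z \<noteq> 0" for z using r s that by auto
    show "y = z"
    proof (cases "y = 0 \<or> z = 0")
      case True
      then show ?thesis using yz nz[of y] nz[of z] by (auto simp: u_def split: if_splits)
    next
      case False
      then have "G y = G z" using yz(3) by (simp add: u_def)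
      then show ?thesis using inj_onD[OF inj] False yz s by auto
    qed
  qed
  then have du: "deriv u 0 \<noteq> 0"
    using holomorphic_injective_imp_regular[OF u open_ball] s by simp
  define p where "p = (\<lambda>z. if z = 0 then 1 else deriv u 0 * z * G z)"
  have "p holomorphic_on ball 0 1"
  proof (rule no_isolated_singularity')
    have "(\<lambda>z. deriv u 0 * z * G z) holomorphic_on ball 0 1 - {0}"
      by (intro holomorphic_intros G)
    then show "p holomorphic_on ball 0 1 - {0}"
      by (rule holomorphic_transform) (auto simp: p_def)
    fix z :: complex assume "z \<in> {0}"
    have "(u has_field_derivative deriv u 0) (at 0)"
      using holomorphic_derivI[OF u open_ball] s by simp
    then have "((\<lambda>z. (u z - u 0) / (z - 0)) \<longlongrightarrow> deriv u 0) (at 0)"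
      by (simp add: has_field_derivative_iff)
    then have "((\<lambda>z. deriv u 0 / (u z / z)) \<longlongrightarrow> deriv u 0 / deriv u 0) (at 0)"
      using du by (intro tendsto_intros) (simp_all add: u_def)
    moreover have "eventually (\<lambda>z. deriv u 0 / (u z / z) = p z) (at 0)"
      by (auto simp: u_def p_def eventually_at_filter field_simps)
    ultimately have "(p \<longlongrightarrow> p 0) (at 0)"
      using du tendsto_cong by (fastforce simp: p_def)
    then show "(p \<longlongrightarrow> p z) (at z within ball 0 1)"
      using \<open>z \<in> {0}\<close> tendsto_within_subset by fastforce
  qed auto
  then show thesis using that[of p "deriv u 0"] du by (simp add: p_def)
qed

text \<open>
  With \<open>q = p - z p'\<close> and \<open>v = p'' / q\<close> one has \<open>q' = - z p''\<close>, so the pre-Schwarzian of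
  \<open>p z / z\<close> is \<open>- 2 / z - z v\<close>.
\<close>
lemma raw_schwarzian_simple_pole:
  assumes p: "p analytic_on {0}" "p 0 = 1" and P: "p has_fps_expansion P" and c: "c \<noteq> 0"
    and G: "eventually (\<lambda>z. p z = c * z * G z) (at 0)"
  obtains \<psi> where "\<psi> analytic_on {0}" "eventually (\<lambda>z. raw_schwarzian G z = \<psi> z) (at 0)"
    "deriv \<psi> 0 = - 24 * fps_nth P 3"
proof -
  define q where "q = (\<lambda>z. p z - z * deriv p z)"
  define v where "v = (\<lambda>z. deriv (deriv p) z / q z)"
  \<comment> \<open>The Schwarzian of \<open>p z / z\<close> after the terms
    \<open>2 / z\<^sup>2\<close> have cancelled. Its derivative at 0 is
    \<open>- 4 * deriv v 0\<close>, and \<open>deriv v 0\<close> is the third derivative of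
    \<open>p\<close>, \<open>6 * fps_nth P 3\<close>; this is the origin of 24.\<close>
  define \<psi> where "\<psi> = (\<lambda>z. - 3 * v z - z * deriv v z - 1 / 2 * (z * v z)\<^sup>2)"
  have q0: "q 0 = 1" using p by (simp add: q_def)
  have q_an: "q analytic_on {0}"
    unfolding q_def using p by (intro analytic_intros analytic_deriv)
  have dp_an: "deriv (deriv p) analytic_on {0}" by (intro analytic_deriv p)
  have v_an: "v analytic_on {0}"
    unfolding v_def by (intro analytic_on_divide dp_an q_an) (use q0 in auto)
  have psi_an: "\<psi> analytic_on {0}"
    unfolding \<psi>_def using v_an by (intro analytic_intros analytic_deriv) auto
  have dq: "(q has_field_derivative - (z * deriv (deriv p) z)) (at z)" if "p analytic_on {z}" for z
    unfolding q_def
    by (rule derivative_eq_intros analytic_at_DERIV[OF that] analytic_at_DERIV[OF analytic_deriv[OF that]] refl)+ simp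
  have dv0: "deriv v 0 = 6 * fps_nth P 3"
  proof -
    have "(v has_field_derivative (deriv (deriv (deriv p)) 0 * q 0 - deriv (deriv p) 0 * - (0 * deriv (deriv p) 0)) / (q 0 * q 0)) (at 0)"
      unfolding v_def using q0
      by (intro DERIV_divide analytic_at_DERIV[OF dp_an] dq[OF p(1)]) simp
    then have "deriv v 0 = deriv (deriv (deriv p)) 0" using q0 by (simp add: DERIV_imp_deriv)
    then show ?thesis
      using fps_nth_fps_expansion[OF P, of 3] by (simp add: eval_nat_numeral mult.commute)
  qed
  have "(\<psi> has_field_derivative - 4 * deriv v 0) (at 0)"
    unfolding \<psi>_def
    by (auto intro!: derivative_eq_intros analytic_at_DERIV[OF v_an] analytic_at_DERIV[OF analytic_deriv[OF v_an]])
  then have dpsi: "deriv \<psi> 0 = - 24 * fps_nth P 3"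
    by (simp add: DERIV_imp_deriv dv0)
  obtain A where A: "open A" "0 \<in> A" "p holomorphic_on A" using p(1) analytic_at by blast
  obtain B where B: "open B" "0 \<in> B" "\<And>z. z \<in> B \<Longrightarrow> z \<noteq> 0 \<Longrightarrow> p z = c * z * G z"
    using G unfolding eventually_at_topological by blast
  obtain C where C: "open C" "0 \<in> C" "\<And>z. z \<in> C \<Longrightarrow> q z \<noteq> 0"
  proof -
    have "isCont q 0" using q_an by (rule analytic_at_imp_isCont)
    then have "eventually (\<lambda>z. q z \<noteq> 0) (nhds 0)"
      unfolding eventually_nhds_conv_at using q0 by (auto intro: tendsto_imp_eventually_ne dest: isContD)
    then show thesis using that unfolding eventually_nhds by blast
  qed
  define S where "S = A \<inter> B \<inter> C - {0}"
  have S: "open S" using A B C by (auto simp: S_def)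
  have Sz: "z \<noteq> 0" "q z \<noteq> 0" "p analytic_on {z}" "p z = c * z * G z" if "z \<in> S" for z
    using that A B C analytic_at by (auto simp: S_def)
  have dG: "deriv G z = - q z / (c * z\<^sup>2)" if z: "z \<in> S" for z
  proof -
    have "((\<lambda>z. p z / (c * z)) has_field_derivative (deriv p z * (c * z) - p z * c) / ((c * z) * (c * z))) (at z)"
      using Sz[OF z] c by (intro DERIV_divide analytic_at_DERIV) (auto intro!: derivative_eq_intros)
    then have "(G has_field_derivative (deriv p z * (c * z) - p z * c) / ((c * z) * (c * z))) (at z)"
      by (rule has_field_derivative_transform_within_open[OF _ S z]) (use Sz c in \<open>simp add: field_simps\<close>)
    then show ?thesis using Sz[OF z] c by (simp add: DERIV_imp_deriv q_def field_simps power2_eq_square)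
  qed
  have pre: "pre_schwarzian G z = - 2 / z - z * v z" if z: "z \<in> S" for z
  proof -
    have "((\<lambda>z. - q z / (c * z\<^sup>2)) has_field_derivative
       (- (- (z * deriv (deriv p) z)) * (c * z\<^sup>2) - (- q z) * (c * (2 * z))) / ((c * z\<^sup>2) * (c * z\<^sup>2))) (at z)"
      using Sz[OF z] c by (intro DERIV_divide DERIV_minus dq) (auto intro!: derivative_eq_intros)
    then have "(deriv G has_field_derivative
       (- (- (z * deriv (deriv p) z)) * (c * z\<^sup>2) - (- q z) * (c * (2 * z))) / ((c * z\<^sup>2) * (c * z\<^sup>2))) (at z)"
      by (rule has_field_derivative_transform_within_open[OF _ S z]) (use dG in auto)
    then show ?thesis
      using Sz[OF z] c unfolding pre_schwarzian_def dG[OF z] v_def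
      by (simp add: DERIV_imp_deriv divide_simps power2_eq_square) (simp add: algebra_simps)
  qed
  have "raw_schwarzian G z = \<psi> z" if z: "z \<in> S" for z
  proof -
    have "v analytic_on {z}"
    proof -
      have "q analytic_on {z}" "deriv (deriv p) analytic_on {z}"
        unfolding q_def using Sz(3)[OF z] by (intro analytic_intros analytic_deriv; simp)+
      then show ?thesis unfolding v_def by (intro analytic_on_divide) (use Sz(2)[OF z] in auto)
    qed
    then have "((\<lambda>z. - 2 / z - z * v z) has_field_derivative 2 / z\<^sup>2 - (v z + z * deriv v z)) (at z)"
      using Sz[OF z] by (auto intro!: derivative_eq_intros analytic_at_DERIV simp: power2_eq_square)
    then have "(pre_schwarzian G has_field_derivative 2 / z\<^sup>2 - (v z + z * deriv v z)) (at z)"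
      by (rule has_field_derivative_transform_within_open[OF _ S z]) (use pre in auto)
    then show ?thesis
      using Sz(1)[OF z] unfolding raw_schwarzian_def pre[OF z] \<psi>_def
      by (simp add: DERIV_imp_deriv field_simps power2_eq_square)
  qed
  moreover have "eventually (\<lambda>z. z \<in> S) (at 0)"
    unfolding S_def using A B C by (intro eventually_at_in_open) auto
  ultimately have "eventually (\<lambda>z. raw_schwarzian G z = \<psi> z) (at 0)"
    by (auto elim: eventually_mono)
  then show thesis using that psi_an dpsi by blast
qed

lemma schwarzian_locally_eq:
  assumes "eventually (\<lambda>z. raw_schwarzian f z = \<phi> z) (at a)" "\<phi> analytic_on {a}"
  shows "V_op f a = Finite (deriv \<phi> a - 4 * cnj a / (1 - (cmod a)\<^sup>2) * \<phi> a)"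
proof -
  note ev = eventually_schwarzian_eq[OF assms]
  have "is_pole (schwarzian f) a \<longleftrightarrow> is_pole \<phi> a"
    using ev by (intro is_pole_cong) (auto simp: eventually_nhds_conv_at)
  then have "\<not> is_pole (schwarzian f) a"
    using assms(2) analytic_at_imp_no_pole by blast
  moreover have "deriv (schwarzian f) a = deriv \<phi> a" by (rule deriv_cong_ev[OF ev refl])
  moreover have "schwarzian f a = \<phi> a" using ev by (rule eventually_nhds_x_imp_x)
  ultimately show ?thesis by (simp add: V_op_def)
qed

lemma univalent_V_op_bound:
  assumes f: "f nicely_meromorphic_on ball 0 1" and univ: "univalent f" and a: "a \<in> ball 0 1"
  obtains v where "V_op f a = Finite v" "(1 - (cmod a)\<^sup>2) ^ 3 * cmod v \<le> 16"
proof -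
  interpret s: disk_automorphism 1 a by unfold_locales (use a in auto)
  interpret t: disk_automorphism 1 "- a" by unfold_locales (use a in auto)
  let ?s = "disk_aut 1 a" and ?t = "disk_aut 1 (- a)"
  obtain g where g: "g holomorphic_on ball 0 1 - {a}" "inj_on g (ball 0 1 - {a})" "is_pole g a"
    "eventually (\<lambda>z. raw_schwarzian f z = raw_schwarzian g z) (at a)"
    using univalent_pole_form[OF assms] by blast
  have s0: "?s 0 = a" and ta: "?t a = 0" by (simp_all add: disk_aut_def)
  have st: "?s (?t z) = z" if z: "z \<in> ball 0 1" for z
  proof -
    have d: "1 - cnj a * z \<noteq> 0" using t.denom_nonzero[OF z] by simp
    have N: "z - a + a * (1 - cnj a * z) = z * (1 - a * cnj a)" and D: "1 - cnj a * z + cnj a * (z - a) = 1 - a * cnj a"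
      by (simp_all add: algebra_simps)
    have F: "?s (?t z) = (z - a + a * (1 - cnj a * z)) / (1 - cnj a * z + cnj a * (z - a))"
      using d by (simp add: disk_aut_def divide_simps)
    show ?thesis unfolding F N D using s.one_minus_norm_nonzero by simp
  qed
  have s_ne: "?s z \<in> ball 0 1 - {a}" if "z \<in> ball 0 1 - {0}" for z
    using s.maps_ball[of z] inj_onD[OF s.inj, of z 0] that s0 by auto
  have t_ne: "?t z \<in> ball 0 1 - {0}" if "z \<in> ball 0 1 - {a}" for z
    using t.maps_ball[of z] inj_onD[OF t.inj, of z a] that ta a by auto
  define G where "G = (\<lambda>z. g (?s z))"
  have G: "G holomorphic_on ball 0 1 - {0}"
    unfolding G_def using s_ne
    by (intro holomorphic_on_compose_gen[OF holomorphic_on_subset[OF s.holomorphic] g(1), unfolded o_def]) auto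
  have Ginj: "inj_on G (ball 0 1 - {0})"
  proof (rule inj_onI)
    fix y z assume yz: "y \<in> ball 0 1 - {0}" "z \<in> ball 0 1 - {0}" "G y = G z"
    then have "?s y = ?s z" using inj_onD[OF g(2)] s_ne by (auto simp: G_def)
    then show "y = z" using inj_onD[OF s.inj] yz by auto
  qed
  have "is_pole G 0"
    unfolding G_def
  proof (rule is_pole_compose[OF g(3)])
    have "isCont ?s 0" using s.has_deriv[of 0] DERIV_isCont by auto
    then show "(?s \<longlongrightarrow> a) (at 0)" using s0 by (simp add: isCont_def)
    have "eventually (\<lambda>z. z \<in> ball 0 1 - {0}) (at (0::complex))"
      by (intro eventually_at_in_open) auto
    then show "eventually (\<lambda>z. ?s z \<noteq> a) (at 0)"
      by eventually_elim (use s_ne in blast)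
  qed
  then obtain p c where p: "p holomorphic_on ball 0 1" "p 0 = 1" "c \<noteq> 0"
    "\<And>z. z \<in> ball 0 1 - {0} \<Longrightarrow> p z = c * z * G z"
    using injective_pole_simple[OF G Ginj] by blast
  have p_an: "p analytic_on {0}"
    using p(1) analytic_at open_ball centre_in_ball zero_less_one by blast
  then obtain P where P: "p has_fps_expansion P"
    using analytic_at_imp_has_fps_expansion_0 by blast
  have "cmod (fps_nth P 3) \<le> 2 / 3"
  proof (rule coeff_bound[OF p(1) P])
    show "fps_nth P 0 = 1" using has_fps_expansion_imp_0_eq_fps_nth_0[OF P] p(2) by simp
    have "inj_on (\<lambda>z. c * G z) (ball 0 1 - {0})"
      using Ginj p(3) by (auto simp: inj_on_def)
    then show "inj_on (\<lambda>z. p z / z) (ball 0 1 - {0})"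
      by (rule inj_on_cong[THEN iffD1, rotated]) (simp add: p(4))
  qed
  have "eventually (\<lambda>z. z \<in> ball 0 1 - {0}) (at (0::complex))"
    by (intro eventually_at_in_open) auto
  then have "eventually (\<lambda>z. p z = c * z * G z) (at 0)"
    by eventually_elim (use p(4) in auto)
  then obtain \<psi> where psi: "\<psi> analytic_on {0}" "eventually (\<lambda>z. raw_schwarzian G z = \<psi> z) (at 0)"
    "deriv \<psi> 0 = - 24 * fps_nth P 3"
    using raw_schwarzian_simple_pole[OF p_an p(2) P p(3)] by blast
  \<comment> \<open>The Schwarzian of f near \<open>a\<close>, transported back by the inverse
    automorphism. Since \<open>?t a = 0\<close>, the correction term of V vanishes at the image
    point, which leaves a multiple of \<open>deriv \<psi> 0\<close>.\<close>
  define \<phi> where "\<phi> = (\<lambda>z. \<psi> (?t z) * (deriv ?t z)\<^sup>2)"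
  have t_an: "?t analytic_on {a}" using t.holomorphic a analytic_at open_ball by blast
  have "\<phi> analytic_on {a}"
    unfolding \<phi>_def using t_an psi(1) ta
    by (intro analytic_intros analytic_deriv analytic_on_compose_gen[OF t_an psi(1), unfolded o_def]) auto
  moreover have "eventually (\<lambda>z. raw_schwarzian f z = \<phi> z) (at a)"
  proof -
    have in_ball: "eventually (\<lambda>z. z \<in> ball 0 1 - {a}) (at a)"
      using a by (intro eventually_at_in_open) auto
    have "filterlim ?t (at 0) (at a)"
      unfolding filterlim_at
    proof
      show "eventually (\<lambda>z. ?t z \<in> UNIV \<and> ?t z \<noteq> 0) (at a)"
        using in_ball by eventually_elim (use t_ne in blast)
      show "(?t \<longlongrightarrow> 0) (at a)"
        using t_an analytic_at_imp_isCont ta by (metis isCont_def)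
    qed
    from eventually_compose_filterlim[OF psi(2) this]
    have "eventually (\<lambda>z. raw_schwarzian G (?t z) = \<psi> (?t z)) (at a)" .
    moreover have "eventually (\<lambda>z. g z = G (?t z)) (at a)"
      using in_ball by eventually_elim (use st in \<open>auto simp: G_def\<close>)
    from eventually_raw_schwarzian_cong[OF this]
    have "eventually (\<lambda>z. raw_schwarzian g z = raw_schwarzian (\<lambda>z. G (?t z)) z) (at a)" .
    moreover have "eventually (\<lambda>z. raw_schwarzian (\<lambda>z. G (?t z)) z = raw_schwarzian G (?t z) * (deriv ?t z)\<^sup>2) (at a)"
      using in_ball
    proof eventually_elim
      case (elim z)
      show ?case
        using elim analytic_inj_deriv_nonzero[OF G _ Ginj t_ne[OF elim]]
        by (intro t.raw_schwarzian_precompose) auto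
    qed
    ultimately show ?thesis using g(4) by eventually_elim (simp add: \<phi>_def)
  qed
  ultimately have "V_op f a = Finite (deriv \<phi> a - 4 * cnj a / (1 - (cmod a)\<^sup>2) * \<phi> a)"
    by (rule schwarzian_locally_eq[rotated])
  moreover have "deriv \<phi> a - 4 * cnj a / (1 - (cmod a)\<^sup>2) * \<phi> a = (deriv ?t a) ^ 3 * deriv \<psi> 0"
  proof -
    have "\<psi> field_differentiable at (?t a)"
      unfolding ta using psi(1) by (rule analytic_on_imp_differentiable_at) simp
    from t.V_transform[OF a this] show ?thesis unfolding \<phi>_def ta by simp
  qed
  moreover have "(1 - (cmod a)\<^sup>2) ^ 3 * cmod ((deriv ?t a) ^ 3 * deriv \<psi> 0) \<le> 16"
  proof -
    have "(1 - (cmod a)\<^sup>2) ^ 3 * cmod ((deriv ?t a) ^ 3 * deriv \<psi> 0)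
       = (cmod (deriv ?t a) * (1 - (cmod a)\<^sup>2)) ^ 3 * cmod (deriv \<psi> 0)"
      by (simp add: norm_mult norm_power power_mult_distrib)
    also have "\<dots> = 24 * cmod (fps_nth P 3)"
      unfolding t.norm_deriv[OF a] ta psi(3) by (simp add: norm_mult)
    finally show ?thesis using \<open>cmod (fps_nth P 3) \<le> 2 / 3\<close> by simp
  qed
  ultimately show thesis using that by metis
qed

lemma weighted_norm_leI:
  assumes "\<And>z. z \<in> ball 0 1 \<Longrightarrow> \<exists>v. \<phi> z = Finite v \<and> (1 - (cmod z)\<^sup>2) ^ 3 * cmod v \<le> C"
  shows "weighted_norm 3 \<phi> \<le> ennreal C"
  unfolding weighted_norm_def
proof (rule SUP_least)
  fix z :: complex assume z: "z \<in> ball 0 1"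
  then obtain v where v: "\<phi> z = Finite v" "(1 - (cmod z)\<^sup>2) ^ 3 * cmod v \<le> C"
    using assms by blast
  have "0 < 1 - (cmod z)\<^sup>2" using z by (simp add: power_less_one_iff)
  then have "(1 - (cmod z)\<^sup>2) powr 3 = (1 - (cmod z)\<^sup>2) ^ 3"
    using powr_realpow[of "1 - (cmod z)\<^sup>2" 3] by simp
  moreover have "ennreal ((1 - (cmod z)\<^sup>2) ^ 3) * ennreal (cmod v) = ennreal ((1 - (cmod z)\<^sup>2) ^ 3 * cmod v)"
    using \<open>0 < 1 - (cmod z)\<^sup>2\<close> by (intro ennreal_mult[symmetric]) auto
  ultimately show "ennreal ((1 - (cmod z)\<^sup>2) powr 3) * sphere_abs (\<phi> z) \<le> ennreal C"
    using v by (simp add: ennreal_leI)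
qed

lemma univalent_weighted_norm_bound:
  assumes "nonconstant_meromorphic f" "univalent f"
  shows "weighted_norm 3 (V_op f) \<le> 16"
proof -
  have "weighted_norm 3 (V_op f) \<le> ennreal 16"
    by (rule weighted_norm_leI)
       (use univalent_V_op_bound[of f] assms in \<open>metis nonconstant_meromorphic_def\<close>)
  then show ?thesis by simp
qed

section \<open>Sharpness\<close>

text \<open>A threefold symmetrization of the reciprocal of a Koebe function, with expansion
  \<open>1 / z + 2 / 3 * z\<^sup>2\<close> up to higher order. The principal power is holomorphic on
  the disk because \<open>1 + z ^ 3\<close> has positive real part. At 0 the division gives 0, which
  is the value that \<open>nicely_meromorphic_on\<close> prescribes at a pole.\<close>

definition extremal_map :: "complex \<Rightarrow> complex" where
  "extremal_map z = (1 + z ^ 3) powr (2 / 3) / z"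

lemma one_plus_cube_nonpos:
  fixes z :: complex
  assumes "z \<in> ball 0 1"
  shows "1 + z ^ 3 \<notin> \<real>\<^sub>\<le>\<^sub>0" "1 + z ^ 3 \<noteq> 0"
proof -
  have "cmod (z ^ 3) < 1" using assms by (simp add: norm_power power_less_one_iff)
  then have "Re (z ^ 3) > -1" using abs_Re_le_cmod[of "z ^ 3"] by linarith
  then show *: "1 + z ^ 3 \<notin> \<real>\<^sub>\<le>\<^sub>0" by (auto simp: complex_nonpos_Reals_iff)
  then show "1 + z ^ 3 \<noteq> 0" by auto
qed

text \<open>The cube of \<open>1 / extremal_map z\<close> is \<open>u / (1 + u)\<^sup>2\<close> with \<open>u = z ^ 3\<close>, a Koebe function of \<open>u\<close>.\<close>
lemma extremal_map_inj: "inj_on extremal_map (ball 0 1 - {0})"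
proof (rule inj_onI)
  fix z w :: complex assume z: "z \<in> ball 0 1 - {0}" and w: "w \<in> ball 0 1 - {0}"
    and eq: "extremal_map z = extremal_map w"
  have cube: "extremal_map y ^ 3 = (1 + y ^ 3)\<^sup>2 / y ^ 3" if "y \<in> ball 0 1" for y
  proof -
    have nz: "1 + y ^ 3 \<noteq> 0" by (rule one_plus_cube_nonpos(2)[OF that])
    have "((1 + y ^ 3) powr (2 / 3)) ^ 3 = exp (of_nat 3 * (2 / 3 * Ln (1 + y ^ 3)))"
      unfolding exp_of_nat_mult using nz by (simp add: powr_def)
    also have "of_nat 3 * (2 / 3 * Ln (1 + y ^ 3)) = of_nat 2 * Ln (1 + y ^ 3)" by simp
    also have "exp \<dots> = (1 + y ^ 3)\<^sup>2"
      unfolding exp_of_nat_mult using nz by simp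
    finally show ?thesis by (simp add: extremal_map_def power_divide)
  qed
  define u t where "u = z ^ 3" and "t = w ^ 3"
  have ut: "u \<noteq> 0" "t \<noteq> 0" using z w by (auto simp: u_def t_def)
  have "cmod (u * t) < 1 * 1"
    unfolding norm_mult u_def t_def norm_power using z w
    by (intro mult_strict_mono') (auto simp: power_less_one_iff)
  then have "u * t \<noteq> 1" by auto
  have "(1 + u)\<^sup>2 / u = (1 + t)\<^sup>2 / t"
    using cube[of z] cube[of w] z w eq by (simp add: u_def t_def)
  then have "(1 + u)\<^sup>2 * t = (1 + t)\<^sup>2 * u" using ut by (simp add: field_simps)
  then have "(t - u) * (1 - u * t) = 0" by (simp add: power2_eq_square algebra_simps)
  then have "z ^ 3 = w ^ 3" using \<open>u * t \<noteq> 1\<close> by (auto simp: u_def t_def)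
  \<comment> \<open>Equal cubes give equal nonzero numerators, so equality of the quotients leaves
    equality of the denominators.\<close>
  then show "z = w"
    using eq one_plus_cube_nonpos(2)[of w] w z by (auto simp: extremal_map_def)
qed

lemma extremal_map_holomorphic: "extremal_map holomorphic_on ball 0 1 - {0}"
  unfolding extremal_map_def[abs_def] using one_plus_cube_nonpos
  by (intro holomorphic_intros) auto

lemma extremal_map_numerator: "(\<lambda>z::complex. (1 + z ^ 3) powr (2 / 3)) analytic_on {0}"
  by (intro analytic_intros) auto

lemma extremal_map_pole: "is_pole extremal_map 0"
  unfolding extremal_map_def[abs_def]
  by (rule is_pole_divide) (use analytic_at_imp_isCont[OF extremal_map_numerator] in \<open>auto simp: filterlim_ident\<close>)

lemma extremal_map_analytic:
  "z \<in> ball 0 1 - {0} \<Longrightarrow> extremal_map analytic_on {z}"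
  using extremal_map_holomorphic analytic_at open_delete[OF open_ball] by blast

lemma extremal_map_univalent: "univalent extremal_map"
  unfolding univalent_def
proof (rule inj_onI)
  fix z w :: complex assume z: "z \<in> ball 0 1" and w: "w \<in> ball 0 1"
    and eq: "sphere_map extremal_map z = sphere_map extremal_map w"
  have np: "is_pole extremal_map y \<longleftrightarrow> y = 0" if "y \<in> ball 0 1" for y
    using extremal_map_pole analytic_at_imp_no_pole[OF extremal_map_analytic, of y] that by auto
  show "z = w"
    using eq np[OF z] np[OF w] inj_onD[OF extremal_map_inj, of z w] z w
    by (auto simp: sphere_map_def split: if_splits)
qed

lemma extremal_map_meromorphic: "nonconstant_meromorphic extremal_map"
  unfolding nonconstant_meromorphic_def
proof
  show "\<not> extremal_map constant_on ball 0 1"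
  proof
    assume "extremal_map constant_on ball 0 1"
    then have "extremal_map (1 / 2) = extremal_map (1 / 3)"
      unfolding constant_on_def by (auto simp: norm_divide)
    then have "(1 / 2 :: complex) = 1 / 3"
      by (rule inj_onD[OF extremal_map_inj]) (auto simp: norm_divide)
    then show False by simp
  qed
  show "extremal_map nicely_meromorphic_on ball 0 1"
    unfolding nicely_meromorphic_on_def
  proof
    have "(\<lambda>z::complex. (1 + z ^ 3) powr (2 / 3)) analytic_on ball 0 1"
      using one_plus_cube_nonpos by (intro analytic_intros) auto
    then show "extremal_map meromorphic_on ball 0 1"
      unfolding extremal_map_def[abs_def] by (intro meromorphic_intros analytic_on_imp_meromorphic_on)
    show "\<forall>z\<in>ball 0 1. (is_pole extremal_map z \<and> extremal_map z = 0) \<or> (extremal_map \<longlongrightarrow> extremal_map z) (at z)"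
    proof
      fix z :: complex assume z: "z \<in> ball 0 1"
      show "(is_pole extremal_map z \<and> extremal_map z = 0) \<or> (extremal_map \<longlongrightarrow> extremal_map z) (at z)"
      proof (cases "z = 0")
        case True
        then show ?thesis using extremal_map_pole by (simp add: extremal_map_def)
      next
        case False
        then have "isCont extremal_map z" using extremal_map_analytic z by (intro analytic_at_imp_isCont) auto
        then show ?thesis using isContD by blast
      qed
    qed
  qed
qed

lemma extremal_map_weighted_norm: "16 \<le> weighted_norm 3 (V_op extremal_map)"
proof -
  let ?p = "\<lambda>z::complex. (1 + z ^ 3) powr (2 / 3)"
  have "((\<lambda>x. (1 + x) powr (2 / 3)) \<circ> (\<lambda>z::complex. z ^ 3)) has_fps_expansion
      fps_compose (fps_binomial (2 / 3)) (fps_X ^ 3)"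
    by (intro fps_expansion_intros) auto
  then have P: "?p has_fps_expansion fps_compose (fps_binomial (2 / 3)) (fps_X ^ 3)"
    by (simp add: o_def)
  have G: "eventually (\<lambda>z. ?p z = 1 * z * extremal_map z) (at 0)"
    by (auto simp: extremal_map_def eventually_at_filter)
  obtain \<psi> where psi: "\<psi> analytic_on {0}" "eventually (\<lambda>z. raw_schwarzian extremal_map z = \<psi> z) (at 0)"
    "deriv \<psi> 0 = - 24 * fps_nth (fps_compose (fps_binomial (2 / 3)) (fps_X ^ 3)) 3"
    using raw_schwarzian_simple_pole[OF extremal_map_numerator _ P _ G] by auto
  have "deriv \<psi> 0 = - 16"
    unfolding psi(3) fps_nth_compose_X_power by simp
  then have "V_op extremal_map 0 = Finite (- 16)"
    using schwarzian_locally_eq[OF psi(2,1)] by simp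
  then have "ennreal ((1 - (cmod 0)\<^sup>2) powr 3) * sphere_abs (V_op extremal_map 0) = 16"
    by simp
  moreover have "ennreal ((1 - (cmod 0)\<^sup>2) powr 3) * sphere_abs (V_op extremal_map 0) \<le> weighted_norm 3 (V_op extremal_map)"
    unfolding weighted_norm_def by (intro SUP_upper) auto
  ultimately show ?thesis by simp
qed

section \<open>The univalence criterion\<close>

text \<open>The average of \<open>z * deriv \<phi> z\<close> vanishes. On the circle of radius 1 / 2
  the factor \<open>4 * z * cnj z / (1 - (cmod z)\<^sup>2)\<close> is 4 / 3 and the weight is 27 /
  64, so \<open>4 / 3 * cmod (\<phi> 0)\<close> is at most 1 / 2 times 3 / 2 times 64 / 27, that is
  16 / 9. A radius \<open>\<rho>\<close> would give
  \<open>3 / (8 * \<rho> * (1 - \<rho>\<^sup>2)\<^sup>2)\<close>, best at \<open>1 / sqrt 5\<close>;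
  the nearby 1 / 2 keeps the numbers rational.\<close>

lemma schwarzian_bound_at_0:
  assumes \<phi>: "\<phi> holomorphic_on ball 0 1"
    and bound: "\<And>z. z \<in> ball 0 1 \<Longrightarrow>
      (1 - (cmod z)\<^sup>2) ^ 3 * cmod (deriv \<phi> z - 4 * cnj z / (1 - (cmod z)\<^sup>2) * \<phi> z) \<le> 3 / 2"
  shows "cmod (\<phi> 0) \<le> 4 / 3"
proof -
  let ?g = "circlepath 0 (1 / 2)"
  have cg: "cmod (?g t) = 1 / 2" for t by (simp add: circlepath norm_mult)
  have "\<phi> analytic_on {0}"
    using \<phi> analytic_at open_ball centre_in_ball zero_less_one by blast
  then obtain F where F: "\<phi> has_fps_expansion F"
    using analytic_at_imp_has_fps_expansion_0 by blast
  have "((\<lambda>t. \<phi> (?g t) / ?g t ^ 0) has_integral fps_nth F 0) {0..1}"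
    by (rule circlepath_integral_coeff[OF \<phi> F]) auto
  then have A: "((\<lambda>t. \<phi> (?g t)) has_integral \<phi> 0) {0..1}"
    using has_fps_expansion_imp_0_eq_fps_nth_0[OF F] by simp
  have B: "((\<lambda>t. deriv \<phi> (?g t) * ?g t ^ Suc 0) has_integral 0) {0..1}"
    by (rule circlepath_integral_mult[OF holomorphic_deriv[OF \<phi> open_ball]]) auto
  let ?v = "\<lambda>z. deriv \<phi> z - 4 * cnj z / (1 - (cmod z)\<^sup>2) * \<phi> z"
  have "((\<lambda>t. deriv \<phi> (?g t) * ?g t ^ Suc 0 - 4 / 3 * \<phi> (?g t)) has_integral 0 - 4 / 3 * \<phi> 0) {0..1}"
    by (intro has_integral_diff has_integral_mult_right A B)
  moreover have "deriv \<phi> (?g t) * ?g t ^ Suc 0 - 4 / 3 * \<phi> (?g t) = ?g t * ?v (?g t)" for t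
  proof -
    have "?g t * cnj (?g t) = of_real ((1 / 2)\<^sup>2)"
      using complex_norm_square[of "?g t"] unfolding cg by simp
    then have "4 * (?g t * cnj (?g t)) = 1" by (simp add: power2_eq_square mult.commute)
    moreover have "?g t * (4 * cnj (?g t) / (1 - (cmod (?g t))\<^sup>2)) = 4 * (?g t * cnj (?g t)) * (4 / 3)"
      unfolding cg by (simp add: power2_eq_square)
    ultimately have E1: "?g t * (4 * cnj (?g t) / (1 - (cmod (?g t))\<^sup>2)) = 4 / 3"
      by simp
    have E2: "?g t * ?v (?g t) = ?g t * deriv \<phi> (?g t)
        - (?g t * (4 * cnj (?g t) / (1 - (cmod (?g t))\<^sup>2))) * \<phi> (?g t)"
      by (simp only: right_diff_distrib mult.assoc)
    show ?thesis unfolding E2 E1 by (simp add: mult.commute)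
  qed
  ultimately have "((\<lambda>t. ?g t * ?v (?g t)) has_integral - (4 / 3 * \<phi> 0)) (cbox 0 (1::real))"
    by (simp add: cbox_interval)
  moreover have "cmod (?g t * ?v (?g t)) \<le> 16 / 9" for t
  proof -
    have "(27 / 64) * cmod (?v (?g t)) \<le> 3 / 2"
      using bound[of "?g t"] unfolding cg by (simp add: power2_eq_square power3_eq_cube cg)
    then show ?thesis unfolding norm_mult cg by simp
  qed
  ultimately have "cmod (- (4 / 3 * \<phi> 0)) \<le> 16 / 9 * measure lborel (cbox 0 (1::real))"
    by (intro has_integral_bound) auto
  then show ?thesis by (simp add: norm_mult)
qed

lemma schwarzian_bound:
  assumes \<phi>: "\<phi> holomorphic_on ball 0 1"
    and bound: "\<And>z. z \<in> ball 0 1 \<Longrightarrow>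
      (1 - (cmod z)\<^sup>2) ^ 3 * cmod (deriv \<phi> z - 4 * cnj z / (1 - (cmod z)\<^sup>2) * \<phi> z) \<le> 3 / 2"
    and a: "a \<in> ball 0 1"
  shows "(1 - (cmod a)\<^sup>2)\<^sup>2 * cmod (\<phi> a) \<le> 4 / 3"
proof -
  interpret s: disk_automorphism 1 a by unfold_locales (use a in auto)
  let ?s = "disk_aut 1 a"
  have s0: "?s 0 = a" by (simp add: disk_aut_def)
  have "cmod (\<phi> (?s 0) * (deriv ?s 0)\<^sup>2) \<le> 4 / 3"
  proof (rule schwarzian_bound_at_0)
    have "(\<lambda>z. \<phi> (?s z)) holomorphic_on ball 0 1"
      by (rule holomorphic_on_compose_gen[OF s.holomorphic \<phi>, unfolded o_def]) (use s.maps_ball in auto)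
    then show "(\<lambda>z. \<phi> (?s z) * (deriv ?s z)\<^sup>2) holomorphic_on ball 0 1"
      by (intro holomorphic_intros holomorphic_deriv s.holomorphic) auto
    fix z :: complex assume z: "z \<in> ball 0 1"
    have "\<phi> field_differentiable at (?s z)"
      using \<phi> s.maps_ball[OF z] holomorphic_on_imp_differentiable_at open_ball by blast
    from s.V_transform[OF z this]
    have "(1 - (cmod z)\<^sup>2) ^ 3 * cmod (deriv (\<lambda>z. \<phi> (?s z) * (deriv ?s z)\<^sup>2) z - 4 * cnj z / (1 - (cmod z)\<^sup>2) * (\<phi> (?s z) * (deriv ?s z)\<^sup>2))
      = (cmod (deriv ?s z) * (1 - (cmod z)\<^sup>2)) ^ 3 * cmod (deriv \<phi> (?s z) - 4 * cnj (?s z) / (1 - (cmod (?s z))\<^sup>2) * \<phi> (?s z))"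
      by (simp only: norm_mult norm_power power_mult_distrib mult_ac)
    also have "\<dots> \<le> 3 / 2"
      unfolding s.norm_deriv[OF z] by (rule bound[OF s.maps_ball[OF z]])
    finally show "(1 - (cmod z)\<^sup>2) ^ 3 * cmod (deriv (\<lambda>z. \<phi> (?s z) * (deriv ?s z)\<^sup>2) z - 4 * cnj z / (1 - (cmod z)\<^sup>2) * (\<phi> (?s z) * (deriv ?s z)\<^sup>2)) \<le> 3 / 2" .
  qed
  moreover have "cmod (deriv ?s 0) = 1 - (cmod a)\<^sup>2"
    using s.norm_deriv[of 0] by (simp add: s0)
  ultimately show ?thesis by (simp add: s0 norm_mult norm_power mult.commute)
qed

section \<open>Nehari's comparison argument\<close>

text \<open>A meromorphic derivative either avoids 0 in a punctured neighbourhood of every point or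
  vanishes in one of every point. In the second case f has no poles, because its derivative would be
  large near them, and f is constant.\<close>

lemma nonconstant_deriv_nonzero:
  assumes f: "f nicely_meromorphic_on ball 0 1" and nc: "\<not> f constant_on ball 0 1" and d: "d \<in> ball 0 1"
  shows "eventually (\<lambda>z. deriv f z \<noteq> 0) (at d)"
proof (rule ccontr)
  assume contra: "\<not> eventually (\<lambda>z. deriv f z \<noteq> 0) (at d)"
  have mero: "f meromorphic_on ball 0 1" using f by (simp add: nicely_meromorphic_on_def)
  have "eventually (\<lambda>z. deriv f z = 0) (cosparse (ball 0 1)) \<or> eventually (\<lambda>z. deriv f z \<noteq> 0) (cosparse (ball 0 1))"
    by (intro meromorphic_imp_constant_or_avoid meromorphic_on_deriv mero) auto
  then have zero: "eventually (\<lambda>z. deriv f z = 0) (at c)" if "c \<in> ball 0 1" for c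
    using contra d that by (auto simp: eventually_cosparse_open_eq)
  have an: "f analytic_on {c}" if c: "c \<in> ball 0 1" for c
  proof (rule nicely_meromorphic_on_imp_analytic_at[OF f c], rule notI)
    assume "is_pole f c"
    moreover have "f meromorphic_on {c}" using mero c by (auto intro: meromorphic_on_subset)
    ultimately have "is_pole (deriv f) c" by (simp add: is_pole_deriv_iff)
    then have "eventually (\<lambda>z. deriv f z \<noteq> 0) (at c)" by (rule non_zero_neighbour_pole)
    with zero[OF c] have "eventually (\<lambda>z. False) (at c)" by eventually_elim auto
    then show False by simp
  qed
  have "(f has_field_derivative 0) (at c within ball 0 1)" if c: "c \<in> ball 0 1" for c
  proof -
    have "isCont (deriv f) c" using an[OF c] analytic_deriv analytic_at_imp_isCont by blast
    then have "(deriv f \<longlongrightarrow> deriv f c) (at c)" by (rule isContD)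
    moreover have "(deriv f \<longlongrightarrow> 0) (at c)" using zero[OF c] by (rule tendsto_eventually)
    ultimately have "deriv f c = 0" using tendsto_unique by (metis at_neq_bot)
    then show ?thesis
      using analytic_at_DERIV[OF an[OF c]] has_field_derivative_at_within by metis
  qed
  then have "\<exists>k. \<forall>x\<in>ball 0 1. f x = k"
    by (intro has_field_derivative_zero_constant) auto
  then show False using nc by (simp add: constant_on_def)
qed

text \<open>Meant for \<open>g = deriv F\<close>: the residue \<open>j\<close> of the pre-Schwarzian
  is then positive at critical points and negative at poles of \<open>F\<close>.\<close>

lemma log_derivative_form:
  assumes g: "g meromorphic_on {c}" and nz: "eventually (\<lambda>z. g z \<noteq> 0) (at c)"
  obtains j :: int and h where "h analytic_on {c}"
    "eventually (\<lambda>z. deriv g z / g z = of_int j / (z - c) + h z) (at c)"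
    "is_pole g c \<Longrightarrow> j < 0" "g analytic_on {c} \<Longrightarrow> g c = 0 \<Longrightarrow> j > 0"
proof -
  define j where "j = zorder g c"
  define p where "p = zor_poly g c"
  have sing: "isolated_singularity_at g c" "not_essential g c"
    using g by (simp_all add: meromorphic_at_iff)
  have fr: "frequently (\<lambda>z. g z \<noteq> 0) (at c)" using nz by (simp add: eventually_frequently)
  obtain r where r: "r > 0" "p holomorphic_on cball c r" "p c \<noteq> 0"
    "\<And>w. w \<in> cball c r - {c} \<Longrightarrow> g w = p w * (w - c) powi j \<and> p w \<noteq> 0"
    using zorder_exist[OF sing fr] unfolding j_def p_def by blast
  define h where "h = (\<lambda>z. deriv p z / p z)"
  have p_hol: "p holomorphic_on ball c r" using r(2) by (rule holomorphic_on_subset) auto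
  have pnz: "p z \<noteq> 0" if "z \<in> ball c r" for z using r(3) r(4)[of z] that by (cases "z = c") auto
  have "h holomorphic_on ball c r"
    unfolding h_def using pnz by (intro holomorphic_intros holomorphic_deriv p_hol) auto
  then have h: "h analytic_on {c}" using r(1) analytic_at open_ball centre_in_ball by blast
  have "deriv g z / g z = of_int j / (z - c) + h z" if z: "z \<in> ball c r - {c}" for z
  proof -
    have zc: "z - c \<noteq> 0" using z by auto
    have "((\<lambda>w. p w * (w - c) powi j) has_field_derivative
        deriv p z * (z - c) powi j + (of_int j * (z - c) powi (j - 1) * 1) * p z) (at z)"
      using z zc holomorphic_derivI[OF p_hol open_ball, of z]
      by (intro DERIV_mult DERIV_power_int) (auto intro!: derivative_eq_intros)
    then have "(g has_field_derivative deriv p z * (z - c) powi j + (of_int j * (z - c) powi (j - 1) * 1) * p z) (at z)"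
      by (rule has_field_derivative_transform_within_open[where S="ball c r - {c}"]) (use z r(4) in auto)
    then have "deriv g z = deriv p z * (z - c) powi j + of_int j * ((z - c) powi j / (z - c)) * p z"
      using zc by (simp add: DERIV_imp_deriv power_int_diff)
    moreover have "g z = p z * (z - c) powi j" "p z \<noteq> 0"
      using r(4)[of z] z by auto
    moreover have "(z - c) powi j \<noteq> 0" using zc by simp
    moreover have "(u * Q + of_int j * (Q / (z - c)) * v) / (v * Q) = of_int j / (z - c) + u / v"
      if "Q \<noteq> 0" "v \<noteq> 0" for u v Q
      using that zc by (simp add: field_simps)
    ultimately show ?thesis by (simp only: h_def)
  qed
  moreover have "eventually (\<lambda>z. z \<in> ball c r - {c}) (at c)"
    using r(1) by (intro eventually_at_in_open) auto
  ultimately have "eventually (\<lambda>z. deriv g z / g z = of_int j / (z - c) + h z) (at c)"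
    by (auto elim: eventually_mono)
  then show thesis
    using that[of h j] h isolated_pole_imp_neg_zorder[OF sing(1)] zorder_pos_iff'[OF _ fr]
    unfolding j_def by blast
qed

text \<open>At the first zero after \<open>a\<close> the positive derivative makes \<open>d\<close>
  negative just before, and the intermediate value theorem yields an even earlier zero.\<close>

lemma no_downcrossing:
  fixes d d' :: "real \<Rightarrow> real"
  assumes "a < b" and deriv: "\<And>t. t \<in> {a..b} \<Longrightarrow> (d has_real_derivative d' t) (at t)"
    and pos: "d a > 0" and zero: "\<And>t. t \<in> {a..b} \<Longrightarrow> d t = 0 \<Longrightarrow> d' t > 0"
  shows "d b \<ge> 0"
proof (rule ccontr)
  assume neg: "\<not> d b \<ge> 0"
  have cont: "continuous_on {a..b} d"
    using deriv by (meson DERIV_continuous_on has_field_derivative_at_within)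
  define Z where "Z = {t \<in> {a..b}. d t = 0}"
  have "closed Z"
    unfolding Z_def using continuous_closed_preimage_constant[OF cont closed_atLeastAtMost] by simp
  moreover have "bounded Z" unfolding Z_def by (rule bounded_subset[OF bounded_closed_interval]) auto
  ultimately have "compact Z" by (simp add: compact_eq_bounded_closed)
  moreover obtain s where "a \<le> s" "s \<le> b" "d s = 0"
    using IVT2'[of d b 0 a] neg pos \<open>a < b\<close> cont by auto
  then have "Z \<noteq> {}" by (auto simp: Z_def)
  ultimately obtain t where t: "t \<in> Z" "\<And>s. s \<in> Z \<Longrightarrow> t \<le> s"
    using compact_attains_inf[of Z] by blast
  have "t > a" "t \<le> b" "d t = 0" using t(1) pos by (auto simp: Z_def order_le_less)
  then obtain e where e: "e > 0" "\<And>h. 0 < h \<Longrightarrow> h < e \<Longrightarrow> d (t - h) < d t"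
    using DERIV_pos_inc_left[OF deriv[of t] zero[of t]] by force
  define h where "h = min e (t - a) / 2"
  have h: "0 < h" "h < e" "a < t - h" using e(1) \<open>t > a\<close> by (auto simp: h_def min_def field_simps)
  then have "d (t - h) < 0" using e(2) \<open>d t = 0\<close> by simp
  moreover have "continuous_on {a..t - h} d" using cont by (rule continuous_on_subset) (use h \<open>t \<le> b\<close> in auto)
  ultimately obtain s where "a \<le> s" "s \<le> t - h" "d s = 0"
    using IVT2'[of d "t - h" 0 a] pos h by auto
  then have "s \<in> Z" using h \<open>t \<le> b\<close> by (auto simp: Z_def)
  then show False using t(2) \<open>s \<le> t - h\<close> h by fastforce
qed

text \<open>
  \<open>R = - F'' / (2 F')\<close> solves the Riccati equation \<open>R' + R\<^sup>2 = - \<phi> / 2\<close>, and so does \<open>- t / (1 - t\<^sup>2)\<close>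
  with \<open>2 / (1 - t\<^sup>2)\<^sup>2\<close> in place of \<open>\<phi>\<close>. At two consecutive poles of \<open>F\<close> the function \<open>Re R\<close> runs from
  \<open>\<infinity>\<close> to \<open>- \<infinity>\<close>, but it can cross the comparison function only upwards.
\<close>
lemma no_two_poles:
  assumes F: "F nicely_meromorphic_on ball 0 1" and \<phi>: "\<phi> holomorphic_on ball 0 1"
    and S: "\<And>c. c \<in> ball 0 1 \<Longrightarrow> eventually (\<lambda>z. raw_schwarzian F z = \<phi> z) (at c)"
    and bound: "\<And>z. z \<in> ball 0 1 \<Longrightarrow> (1 - (cmod z)\<^sup>2)\<^sup>2 * cmod (\<phi> z) \<le> 4 / 3"
    and x: "0 < x" "x < 1" and pole0: "is_pole F 0" and polex: "is_pole F (of_real x)"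
  shows False
proof -
  have mero: "F meromorphic_on ball 0 1" using F by (simp add: nicely_meromorphic_on_def)
  have nc: "\<not> F constant_on ball 0 1"
  proof
    assume "F constant_on ball 0 1"
    then have "F holomorphic_on ball 0 1" by (simp add: constant_on_imp_holomorphic_on)
    then show False using pole0 not_is_pole_holomorphic[of "ball 0 1" 0 F] by simp
  qed
  note dnz = nonconstant_deriv_nonzero[OF F nc]
  have mero_at: "deriv F meromorphic_on {c}" if "c \<in> ball 0 1" for c
    using meromorphic_on_deriv[OF mero] that by (auto intro: meromorphic_on_subset)
  have pole_deriv: "is_pole (deriv F) c \<longleftrightarrow> is_pole F c" if "c \<in> ball 0 1" for c
    by (rule is_pole_deriv_iff, rule meromorphic_on_subset[OF mero]) (use that in auto)
  have in_ball: "of_real t \<in> ball (0::complex) 1" if "0 \<le> t" "t \<le> x" for t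
    using that x by simp
  \<comment> \<open>The comparison takes place between consecutive poles, so \<open>x\<close> is
    replaced by the first pole \<open>y\<close> after 0; it exists because poles are isolated and
    the segment is compact.\<close>
  define A where "A = {t. 0 < t \<and> t \<le> x \<and> is_pole F (of_real t)}"
  have "finite A"
  proof -
    have "eventually (\<lambda>z. \<not> is_pole F z) (cosparse (ball 0 1))"
      by (rule meromorphic_on_imp_not_pole_cosparse[OF mero])
    then have "{z. \<not> \<not> is_pole F z} sparse_in ball 0 1" by (simp only: eventually_cosparse)
    moreover have "complex_of_real ` {0..x} \<subseteq> ball 0 1" using in_ball by auto
    ultimately have "{z. \<not> \<not> is_pole F z} sparse_in (complex_of_real ` {0..x})"
      by (rule sparse_in_subset)
    moreover have "compact (complex_of_real ` {0..x})"
      by (intro compact_continuous_image continuous_intros) auto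
    ultimately have "finite (complex_of_real ` {0..x} \<inter> {z. \<not> \<not> is_pole F z})"
      by (rule sparse_in_compact_finite)
    moreover have "complex_of_real ` A \<subseteq> complex_of_real ` {0..x} \<inter> {z. \<not> \<not> is_pole F z}"
      by (auto simp: A_def)
    ultimately have "finite (complex_of_real ` A)" by (rule rev_finite_subset)
    then show ?thesis by (rule finite_imageD) (auto simp: inj_on_def)
  qed
  moreover have "x \<in> A" using x polex by (simp add: A_def)
  ultimately have minA: "Min A \<in> A" "\<And>t. t \<in> A \<Longrightarrow> Min A \<le> t" using Min_in Min_le by blast+
  define y where "y = Min A"
  have yA: "y \<in> A" "\<And>t. t \<in> A \<Longrightarrow> y \<le> t" using minA by (simp_all add: y_def)
  have y: "0 < y" "y \<le> x" "is_pole F (of_real y)"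
    using yA(1) by (auto simp: A_def)
  have no_pole: "\<not> is_pole F (of_real t)" if "0 < t" "t < y" for t
    using yA(2)[of t] that y(2) by (auto simp: A_def)
  have reg: "F analytic_on {of_real t}" "deriv F (of_real t) \<noteq> 0" "raw_schwarzian F (of_real t) = \<phi> (of_real t)"
    if t: "0 < t" "t < y" for t
  proof -
    let ?c = "complex_of_real t"
    have c: "?c \<in> ball 0 1" using t y in_ball by simp
    show an: "F analytic_on {?c}"
      using nicely_meromorphic_on_imp_analytic_at[OF F c] no_pole[OF t] by blast
    have \<phi>_lim: "(\<phi> \<longlongrightarrow> \<phi> ?c) (at ?c)"
      using \<phi> c by (metis analytic_at analytic_at_imp_isCont isContD open_ball)
    \<comment> \<open>A critical point of order \<open>j\<close> would give the Schwarzian a double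
      pole with coefficient \<open>- j - j\<^sup>2 / 2\<close>, while \<open>\<phi>\<close> is
      holomorphic. The coefficient vanishes only for j = 0 and for j = -2, the case of a simple pole
      of \<open>F\<close>.\<close>
    show dn: "deriv F ?c \<noteq> 0"
    proof
      assume z: "deriv F ?c = 0"
      obtain j h where jh: "h analytic_on {?c}"
        "eventually (\<lambda>z. deriv (deriv F) z / deriv F z = of_int j / (z - ?c) + h z) (at ?c)"
        "deriv F analytic_on {?c} \<Longrightarrow> deriv F ?c = 0 \<Longrightarrow> j > 0"
        using log_derivative_form[OF mero_at[OF c] dnz[OF c]] by metis
      have j: "j > 0" using jh(3) analytic_deriv[OF an] z by blast
      obtain U where U: "open U" "?c \<in> U" "\<And>z. z \<in> U \<Longrightarrow> z \<noteq> ?c \<Longrightarrow> pre_schwarzian F z = of_int j / (z - ?c) + h z"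
        using jh(2) unfolding eventually_at_topological pre_schwarzian_def by blast
      obtain V where V: "open V" "?c \<in> V" "h holomorphic_on V" using jh(1) analytic_at by blast
      have raw: "(z - ?c)\<^sup>2 * raw_schwarzian F z = - of_int j + (z - ?c)\<^sup>2 * deriv h z - 1 / 2 * (of_int j + (z - ?c) * h z)\<^sup>2"
        if z: "z \<in> U \<inter> V - {?c}" for z
      proof -
        have "((\<lambda>z. of_int j / (z - ?c) + h z) has_field_derivative - of_int j / (z - ?c)\<^sup>2 + deriv h z) (at z)"
          using z holomorphic_derivI[OF V(3,1), of z]
          by (auto intro!: derivative_eq_intros simp: power2_eq_square)
        then have "(pre_schwarzian F has_field_derivative - of_int j / (z - ?c)\<^sup>2 + deriv h z) (at z)"
          by (rule has_field_derivative_transform_within_open[where S="U \<inter> V - {?c}"]) (use U V z in auto)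
        then have "raw_schwarzian F z = - of_int j / (z - ?c)\<^sup>2 + deriv h z - 1 / 2 * (of_int j / (z - ?c) + h z)\<^sup>2"
          unfolding raw_schwarzian_def using U(3)[of z] z by (simp add: DERIV_imp_deriv)
        moreover have "u\<^sup>2 * (- J / u\<^sup>2 + H' - 1 / 2 * (J / u + H)\<^sup>2) = - J + u\<^sup>2 * H' - 1 / 2 * (J + u * H)\<^sup>2"
          if "u \<noteq> 0" for u J H H' :: complex
          using that by (simp add: field_simps power2_eq_square)
        ultimately show ?thesis using z by simp
      qed
      have "eventually (\<lambda>z. z \<in> U \<inter> V - {?c}) (at ?c)"
        using U V by (intro eventually_at_in_open) auto
      with S[OF c] have ev: "eventually (\<lambda>z. (z - ?c)\<^sup>2 * \<phi> z = - of_int j + (z - ?c)\<^sup>2 * deriv h z - 1 / 2 * (of_int j + (z - ?c) * h z)\<^sup>2) (at ?c)"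
        by eventually_elim (use raw in metis)
      have hl: "(h \<longlongrightarrow> h ?c) (at ?c)" "(deriv h \<longlongrightarrow> deriv h ?c) (at ?c)"
        using jh(1) analytic_deriv analytic_at_imp_isCont isContD by blast+
      have "((\<lambda>z. (z - ?c)\<^sup>2 * \<phi> z) \<longlongrightarrow> (?c - ?c)\<^sup>2 * \<phi> ?c) (at ?c)"
        by (intro tendsto_intros \<phi>_lim)
      moreover have "((\<lambda>z. (z - ?c)\<^sup>2 * \<phi> z) \<longlongrightarrow>
          - of_int j + (?c - ?c)\<^sup>2 * deriv h ?c - 1 / 2 * (of_int j + (?c - ?c) * h ?c)\<^sup>2) (at ?c)"
        unfolding tendsto_cong[OF ev] by (intro tendsto_intros hl)
      ultimately have "(?c - ?c)\<^sup>2 * \<phi> ?c = - of_int j + (?c - ?c)\<^sup>2 * deriv h ?c - 1 / 2 * (of_int j + (?c - ?c) * h ?c)\<^sup>2"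
        by (rule tendsto_unique[OF at_neq_bot])
      then have "complex_of_int (2 * j + j * j) = 0" by (simp add: power2_eq_square field_simps)
      then have "2 * j + j * j = 0" by (simp only: of_int_eq_0_iff)
      moreover have "j * j > 0" using j by simp
      ultimately show False using j by linarith
    qed
    have "isCont (raw_schwarzian F) ?c"
      using analytic_raw_schwarzian[OF an dn] by (rule analytic_at_imp_isCont)
    then have "(raw_schwarzian F \<longlongrightarrow> raw_schwarzian F ?c) (at ?c)" by (rule isContD)
    moreover have "(raw_schwarzian F \<longlongrightarrow> \<phi> ?c) (at ?c)"
      by (rule Lim_transform_eventually[OF \<phi>_lim]) (use S[OF c] in \<open>auto elim: eventually_mono\<close>)
    ultimately show "raw_schwarzian F ?c = \<phi> ?c" by (rule tendsto_unique[OF at_neq_bot])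
  qed
  define P where "P = (\<lambda>t::real. pre_schwarzian F (of_real t))"
  \<comment> \<open>The real part of \<open>R\<close> minus the comparison function
    \<open>- t / (1 - t\<^sup>2)\<close>; \<open>d'\<close> is its derivative, obtained from the two
    Riccati equations.\<close>
  define d where "d = (\<lambda>t. - Re (P t) / 2 + t / (1 - t\<^sup>2))"
  define d' where "d' = (\<lambda>t. - Re (\<phi> (of_real t) + 1 / 2 * (P t)\<^sup>2) / 2 + (1 + t\<^sup>2) / (1 - t\<^sup>2)\<^sup>2)"
  have d_deriv: "(d has_real_derivative d' t) (at t)" if t: "0 < t" "t < y" for t
  proof -
    have t1: "1 - t\<^sup>2 \<noteq> 0" using t y x by (simp add: power2_eq_1_iff)
    have D: "deriv (pre_schwarzian F) (of_real t) = \<phi> (of_real t) + 1 / 2 * (P t)\<^sup>2"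
      using reg(3)[OF t] by (simp add: raw_schwarzian_def P_def diff_eq_eq)
    have "((\<lambda>s. pre_schwarzian F (of_real s)) has_vector_derivative 1 * deriv (pre_schwarzian F) (of_real t)) (at t)"
      by (rule field_vector_diff_chain_at[where f=of_real and g="pre_schwarzian F", unfolded o_def])
         (use analytic_at_DERIV[OF analytic_pre_schwarzian[OF reg(1,2)[OF t]]] has_vector_derivative_of_real[OF DERIV_ident] in auto)
    then have "((\<lambda>s. Re (pre_schwarzian F (of_real s))) has_real_derivative Re (1 * deriv (pre_schwarzian F) (of_real t))) (at t)"
      unfolding has_real_derivative_iff_has_vector_derivative
      by (rule bounded_linear.has_vector_derivative[OF bounded_linear_Re])
    then have "((\<lambda>s. Re (P s)) has_real_derivative Re (\<phi> (of_real t) + 1 / 2 * (P t)\<^sup>2)) (at t)"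
      using D by (simp add: P_def)
    moreover have "((\<lambda>t. t / (1 - t\<^sup>2)) has_real_derivative (1 + t\<^sup>2) / (1 - t\<^sup>2)\<^sup>2) (at t)"
      using t1 by (auto intro!: derivative_eq_intros simp: power2_eq_square field_simps)
    ultimately show ?thesis
      unfolding d_def d'_def by (intro DERIV_add DERIV_cdivide DERIV_minus)
  qed
  \<comment> \<open>At a crossing the real part of \<open>P t\<close> is known, its imaginary part
    contributes a square with the favourable sign, and \<open>\<phi>\<close> costs at most 2 / 3 of
    \<open>1 / (1 - t\<^sup>2)\<^sup>2\<close>, so a third of that quantity is left.\<close>
  have d_zero: "d' t > 0" if t: "0 < t" "t < y" and "d t = 0" for t
  proof -
    have t1: "1 - t\<^sup>2 > 0" using t y x by (simp add: power_less_one_iff abs_square_less_1)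
    have R: "Re (P t) = 2 * t / (1 - t\<^sup>2)" using \<open>d t = 0\<close> by (simp add: d_def mult.commute)
    have "Re ((P t)\<^sup>2) = (2 * t / (1 - t\<^sup>2))\<^sup>2 - (Im (P t))\<^sup>2"
      unfolding R[symmetric] by (simp add: power2_eq_square)
    then have sq: "Re ((P t)\<^sup>2) = 4 * (t\<^sup>2 / (1 - t\<^sup>2)\<^sup>2) - (Im (P t))\<^sup>2"
      by (simp add: power_divide power_mult_distrib)
    have Re_eq: "Re (\<phi> (of_real t) + 1 / 2 * (P t)\<^sup>2) = Re (\<phi> (of_real t)) + Re ((P t)\<^sup>2) / 2"
      by simp
    have "- (p + (4 * A - I) / 2) / 2 + B = - p / 2 + I / 4 + (B - A)" for p A B I :: real
      by (simp add: field_simps)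
    then have d'_eq: "d' t = - Re (\<phi> (of_real t)) / 2 + (Im (P t))\<^sup>2 / 4 + ((1 + t\<^sup>2) / (1 - t\<^sup>2)\<^sup>2 - t\<^sup>2 / (1 - t\<^sup>2)\<^sup>2)"
      unfolding d'_def Re_eq sq .
    have "(1 + t\<^sup>2) / (1 - t\<^sup>2)\<^sup>2 - t\<^sup>2 / (1 - t\<^sup>2)\<^sup>2 = 1 / (1 - t\<^sup>2)\<^sup>2"
      by (simp flip: diff_divide_distrib)
    moreover have "Re (\<phi> (of_real t)) \<le> 4 / 3 / (1 - t\<^sup>2)\<^sup>2"
    proof -
      have "(1 - t\<^sup>2)\<^sup>2 * cmod (\<phi> (of_real t)) \<le> 4 / 3"
        using bound[of "of_real t"] t y x by simp
      then have "cmod (\<phi> (of_real t)) \<le> 4 / 3 / (1 - t\<^sup>2)\<^sup>2"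
        using t1 by (simp add: field_simps)
      then show ?thesis using complex_Re_le_cmod order_trans by blast
    qed
    moreover have "4 / 3 / (1 - t\<^sup>2)\<^sup>2 = 4 / 3 * (1 / (1 - t\<^sup>2)\<^sup>2)" by simp
    moreover have "1 / (1 - t\<^sup>2)\<^sup>2 > 0" using t1 by simp
    moreover have "(Im (P t))\<^sup>2 \<ge> 0" by simp
    ultimately show ?thesis unfolding d'_eq by linarith
  qed
  \<comment> \<open>The factor \<open>s - t\<close> replaces the infinite one-sided limits by the
    residue, which is negative as the order of the pole of \<open>deriv F\<close>. So
    \<open>Re (P s)\<close> is negative just to the right of a pole and positive just to the left of
    one.\<close>
  have near_pole: "\<exists>j<0. ((\<lambda>s. (s - t) * Re (P s)) \<longlongrightarrow> j) (at t)" if c: "of_real t \<in> ball (0::complex) 1" and pole: "is_pole F (of_real t)" for t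
  proof -
    let ?c = "complex_of_real t"
    obtain j h where jh: "h analytic_on {?c}"
      "eventually (\<lambda>z. deriv (deriv F) z / deriv F z = of_int j / (z - ?c) + h z) (at ?c)"
      "is_pole (deriv F) ?c \<Longrightarrow> j < 0"
      using log_derivative_form[OF mero_at[OF c] dnz[OF c]] by metis
    have "j < 0" using jh(3) pole_deriv[OF c] pole by blast
    have hl: "(h \<longlongrightarrow> h ?c) (at ?c)" using jh(1) analytic_at_imp_isCont isContD by blast
    have ne: "eventually (\<lambda>z. z \<noteq> ?c) (at ?c)" by (simp add: eventually_at_filter)
    have "((\<lambda>z. of_int j + (z - ?c) * h z) \<longlongrightarrow> of_int j + (?c - ?c) * h ?c) (at ?c)"
      by (intro tendsto_intros hl)
    moreover have "eventually (\<lambda>z. of_int j + (z - ?c) * h z = (z - ?c) * pre_schwarzian F z) (at ?c)"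
      using jh(2) ne by eventually_elim (simp add: pre_schwarzian_def field_simps)
    ultimately have lim: "((\<lambda>z. (z - ?c) * pre_schwarzian F z) \<longlongrightarrow> of_int j) (at ?c)"
      by (auto intro: Lim_transform_eventually)
    have "filterlim complex_of_real (at ?c) (at t)"
      unfolding filterlim_at by (auto intro!: tendsto_intros simp: eventually_at_filter)
    from filterlim_compose[OF lim this]
    have "((\<lambda>s. Re ((of_real s - ?c) * P s)) \<longlongrightarrow> Re (of_int j)) (at t)"
      unfolding P_def by (intro tendsto_Re) simp
    then have "((\<lambda>s. (s - t) * Re (P s)) \<longlongrightarrow> of_int j) (at t)"
      by (simp flip: of_real_diff)
    then show ?thesis using \<open>j < 0\<close> by (intro exI[of _ "of_int j"]) auto
  qed
  obtain a where a: "0 < a" "a < y" "d a > 0"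
  proof -
    obtain j where j: "j < 0" "((\<lambda>s. (s - 0) * Re (P s)) \<longlongrightarrow> j) (at 0)"
      using near_pole[of 0] pole0 by auto
    have "eventually (\<lambda>s. (s - 0) * Re (P s) < 0) (at 0)"
      using j by (rule order_tendstoD(2)[rotated])
    then have "eventually (\<lambda>s. (s - 0) * Re (P s) < 0) (at_right 0)"
      by (simp add: eventually_at_split)
    moreover have "eventually (\<lambda>s. s \<in> {0<..<y}) (at_right 0)"
      using y(1) by (rule eventually_at_right_real)
    ultimately have "eventually (\<lambda>s. 0 < s \<and> s < y \<and> s * Re (P s) < 0) (at_right 0)"
      by eventually_elim simp
    then obtain s where s: "0 < s" "s < y" "s * Re (P s) < 0"
      by (metis (mono_tags, lifting) eventually_happens' trivial_limit_at_right_real)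
    then have "Re (P s) < 0" by (simp add: mult_less_0_iff)
    moreover have "s / (1 - s\<^sup>2) > 0"
      using s y x by (intro divide_pos_pos) (auto simp: power_less_one_iff abs_square_less_1)
    ultimately have "d s > 0" unfolding d_def by linarith
    then show thesis using that s by blast
  qed
  obtain b where b: "a < b" "b < y" "d b < 0"
  proof -
    have y1: "1 - y\<^sup>2 \<noteq> 0" using y x by (simp add: power2_eq_1_iff)
    obtain j where j: "j < 0" "((\<lambda>s. (s - y) * Re (P s)) \<longlongrightarrow> j) (at y)"
      using near_pole[of y] y x by auto
    have "((\<lambda>s. - ((s - y) * Re (P s)) / 2 + (s - y) * (s / (1 - s\<^sup>2))) \<longlongrightarrow> - j / 2 + (y - y) * (y / (1 - y\<^sup>2))) (at y)"
      using y1 by (intro tendsto_intros j) auto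
    moreover have "- ((s - y) * Re (P s)) / 2 + (s - y) * (s / (1 - s\<^sup>2)) = (s - y) * d s" for s
      by (simp only: d_def distrib_left)
    ultimately have "((\<lambda>s. (s - y) * d s) \<longlongrightarrow> - j / 2) (at y)" by simp
    then have "eventually (\<lambda>s. (s - y) * d s > 0) (at y)"
      by (rule order_tendstoD(1)) (use j in simp)
    then have "eventually (\<lambda>s. (s - y) * d s > 0) (at_left y)"
      by (simp add: eventually_at_split)
    moreover have "eventually (\<lambda>s. s \<in> {a<..<y}) (at_left y)"
      using a(2) by (rule eventually_at_left_real)
    ultimately have "eventually (\<lambda>s. a < s \<and> s < y \<and> (s - y) * d s > 0) (at_left y)"
      by eventually_elim simp
    then obtain s where s: "a < s" "s < y" "(s - y) * d s > 0"
      by (metis (mono_tags, lifting) eventually_happens' trivial_limit_at_left_real)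
    then have "d s < 0" by (simp add: zero_less_mult_iff)
    then show thesis using that s by blast
  qed
  have "d b \<ge> 0"
    by (rule no_downcrossing[of a b d d']) (use a b d_deriv d_zero in auto)
  then show False using b by simp
qed

text \<open>If f took a value twice, an automorphism would move the two points to 0 and to a point
  of the positive real axis, and a Moebius map the common value to infinity. The Schwarzian bound
  survives both, which puts one in the situation of \<open>no_two_poles\<close>.\<close>

lemma small_norm_univalent:
  assumes f: "nonconstant_meromorphic f" and small: "weighted_norm 3 (V_op f) \<le> 3 / 2"
  shows "univalent f"
proof (rule ccontr)
  assume "\<not> univalent f"
  have nice: "f nicely_meromorphic_on ball 0 1" and nc: "\<not> f constant_on ball 0 1"
    using f by (auto simp: nonconstant_meromorphic_def)
  have mero: "f meromorphic_on ball 0 1" using nice by (simp add: nicely_meromorphic_on_def)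
  define \<phi> where "\<phi> = schwarzian f"
  have raw_mero: "raw_schwarzian f meromorphic_on ball 0 1"
    unfolding raw_schwarzian_def[abs_def] pre_schwarzian_def[abs_def]
    by (intro meromorphic_intros mero)
  have small_at: "ennreal ((1 - (cmod z)\<^sup>2) ^ 3) * sphere_abs (V_op f z) \<le> 3 / 2" if z: "z \<in> ball 0 1" for z
  proof -
    have "0 < 1 - (cmod z)\<^sup>2" using z by (simp add: power_less_one_iff)
    then have "(1 - (cmod z)\<^sup>2) powr 3 = (1 - (cmod z)\<^sup>2) ^ 3"
      using powr_realpow[of "1 - (cmod z)\<^sup>2" 3] by simp
    then have "ennreal ((1 - (cmod z)\<^sup>2) ^ 3) * sphere_abs (V_op f z) \<le> weighted_norm 3 (V_op f)"
      unfolding weighted_norm_def by (metis (mono_tags, lifting) SUP_upper z)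
    then show ?thesis using small by (rule order_trans)
  qed
  \<comment> \<open>Here the convention that V is infinite at poles of the Schwarzian matters: it
    makes a finite norm force \<open>\<phi>\<close> to be holomorphic.\<close>
  have no_pole: "\<not> is_pole \<phi> z" if z: "z \<in> ball 0 1" for z
  proof
    assume "is_pole \<phi> z"
    then have "sphere_abs (V_op f z) = \<infinity>" by (simp add: V_op_def \<phi>_def)
    moreover have "0 < 1 - (cmod z)\<^sup>2" using z by (simp add: power_less_one_iff)
    ultimately have "\<infinity> \<le> (3 / 2 :: ennreal)" using small_at[OF z] by (simp add: ennreal_mult_top)
    then show False by (simp add: top_unique ennreal_divide_eq_top_iff)
  qed
  have "\<phi> nicely_meromorphic_on ball 0 1"
    unfolding \<phi>_def schwarzian_eq by (rule remove_sings_nicely_meromorphic[OF raw_mero])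
  then have "\<phi> analytic_on {z}" if "z \<in> ball 0 1" for z
    using nicely_meromorphic_on_imp_analytic_at no_pole that by blast
  then have \<phi>: "\<phi> holomorphic_on ball 0 1"
    by (intro analytic_imp_holomorphic) (subst analytic_on_analytic_at, auto)
  have S: "eventually (\<lambda>z. raw_schwarzian f z = \<phi> z) (at c)" if c: "c \<in> ball 0 1" for c
  proof -
    have "isolated_singularity_at (raw_schwarzian f) c"
      using raw_mero c meromorphic_on_isolated_singularity meromorphic_on_subset[of _ _ "{c}"] by blast
    from eventually_remove_sings_eq_at[OF this] show ?thesis
      unfolding \<phi>_def schwarzian_eq by eventually_elim simp
  qed
  have bound: "(1 - (cmod z)\<^sup>2)\<^sup>2 * cmod (\<phi> z) \<le> 4 / 3" if z: "z \<in> ball 0 1" for z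
  proof (rule schwarzian_bound[OF \<phi> _ z])
    fix z :: complex assume z: "z \<in> ball 0 1"
    have "0 < 1 - (cmod z)\<^sup>2" using z by (simp add: power_less_one_iff)
    let ?v = "deriv \<phi> z - 4 * cnj z / (1 - (cmod z)\<^sup>2) * \<phi> z"
    have "sphere_abs (V_op f z) = ennreal (cmod ?v)"
      using no_pole[OF z] by (simp add: V_op_def \<phi>_def)
    then have "ennreal ((1 - (cmod z)\<^sup>2) ^ 3 * cmod ?v) \<le> 3 / 2"
      using small_at[OF z] \<open>0 < 1 - (cmod z)\<^sup>2\<close> by (simp add: ennreal_mult)
    also have "(3 / 2 :: ennreal) = ennreal (3 / 2)"
      by (subst divide_ennreal[symmetric]) auto
    finally show "(1 - (cmod z)\<^sup>2) ^ 3 * cmod ?v \<le> 3 / 2"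
      by (subst (asm) ennreal_le_iff) auto
  qed
  obtain z1 z2 where z: "z1 \<in> ball 0 1" "z2 \<in> ball 0 1" "z1 \<noteq> z2" "sphere_map f z1 = sphere_map f z2"
    using \<open>\<not> univalent f\<close> by (auto simp: univalent_def inj_on_def)
  interpret s1: disk_automorphism 1 z1 by unfold_locales (use z in auto)
  obtain \<zeta> where \<zeta>: "\<zeta> \<in> ball 0 1" "disk_aut 1 z1 \<zeta> = z2" using s1.surj[OF z(2)] by blast
  have "\<zeta> \<noteq> 0" using \<zeta> z(3) by (auto simp: disk_aut_def)
  \<comment> \<open>The rotation that carries \<open>cmod \<zeta>\<close> to \<open>\<zeta>\<close>,
    so that the preimage of \<open>z2\<close> becomes a positive real number.\<close>
  define e where "e = \<zeta> / cmod \<zeta>"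
  have e: "cmod e = 1" "e * cmod \<zeta> = \<zeta>" using \<open>\<zeta> \<noteq> 0\<close> by (auto simp: e_def norm_divide)
  interpret s: disk_automorphism e z1 by unfold_locales (use z e in auto)
  let ?s = "disk_aut e z1"
  have s0: "?s 0 = z1" by (simp add: disk_aut_def)
  have sx: "?s (of_real (cmod \<zeta>)) = z2"
    using \<zeta>(2) e(2) by (simp add: disk_aut_def mult.assoc)
  have s_lim: "filterlim ?s (at (?s c)) (at c)" if c: "c \<in> ball 0 1" for c
    unfolding filterlim_at
  proof
    have "eventually (\<lambda>z. z \<in> ball 0 1 - {c}) (at c)" using c by (intro eventually_at_in_open) auto
    then show "eventually (\<lambda>z. ?s z \<in> UNIV \<and> ?s z \<noteq> ?s c) (at c)"
      by eventually_elim (use inj_onD[OF s.inj] c in auto)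
    show "(?s \<longlongrightarrow> ?s c) (at c)" using DERIV_isCont[OF s.has_deriv[OF c]] by (rule isContD)
  qed
  have reg: "eventually (\<lambda>z. z \<in> ball 0 1 \<and> f analytic_on {?s z} \<and> deriv f (?s z) \<noteq> 0 \<and> raw_schwarzian f (?s z) = \<phi> (?s z)) (at c)"
    if c: "c \<in> ball 0 1" for c
  proof -
    have "eventually (\<lambda>z. f analytic_on {z} \<and> deriv f z \<noteq> 0 \<and> raw_schwarzian f z = \<phi> z) (at (?s c))"
      using nicely_meromorphic_eventually_analytic[OF nice open_ball s.maps_ball[OF c]]
        nonconstant_deriv_nonzero[OF nice nc s.maps_ball[OF c]] S[OF s.maps_ball[OF c]]
      by eventually_elim auto
    from eventually_compose_filterlim[OF this s_lim[OF c]] eventually_at_in_open'[OF open_ball c]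
    show ?thesis by eventually_elim auto
  qed
  define \<psi> where "\<psi> = (\<lambda>z. \<phi> (?s z) * (deriv ?s z)\<^sup>2)"
  have "(\<lambda>z. \<phi> (?s z)) holomorphic_on ball 0 1"
    by (rule holomorphic_on_compose_gen[OF s.holomorphic \<phi>, unfolded o_def]) (use s.maps_ball in auto)
  then have \<psi>: "\<psi> holomorphic_on ball 0 1"
    unfolding \<psi>_def by (intro holomorphic_intros holomorphic_deriv s.holomorphic) auto
  have \<psi>_bound: "(1 - (cmod z)\<^sup>2)\<^sup>2 * cmod (\<psi> z) \<le> 4 / 3" if z: "z \<in> ball 0 1" for z
  proof -
    have "(1 - (cmod z)\<^sup>2)\<^sup>2 * cmod (\<psi> z) = (cmod (deriv ?s z) * (1 - (cmod z)\<^sup>2))\<^sup>2 * cmod (\<phi> (?s z))"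
      by (simp add: \<psi>_def norm_mult norm_power power_mult_distrib)
    also have "\<dots> \<le> 4 / 3" unfolding s.norm_deriv[OF z] by (rule bound[OF s.maps_ball[OF z]])
    finally show ?thesis .
  qed
  have f_mero_s: "(\<lambda>z. f (?s z)) meromorphic_on ball 0 1"
    by (rule meromorphic_on_compose[OF mero]) (use s.holomorphic s.maps_ball in \<open>auto simp: analytic_on_open\<close>)
  have raw_s: "eventually (\<lambda>z. raw_schwarzian (\<lambda>w. f (?s w)) z = \<psi> z) (at c)" if c: "c \<in> ball 0 1" for c
    using reg[OF c] by eventually_elim (simp add: s.raw_schwarzian_precompose \<psi>_def)
  \<comment> \<open>Stated for a general \<open>G\<close> because it will be f composed with the
    automorphism if the common value is infinity, and the reciprocal of a difference otherwise;
    \<open>remove_sings\<close> then supplies the values that \<open>no_two_poles\<close> requires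
    at poles and removable singularities.\<close>
  have contra: False if G: "G meromorphic_on ball 0 1" "is_pole G 0" "is_pole G (of_real (cmod \<zeta>))"
    "\<And>c. c \<in> ball 0 1 \<Longrightarrow> eventually (\<lambda>z. raw_schwarzian G z = \<psi> z) (at c)" for G
  proof -
    let ?F = "remove_sings G"
    have ev: "eventually (\<lambda>z. ?F z = G z) (at c)" if "c \<in> ball 0 1" for c
      using G(1) that by (intro eventually_remove_sings_eq_at) (metis meromorphic_on_altdef)
    have pole: "is_pole ?F c \<longleftrightarrow> is_pole G c" if "c \<in> ball 0 1" for c
      by (rule is_pole_cong[OF ev[OF that] refl])
    show False
    proof (rule no_two_poles[of ?F \<psi> "cmod \<zeta>"])
      show "?F nicely_meromorphic_on ball 0 1" by (rule remove_sings_nicely_meromorphic[OF G(1)])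
      show "eventually (\<lambda>z. raw_schwarzian ?F z = \<psi> z) (at c)" if "c \<in> ball 0 1" for c
        using eventually_raw_schwarzian_cong[OF ev[OF that]] G(4)[OF that] by eventually_elim simp
    qed (use \<psi> \<psi>_bound \<zeta>(1) \<open>\<zeta> \<noteq> 0\<close> G pole in auto)
  qed
  have x: "of_real (cmod \<zeta>) \<in> ball (0::complex) 1" using \<zeta> by simp
  show False
  proof (cases "is_pole f z1")
    case True
    then have "is_pole f z2" using z(4) by (auto simp: sphere_map_def split: if_splits)
    have "is_pole (\<lambda>z. f (?s z)) c" if "c \<in> ball 0 1" "is_pole f (?s c)" for c
      using that(2) filterlim_compose[OF _ s_lim[OF that(1)]] unfolding is_pole_def by blast
    then show False
      using contra[OF f_mero_s _ _ raw_s] True \<open>is_pole f z2\<close> s0 sx x by simp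
  next
    case False
    define w where "w = f z1"
    have np: "\<not> is_pole f z2" and w2: "f z2 = w"
      using z(4) False by (auto simp: sphere_map_def w_def split: if_splits)
    have ne: "eventually (\<lambda>z. f (?s z) \<noteq> w) (at c)" if c: "c \<in> ball 0 1" for c
    proof -
      have "(\<forall>z\<in>ball 0 1. f z = w) \<or> eventually (\<lambda>z. f z \<noteq> w) (cosparse (ball 0 1))"
        by (rule nicely_meromorphic_imp_constant_or_avoid[OF nice]) auto
      moreover have "\<not> (\<forall>z\<in>ball 0 1. f z = w)" using nc unfolding constant_on_def by blast
      ultimately have "eventually (\<lambda>z. f z \<noteq> w) (at (?s c))"
        using s.maps_ball[OF c] by (auto simp: eventually_cosparse_open_eq)
      from eventually_compose_filterlim[OF this s_lim[OF c]] show ?thesis .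
    qed
    let ?G = "\<lambda>z. 1 / (f (?s z) - w)"
    have pole: "is_pole ?G c" if c: "c \<in> ball 0 1" and "f (?s c) = w" "\<not> is_pole f (?s c)" for c
    proof (rule is_pole_divide)
      have "isCont f (?s c)"
        using nicely_meromorphic_on_imp_analytic_at[OF nice s.maps_ball[OF c]] that analytic_at_imp_isCont by blast
      then have "(f \<longlongrightarrow> w) (at (?s c))" using that(2) isContD by metis
      from filterlim_compose[OF this s_lim[OF c]]
      have "((\<lambda>z. f (?s z) - w) \<longlongrightarrow> w - w) (at c)" by (intro tendsto_intros)
      then show "filterlim (\<lambda>z. f (?s z) - w) (at 0) (at c)"
        unfolding filterlim_at using ne[OF c] by simp
    qed auto
    show False
    proof (rule contra)
      show "?G meromorphic_on ball 0 1" by (intro meromorphic_intros f_mero_s)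
      show "is_pole ?G 0" using pole[of 0] False by (simp add: s0 w_def)
      show "is_pole ?G (of_real (cmod \<zeta>))" using pole[OF x] np w2 by (simp add: sx)
      fix c :: complex assume c: "c \<in> ball 0 1"
      show "eventually (\<lambda>z. raw_schwarzian ?G z = \<psi> z) (at c)"
        using reg[OF c] ne[OF c] raw_s[OF c]
      proof eventually_elim
        case (elim z)
        have s_an: "?s analytic_on {z}" using s.holomorphic elim analytic_at open_ball by blast
        have "(\<lambda>w. f (?s w)) analytic_on {z}"
          using analytic_on_compose_gen[OF s_an, of f "{?s z}"] elim by (simp add: o_def)
        moreover have "deriv (\<lambda>w. f (?s w)) z = deriv f (?s z) * deriv ?s z"
          using DERIV_chain2[OF analytic_at_DERIV analytic_at_DERIV[OF s_an]] elim DERIV_imp_deriv by blast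
        then have "deriv (\<lambda>w. f (?s w)) z \<noteq> 0" using elim s.deriv_nonzero by simp
        ultimately show ?case using raw_schwarzian_reciprocal elim by metis
      qed
    qed
  qed
qed

theorem theorem1p1:
  shows "(\<forall>f. nonconstant_meromorphic f \<and> univalent f \<longrightarrow> weighted_norm 3 (V_op f) \<le> 16)
    \<and> (\<forall>C::ennreal. C < 16 \<longrightarrow>
         \<not> (\<forall>f. nonconstant_meromorphic f \<and> univalent f \<longrightarrow> weighted_norm 3 (V_op f) \<le> C))
    \<and> (\<forall>f. nonconstant_meromorphic f \<and> weighted_norm 3 (V_op f) \<le> 3 / 2 \<longrightarrow> univalent f)"
proof (intro conjI allI impI)
  fix f assume "nonconstant_meromorphic f \<and> univalent f"
  then show "weighted_norm 3 (V_op f) \<le> 16" using univalent_weighted_norm_bound by blast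
next
  fix C :: ennreal assume C: "C < 16"
  have "\<not> weighted_norm 3 (V_op extremal_map) \<le> C"
    using extremal_map_weighted_norm C by (meson order_trans not_le)
  then show "\<not> (\<forall>f. nonconstant_meromorphic f \<and> univalent f \<longrightarrow> weighted_norm 3 (V_op f) \<le> C)"
    using extremal_map_meromorphic extremal_map_univalent by blast
next
  fix f assume "nonconstant_meromorphic f \<and> weighted_norm 3 (V_op f) \<le> 3 / 2"
  then show "univalent f" using small_norm_univalent by blast
qed

end
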